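(* Let $\{f=0\}$ and $\{g=0\}$ be two reduced curves of degree $n\ge 1$ in $\mathbb{P}^2$ with no common component, and let $\mathcal{C}(f,g)=\{C_{\alpha,\beta}=\{\alpha f+\beta g=0\}\mid (\alpha,\beta)\in\mathbb{P}^1\}$ be the pencil they generate. Assume that the general member of $\mathcal{C}(f,g)$ is smooth, that every member $C_{\alpha,\beta}$ is reduced, that the base locus $\{f=g=0\}$ is smooth, i.e. consists of $n^2$ distinct points, and that the Jacobian ideal of the union $D^{\mathrm{sg}}$ of all singular members of the pencil is locally a complete intersection. Let $D_k$ be a union of $k\ge 2$ distinct members of $\mathcal{C}(f,g)$, and assume that $D_k$ contains all the singular members of the pencil except the singular curves $C_{\alpha_i,\beta_i}$, $i=1,\ldots,r$. Let $Z_k$ be the zero scheme of the section $s_{\delta,k}\in \mathrm{H}^0(\mathcal{T}_{D_k}(2n-2))$ induced by $\nabla f\wedge\nabla g$. Then $$\mathcal{J}_{Z_k}=\mathcal{J}_{\nabla C_{\alpha_1,\beta_1}}\otimes\cdots\otimes\mathcal{J}_{\nabla C_{\alpha_r,\beta_r}}.$$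
   Context: $\mathbb{K}$ is a field of characteristic zero, $S=\mathbb{K}[x,y,z]$ and $\mathbb{P}^2=\mathrm{Proj}(S)$. Points of $\mathbb{P}^2$ and parameters $(\alpha,\beta)\in\mathbb{P}^1$ are understood geometrically, i.e. with coordinates in an algebraic closure of $\mathbb{K}$ (curves and sheaves being considered over that closure). For a homogeneous polynomial $F$, $\nabla F=(\partial_xF,\partial_yF,\partial_zF)$. For a reduced curve $D=\{F=0\}\subset\mathbb{P}^2$ of degree $d$, the Jacobian ideal sheaf $\mathcal{J}_{\nabla D}=\mathcal{J}_{\nabla F}\subset\mathcal{O}_{\mathbb{P}^2}$ is the ideal sheaf generated by the partial derivatives of $F$, and $\mathcal{T}_D$ is the rank two vector bundle defined by the exact sequence $$0\to\mathcal{T}_D\to\mathcal{O}_{\mathbb{P}^2}^3\xrightarrow{\nabla F}\mathcal{J}_{\nabla F}(d-1)\to 0.$$ A section of $\mathcal{T}_D(a)$ is the same as a triple $(P,Q,R)$ of forms of degree $a$ such that $P\partial_xF+Q\partial_yF+R\partial_zF=0$. The triple $$\nabla f\wedge\nabla g=(\partial_y f\,\partial_z g-\partial_z f\,\partial_y g,\ \partial_z f\,\partial_x g-\partial_x f\,\partial_z g,\ \partial_x f\,\partial_y g-\partial_y f\,\partial_x g)$$ of forms of degree $2n-2$ satisfies this for $F=\prod_{i}(a_if+b_ig)$, the equation of any union $D_k=\bigcup_i C_{a_i,b_i}$ of members of the pencil, hence defines the section $s_{\delta,k}\in\mathrm{H}^0(\mathcal{T}_{D_k}(2n-2))$. For a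 closed subscheme $Z$, $\mathcal{J}_Z\subset\mathcal{O}_{\mathbb{P}^2}$ denotes its ideal sheaf. An empty tensor product ($r=0$) is $\mathcal{O}_{\mathbb{P}^2}$. An ideal sheaf is locally a complete intersection if at every point of its zero locus its stalk can be generated by two elements. *)

theory Defs
  imports "HOL-Algebra.Algebraic_Closure_Type" "HOL-Library.Poly_Mapping" "HOL-Library.FuncSet"
    "HOL-Library.Product_Plus"
begin

section \<open>Forms in three variables\<close>

text \<open>
  The polynomial ring in \<open>x, y, z\<close> is the iterated polynomial ring \<open>K[x][y][z]\<close>:
  the outermost variable is \<open>z\<close>, the innermost one is \<open>x\<close>.
\<close>

type_synonym 'a poly3 = "'a poly poly poly"

type_synonym 'a ratfun3 = "'a poly poly poly fract"

definition const3 :: "'a::zero \<Rightarrow> 'a poly3" where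
  "const3 c = [:[:[:c:]:]:]"

definition eval3 :: "'a::comm_semiring_0 poly3 \<Rightarrow> 'a \<times> 'a \<times> 'a \<Rightarrow> 'a" where
  "eval3 F = (\<lambda>(x, y, z). poly (poly (poly F [:[:z:]:]) [:y:]) x)"

definition homogeneous :: "nat \<Rightarrow> 'a::zero poly3 \<Rightarrow> bool" where
  "homogeneous d F \<longleftrightarrow>
     (\<forall>i j k. Polynomial.coeff (Polynomial.coeff (Polynomial.coeff F k) j) i \<noteq> 0 \<longrightarrow> i + j + k = d)"

definition ddx :: "'a::idom poly3 \<Rightarrow> 'a poly3" where "ddx F = map_poly (map_poly pderiv) F"
definition ddy :: "'a::idom poly3 \<Rightarrow> 'a poly3" where "ddy F = map_poly pderiv F"
definition ddz :: "'a::idom poly3 \<Rightarrow> 'a poly3" where "ddz F = pderiv F"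

definition base_change :: "'k::field poly3 \<Rightarrow> 'k alg_closure poly3" where
  "base_change F = map_poly (map_poly (map_poly to_ac)) F"


section \<open>The projective plane and its sheaves\<close>

text \<open>A point of the projective plane is the set of all its homogeneous coordinate vectors.\<close>

type_synonym 'a point = "('a \<times> 'a \<times> 'a) set"

definition proj_rel :: "(('a::field \<times> 'a \<times> 'a) \<times> ('a \<times> 'a \<times> 'a)) set" where
  "proj_rel = {((x, y, z), (x', y', z')) | x y z x' y' z'.
      (x, y, z) \<noteq> (0, 0, 0) \<and> (\<exists>c. c \<noteq> 0 \<and> x' = c * x \<and> y' = c * y \<and> z' = c * z)}"

definition P2 :: "'a::field point set" where
  "P2 = (UNIV - {(0, 0, 0)}) // proj_rel"

definition vanishes_at :: "'a::field poly3 \<Rightarrow> 'a point \<Rightarrow> bool" where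
  "vanishes_at F p \<longleftrightarrow> (\<forall>v\<in>p. eval3 F v = 0)"

definition zariski_open :: "'a::field point set \<Rightarrow> bool" where
  "zariski_open U \<longleftrightarrow> (\<exists>S. (\<forall>F\<in>S. \<exists>d. homogeneous d F) \<and> U = {p\<in>P2. \<exists>F\<in>S. \<not> vanishes_at F p})"

text \<open>
  The plane is integral, so the twisting sheaves \<open>\<O>(a)\<close> are subsheaves of the constant sheaf
  of rational functions.  A subsheaf of a constant sheaf is given by its stalks: its
  sections over a nonempty open set \<open>U\<close> are the elements lying in the stalk at every point of
  \<open>U\<close>.  Ideal sheaves are represented in this way throughout, as families of stalks.
\<close>

definition twist :: "int \<Rightarrow> 'a::field point \<Rightarrow> 'a ratfun3 set" where
  "twist a p = {Fract A B | A B i j.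
      homogeneous i A \<and> homogeneous j B \<and> \<not> vanishes_at B p \<and> int i - int j = a}"

abbreviation structure_sheaf :: "'a::field point \<Rightarrow> 'a ratfun3 set" where
  "structure_sheaf \<equiv> twist 0"

definition sections_over :: "'a point set \<Rightarrow> ('a point \<Rightarrow> 'b set) \<Rightarrow> 'b set" where
  "sections_over U M = (\<Inter>p\<in>U. M p)"

definition to_ratfun :: "'a::field poly3 \<Rightarrow> 'a ratfun3" where
  "to_ratfun F = Fract F 1"

text \<open>
  Jacobian ideal sheaf of a form \<open>F\<close> of degree \<open>d\<close>: the image of
  \<open>\<nabla>F : \<O>(1 - d)\<^sup>3 \<rightarrow> \<O>\<close>.
\<close>

definition jacobian_sheaf :: "nat \<Rightarrow> 'a::field poly3 \<Rightarrow> 'a point \<Rightarrow> 'a ratfun3 set" where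
  "jacobian_sheaf d F p =
     {A * to_ratfun (ddx F) + B * to_ratfun (ddy F) + C * to_ratfun (ddz F) | A B C.
        A \<in> twist (1 - int d) p \<and> B \<in> twist (1 - int d) p \<and> C \<in> twist (1 - int d) p}"

definition locally_complete_intersection :: "('a::field point \<Rightarrow> 'a ratfun3 set) \<Rightarrow> bool" where
  "locally_complete_intersection J \<longleftrightarrow>
     (\<forall>p\<in>P2. J p \<noteq> structure_sheaf p \<longrightarrow>
        (\<exists>u\<in>J p. \<exists>v\<in>J p. J p = {a * u + b * v | a b. a \<in> structure_sheaf p \<and> b \<in> structure_sheaf p}))"

text \<open>The stalks of \<open>\<T>\<^sub>D(a)\<close>, the kernel of \<open>\<nabla>F : \<O>(a)\<^sup>3 \<rightarrow> \<O>(a + d - 1)\<close>.\<close>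

definition log_tangent_sheaf ::
    "'a::field poly3 \<Rightarrow> int \<Rightarrow> 'a point \<Rightarrow> ('a ratfun3 \<times> 'a ratfun3 \<times> 'a ratfun3) set" where
  "log_tangent_sheaf F a p =
     {(P, Q, R). P \<in> twist a p \<and> Q \<in> twist a p \<and> R \<in> twist a p \<and>
        P * to_ratfun (ddx F) + Q * to_ratfun (ddy F) + R * to_ratfun (ddz F) = 0}"

definition linear_functional ::
    "'b::comm_ring_1 set \<Rightarrow> ('b \<times> 'b \<times> 'b) set \<Rightarrow> ('b \<times> 'b \<times> 'b \<Rightarrow> 'b) \<Rightarrow> bool" where
  "linear_functional R E \<phi> \<longleftrightarrow>
     (\<forall>s\<in>E. \<phi> s \<in> R) \<and>
     (\<forall>s\<in>E. \<forall>t\<in>E. \<phi> (s + t) = \<phi> s + \<phi> t) \<and>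
     (\<forall>c\<in>R. \<forall>P Q S. (P, Q, S) \<in> E \<longrightarrow> \<phi> (c * P, c * Q, c * S) = c * \<phi> (P, Q, S))"

text \<open>
  The zero scheme of a section \<open>s\<close> of a vector bundle \<open>\<E>\<close> has as its ideal sheaf the image of
  \<open>s\<^sup>\<or> : \<E>\<^sup>\<or> \<rightarrow> \<O>\<close>, \<open>\<phi> \<mapsto> \<phi>(s)\<close>; in a local frame this is the ideal generated by the
  coordinates of \<open>s\<close>.  Here \<open>\<E>\<close> is \<open>\<T>\<^sub>D(a)\<close>.
\<close>

definition zero_scheme_sheaf ::
    "'a::field poly3 \<Rightarrow> int \<Rightarrow> 'a ratfun3 \<times> 'a ratfun3 \<times> 'a ratfun3 \<Rightarrow> 'a point \<Rightarrow> 'a ratfun3 set" where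
  "zero_scheme_sheaf F a s p =
     {\<phi> s | \<phi>. linear_functional (structure_sheaf p) (log_tangent_sheaf F a p) \<phi>}"


section \<open>Tensor products of ideal sheaves\<close>

text \<open>
  The tensor product over a subring \<open>R\<close> of the submodules \<open>M i\<close>, \<open>i \<in> I\<close>, of an ambient ring: the free
  \<open>R\<close>-module on the tuples in the product of the \<open>M i\<close>, modulo the relations making the
  tuple symbol additive and homogeneous in each coordinate.  For empty \<open>I\<close> there is a
  single tuple and no relation, so that the tensor product is \<open>R\<close>.
\<close>

definition formal_tensors :: "'b::comm_ring_1 set \<Rightarrow> 'i set \<Rightarrow> ('i \<Rightarrow> 'b set) \<Rightarrow> (('i \<Rightarrow> 'b) \<Rightarrow>\<^sub>0 'b) set" where
  "formal_tensors R I M = {t. Poly_Mapping.keys t \<subseteq> (\<Pi>\<^sub>E i\<in>I. M i) \<and> range (Poly_Mapping.lookup t) \<subseteq> R}"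

inductive_set tensor_relations ::
    "'b::comm_ring_1 set \<Rightarrow> 'i set \<Rightarrow> ('i \<Rightarrow> 'b set) \<Rightarrow> (('i \<Rightarrow> 'b) \<Rightarrow>\<^sub>0 'b) set"
  for R I M where
  zero: "0 \<in> tensor_relations R I M"
| sum: "\<lbrakk>s \<in> tensor_relations R I M; t \<in> tensor_relations R I M\<rbrakk> \<Longrightarrow> s + t \<in> tensor_relations R I M"
| additive: "\<lbrakk>c \<in> R; x \<in> (\<Pi>\<^sub>E i\<in>I. M i); i \<in> I; u \<in> M i; v \<in> M i\<rbrakk> \<Longrightarrow>
    Poly_Mapping.single (x(i := u + v)) c - Poly_Mapping.single (x(i := u)) c
      - Poly_Mapping.single (x(i := v)) c \<in> tensor_relations R I M"
| scaling: "\<lbrakk>c \<in> R; x \<in> (\<Pi>\<^sub>E i\<in>I. M i); i \<in> I; a \<in> R; u \<in> M i\<rbrakk> \<Longrightarrow>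
    Poly_Mapping.single (x(i := a * u)) c - Poly_Mapping.single (x(i := u)) (c * a)
      \<in> tensor_relations R I M"

definition tensor_rel ::
    "'b::comm_ring_1 set \<Rightarrow> 'i set \<Rightarrow> ('i \<Rightarrow> 'b set) \<Rightarrow> ((('i \<Rightarrow> 'b) \<Rightarrow>\<^sub>0 'b) \<times> (('i \<Rightarrow> 'b) \<Rightarrow>\<^sub>0 'b)) set" where
  "tensor_rel R I M = {(s, t). s \<in> formal_tensors R I M \<and> t \<in> formal_tensors R I M \<and>
      s - t \<in> tensor_relations R I M}"

definition tensor_product ::
    "'b::comm_ring_1 set \<Rightarrow> 'i set \<Rightarrow> ('i \<Rightarrow> 'b set) \<Rightarrow> (('i \<Rightarrow> 'b) \<Rightarrow>\<^sub>0 'b) set set" where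
  "tensor_product R I M = formal_tensors R I M // tensor_rel R I M"

text \<open>The multiplication map; it is constant on the classes.\<close>

definition formal_mult :: "'i set \<Rightarrow> (('i \<Rightarrow> 'b::comm_ring_1) \<Rightarrow>\<^sub>0 'b) \<Rightarrow> 'b" where
  "formal_mult I t = (\<Sum>x\<in>Poly_Mapping.keys t. Poly_Mapping.lookup t x * (\<Prod>i\<in>I. x i))"

definition tensor_mult :: "'i set \<Rightarrow> (('i \<Rightarrow> 'b::comm_ring_1) \<Rightarrow>\<^sub>0 'b) set \<Rightarrow> 'b" where
  "tensor_mult I T = the_elem (formal_mult I ` T)"

text \<open>
  The sheaf tensor product over \<open>\<O>\<close>, that is the sheafification of
  \<open>V \<mapsto> \<Otimes>\<^sub>i J\<^sub>i(V)\<close> over \<open>\<O>(V)\<close>: a section over \<open>U\<close> is a family of elements of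
  the tensor products of the stalks which locally comes from the presheaf.
\<close>

definition tensor_sheaf_sections ::
    "'i set \<Rightarrow> ('i \<Rightarrow> 'a::field point \<Rightarrow> 'a ratfun3 set) \<Rightarrow> 'a point set \<Rightarrow>
     ('a point \<Rightarrow> (('i \<Rightarrow> 'a ratfun3) \<Rightarrow>\<^sub>0 'a ratfun3) set) set" where
  "tensor_sheaf_sections I J U =
     {\<sigma> \<in> (\<Pi>\<^sub>E p\<in>U. tensor_product (structure_sheaf p) I (\<lambda>i. J i p)).
        \<forall>p\<in>U. \<exists>V. zariski_open V \<and> p \<in> V \<and> V \<subseteq> U \<and>
          (\<exists>t \<in> formal_tensors (sections_over V structure_sheaf) I (\<lambda>i. sections_over V (J i)).
             \<forall>q\<in>V. \<sigma> q = tensor_rel (structure_sheaf q) I (\<lambda>i. J i q) `` {t})}"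

text \<open>
  Equality of an ideal sheaf \<open>J\<close> with a tensor product of ideal sheaves \<open>J\<^sub>i\<close>, understood through the
  canonical multiplication morphism \<open>\<Otimes>\<^sub>i J\<^sub>i \<rightarrow> \<O>\<close>: this morphism is an isomorphism onto \<open>J\<close>, that is,
  over every nonempty open set it maps the sections of the tensor product bijectively onto
  the sections of \<open>J\<close>.
\<close>

definition ideal_sheaf_eq_tensor ::
    "('a::field point \<Rightarrow> 'a ratfun3 set) \<Rightarrow> 'i set \<Rightarrow> ('i \<Rightarrow> 'a point \<Rightarrow> 'a ratfun3 set) \<Rightarrow> bool" where
  "ideal_sheaf_eq_tensor J I Js \<longleftrightarrow>
     (\<forall>U. zariski_open U \<and> U \<noteq> {} \<longrightarrow>
        (\<forall>\<sigma>\<in>tensor_sheaf_sections I Js U. \<exists>h\<in>sections_over U J. \<forall>p\<in>U. tensor_mult I (\<sigma> p) = h) \<and>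
        (\<forall>h\<in>sections_over U J. \<exists>!\<sigma>. \<sigma> \<in> tensor_sheaf_sections I Js U \<and> (\<forall>p\<in>U. tensor_mult I (\<sigma> p) = h)))"


section \<open>Curves and pencils\<close>

definition singular_curve :: "'a::field poly3 \<Rightarrow> bool" where
  "singular_curve F \<longleftrightarrow>
     (\<exists>p\<in>P2. vanishes_at F p \<and> vanishes_at (ddx F) p \<and> vanishes_at (ddy F) p \<and> vanishes_at (ddz F) p)"

definition pencil_member :: "'a::field poly3 \<Rightarrow> 'a poly3 \<Rightarrow> 'a \<times> 'a \<Rightarrow> 'a poly3" where
  "pencil_member f g = (\<lambda>(a, b). const3 a * f + const3 b * g)"

definition same_param :: "'a::field \<times> 'a \<Rightarrow> 'a \<times> 'a \<Rightarrow> bool" where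
  "same_param = (\<lambda>(a, b) (c, d). \<exists>t. t \<noteq> 0 \<and> a = t * c \<and> b = t * d)"

definition distinct_params :: "'i set \<Rightarrow> ('i \<Rightarrow> 'a::field \<times> 'a) \<Rightarrow> bool" where
  "distinct_params I q \<longleftrightarrow>
     (\<forall>i\<in>I. q i \<noteq> (0, 0)) \<and> (\<forall>i\<in>I. \<forall>j\<in>I. i \<noteq> j \<longrightarrow> \<not> same_param (q i) (q j))"

definition union_of_members :: "'a::field poly3 \<Rightarrow> 'a poly3 \<Rightarrow> 'i set \<Rightarrow> ('i \<Rightarrow> 'a \<times> 'a) \<Rightarrow> 'a poly3" where
  "union_of_members f g I q = (\<Prod>i\<in>I. pencil_member f g (q i))"

text \<open>The nonempty Zariski-open subsets of the parameter line are the cofinite ones.\<close>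

definition general_member_smooth :: "'a::field poly3 \<Rightarrow> 'a poly3 \<Rightarrow> bool" where
  "general_member_smooth f g \<longleftrightarrow>
     (\<exists>E. finite E \<and>
        (\<forall>q. q \<noteq> (0, 0) \<and> (\<forall>e\<in>E. \<not> same_param q e) \<longrightarrow> \<not> singular_curve (pencil_member f g q)))"

definition gradient_wedge ::
    "'a::field poly3 \<Rightarrow> 'a poly3 \<Rightarrow> 'a ratfun3 \<times> 'a ratfun3 \<times> 'a ratfun3" where
  "gradient_wedge f g =
     (to_ratfun (ddy f * ddz g - ddz f * ddy g),
      to_ratfun (ddz f * ddx g - ddx f * ddz g),
      to_ratfun (ddx f * ddy g - ddy f * ddx g))"

end

theory Submission
  imports Defs
begin

text \<open>
  Everything is decided on stalks.  Counting the conditions that points impose on forms shows that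
  \<open>f\<close> and \<open>g\<close> meet transversally, so \<open>s = \<nabla>f \<and> \<nabla>g\<close> vanishes only off the base locus, at the singular
  points of members, and at each point at most one of the ideals \<open>J\<^sub>i\<close> is nontrivial.

  Let \<open>v\<close> be a singular point of a member \<open>l\<close>, and \<open>g\<close> a member not through \<open>v\<close>.  Three generators of
  the Jacobian ideal of \<open>D\<^sup>s\<^sup>g\<close> at \<open>v\<close>, two of which suffice, satisfy a relation with a unit coefficient.
  It is a vector field, not vanishing at \<open>v\<close>, that annihilates the equation of \<open>D\<^sup>s\<^sup>g\<close>.  A reduced
  curve has no nonvanishing tangent field at a singular point, so at \<open>v\<close> this field is a nonzero multiple of the
  Euler field.  Corrected by the Euler field it becomes a field \<open>\<chi>\<close> with \<open>\<chi>(l) = l\<close> and \<open>\<chi>(g) = 0\<close>, so that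
  \<open>l/g\<close> lies in the ideal of its own derivatives, as for a quasi-homogeneous singularity.

  If \<open>l\<close> is not in \<open>D\<^sub>k\<close>, then \<open>\<T>\<close> is a direct summand of the trivial bundle near \<open>v\<close>, so the ideal of \<open>Z\<^sub>k\<close> is
  generated by the components of \<open>s\<close>, which by the existence of \<open>\<chi>\<close> generate the Jacobian ideal of \<open>l\<close>.  If
  \<open>l\<close> is in \<open>D\<^sub>k\<close>, every section of \<open>\<T>\<close> is a combination of the Euler field, \<open>\<chi>\<close> and \<open>s\<close>, and the
  coefficient of \<open>s\<close> is a functional with value \<open>1\<close> on \<open>s\<close>.
\<close>

subsection \<open>Forms in three variables\<close>

text \<open>Intersection theory enters through one count, \<open>combination_in_ideal\<close>: more
  than \<open>a * b\<close> forms of one large degree are linearly dependent modulo two coprime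
  forms of degrees \<open>a\<close> and \<open>b\<close>. It serves at the base points and again for
  reduced curves: up to a factor not vanishing at \<open>v\<close>, a power of any linear form
  vanishing at \<open>v\<close> lies in the Jacobian ideal. This excludes nonvanishing tangent
  fields at a singular point: the field preserves the ideal, and in characteristic zero
  differentiation lowers the power to a unit, without power series. In homogeneous coordinates a
  field counts as zero at \<open>v\<close> when its value is proportional to \<open>v\<close>, so
  directions are tested by linear forms vanishing at \<open>v\<close>.

  The field given by the hypothesis on the union annihilates a product, not \<open>l\<close>. Off
  the base locus the other members are units at \<open>v\<close>, and writing the product as a
  binary form in \<open>l\<close> and \<open>g\<close> isolates \<open>l\<close>.

  The coefficient of \<open>s\<close> in a section is a priori only rational. It is regular because
  its product with \<open>s\<close> controls its products with \<open>l\<close> and the gradient of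
  \<open>l\<close>, and a squarefree \<open>l\<close> is coprime to some combination of its
  derivatives.\<close>

abbreviation coeff3 :: "'a::zero poly3 \<Rightarrow> nat \<Rightarrow> nat \<Rightarrow> nat \<Rightarrow> 'a" where
  "coeff3 F i j k \<equiv> Polynomial.coeff (Polynomial.coeff (Polynomial.coeff F k) j) i"

lemma poly3_eqI: "(\<And>i j k. coeff3 F i j k = coeff3 G i j k) \<Longrightarrow> F = G"
  by (intro poly_eqI) auto

lemma poly3_nonzeroE:
  assumes "F \<noteq> 0"
  obtains i j k where "coeff3 F i j k \<noteq> 0"
proof -
  have "\<exists>i j k. coeff3 F i j k \<noteq> 0"
    using assms poly3_eqI[where F = F and G = 0] by (metis coeff_0)
  then show ?thesis using that by blast
qed

lemma coeff3_mult:
  fixes F G :: "'a::comm_semiring_0 poly3"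
  shows "coeff3 (F * G) i j k =
     (\<Sum>c\<le>k. \<Sum>b\<le>j. \<Sum>a\<le>i. coeff3 F a b c * coeff3 G (i - a) (j - b) (k - c))"
  by (simp add: coeff_mult coeff_sum)

abbreviation X3 :: "'a::comm_semiring_1 poly3" where "X3 \<equiv> [:[:[:0, 1:]:]:]"
abbreviation Y3 :: "'a::comm_semiring_1 poly3" where "Y3 \<equiv> [:[:0, 1:]:]"
abbreviation Z3 :: "'a::comm_semiring_1 poly3" where "Z3 \<equiv> [:0, 1:]"

lemma coeff3_const3_mult [simp]: "coeff3 (const3 (c::'a::comm_semiring_0) * F) i j k = c * coeff3 F i j k"
  by (simp add: const3_def)

lemma coeff3_X3_mult: "coeff3 (X3 * F) i j k = (if i = 0 then 0 else coeff3 F (i - 1) j k)"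
  by (cases i) (simp_all)

lemma coeff3_Y3_mult: "coeff3 (Y3 * F) i j k = (if j = 0 then 0 else coeff3 F i (j - 1) k)"
  by (cases j) (simp_all)

lemma coeff3_Z3_mult: "coeff3 (Z3 * F) i j k = (if k = 0 then 0 else coeff3 F i j (k - 1))"
  by (cases k) (simp_all)

lemma const3_add: "const3 (a + b) = const3 a + const3 (b::'a::comm_ring_1)"
  by (simp add: const3_def)
lemma const3_diff: "const3 (a - b) = const3 a - const3 (b::'a::comm_ring_1)"
  by (simp add: const3_def)
lemma const3_mult: "const3 (a * b) = const3 a * const3 (b::'a::comm_ring_1)"
  by (simp add: const3_def)
lemma const3_0 [simp]: "const3 0 = 0"
  by (simp add: const3_def)
lemma const3_1 [simp]: "const3 1 = (1::'a::comm_ring_1 poly3)"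
  by (simp add: const3_def one_pCons)
lemma const3_of_nat [simp]: "const3 (of_nat n) = (of_nat n :: 'a::comm_ring_1 poly3)"
  by (induction n) (simp_all add: const3_add)

section \<open>Evaluation of polynomials at coordinate vectors\<close>

lemma eval3_0 [simp]: "eval3 0 v = 0"
  by (cases v) (simp add: eval3_def)
lemma eval3_1 [simp]: "eval3 1 v = (1::'a::comm_semiring_1)"
  by (cases v) (simp add: eval3_def)
lemma eval3_add [simp]: "eval3 (F + G) v = eval3 F v + eval3 G v"
  by (cases v) (simp add: eval3_def)
lemma eval3_mult [simp]: "eval3 (F * G) v = eval3 F v * eval3 G v"
  by (cases v) (simp add: eval3_def)
lemma eval3_minus [simp]: "eval3 (- F) v = - eval3 (F::'a::comm_ring_1 poly3) v"
  by (cases v) (simp add: eval3_def)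
lemma eval3_diff [simp]: "eval3 (F - G) v = eval3 F v - eval3 (G::'a::comm_ring_1 poly3) v"
  by (cases v) (simp add: eval3_def)
lemma eval3_power [simp]: "eval3 (F ^ n) v = eval3 (F::'a::comm_semiring_1 poly3) v ^ n"
  by (cases v) (simp add: eval3_def poly_power)
lemma eval3_sum [simp]: "eval3 (sum F A) v = (\<Sum>i\<in>A. eval3 (F i) v)"
  by (induction A rule: infinite_finite_induct) auto
lemma eval3_prod [simp]: "eval3 (prod F A) v = (\<Prod>i\<in>A. eval3 (F i :: 'a::comm_semiring_1 poly3) v)"
  by (induction A rule: infinite_finite_induct) auto
lemma eval3_const3 [simp]: "eval3 (const3 c) v = c"
  by (cases v) (simp add: eval3_def const3_def)
lemma eval3_X3 [simp]: "eval3 X3 (x, y, z) = x"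
  by (simp add: eval3_def)
lemma eval3_Y3 [simp]: "eval3 Y3 (x, y, z) = y"
  by (simp add: eval3_def)
lemma eval3_Z3 [simp]: "eval3 Z3 (x, y, z) = z"
  by (simp add: eval3_def)
lemma eval3_of_nat [simp]: "eval3 (of_nat n) v = (of_nat n :: 'a::comm_ring_1)"
  by (metis const3_of_nat eval3_const3)

lemma eval3_altdef:
  "eval3 F (x, y, z) = (\<Sum>k\<le>degree F. \<Sum>j\<le>degree (Polynomial.coeff F k).
     \<Sum>i\<le>degree (Polynomial.coeff (Polynomial.coeff F k) j).
       coeff3 F i j k * (x ^ i * y ^ j * z ^ k :: 'a::comm_semiring_1))"
proof -
  have "eval3 F (x, y, z) = (\<Sum>k\<le>degree F. poly (poly (Polynomial.coeff F k) [:y:]) x * z ^ k)"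
    by (simp add: eval3_def poly_altdef[of F] poly_sum poly_power)
  moreover have "poly (poly p [:y:]) x = (\<Sum>j\<le>degree p. poly (Polynomial.coeff p j) x * y ^ j)"
    for p :: "'a poly poly"
    by (simp add: poly_altdef[of p] poly_sum poly_power)
  ultimately have "eval3 F (x, y, z) = (\<Sum>k\<le>degree F. (\<Sum>j\<le>degree (Polynomial.coeff F k).
      poly (Polynomial.coeff (Polynomial.coeff F k) j) x * y ^ j) * z ^ k)"
    by simp
  then show ?thesis
    by (simp add: poly_altdef[where x = x] sum_distrib_right mult.assoc)
qed

lemma eval3_scale:
  fixes F :: "'a::comm_semiring_1 poly3"
  assumes "homogeneous d F"
  shows "eval3 F (c * x, c * y, c * z) = c ^ d * eval3 F (x, y, z)"
proof -
  have "coeff3 F i j k * ((c * x) ^ i * (c * y) ^ j * (c * z) ^ k) =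
      c ^ d * (coeff3 F i j k * (x ^ i * y ^ j * z ^ k))" for i j k
  proof (cases "coeff3 F i j k = 0")
    case False
    then have "d = i + j + k" using assms by (auto simp: homogeneous_def)
    then show ?thesis by (simp add: power_mult_distrib power_add ac_simps)
  qed auto
  then show ?thesis unfolding eval3_altdef by (simp add: sum_distrib_left)
qed

text \<open>A nonzero polynomial over a domain has finitely many roots, while an infinite field
  supplies infinitely many constants; this is applied one variable at a time, the outermost
  last.\<close>

lemma eval3_nonzero:
  fixes F :: "'a::field_char_0 poly3"
  assumes "F \<noteq> 0"
  shows "\<exists>v. eval3 F v \<noteq> 0"
proof (rule ccontr)
  assume "\<nexists>v. eval3 F v \<noteq> 0"
  then have *: "poly (poly (poly F [:[:z:]:]) [:y:]) x = 0" for x y z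
    by (auto simp: eval3_def)
  then have A: "poly (poly F [:[:z:]:]) [:y:] = 0" for y z
    using poly_all_0_iff_0 by blast
  have inf: "infinite (range (\<lambda>z::'a. [:z:]))"
    using finite_imageD[of "\<lambda>z::'a. [:z:]" UNIV] infinite_UNIV_char_0 by (auto simp: inj_on_def)
  have inf2: "infinite (range (\<lambda>z::'a. [:[:z:]:]))"
    using finite_imageD[of "\<lambda>z::'a. [:[:z:]:]" UNIV] infinite_UNIV_char_0 by (auto simp: inj_on_def)
  have B: "poly F [:[:z:]:] = 0" for z
  proof (rule ccontr)
    assume "poly F [:[:z:]:] \<noteq> 0"
    then have "finite {x. poly (poly F [:[:z:]:]) x = 0}" by (rule poly_roots_finite)
    with A inf show False by (metis (mono_tags, lifting) finite_subset image_subsetI mem_Collect_eq)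
  qed
  from assms have "finite {x. poly F x = 0}" by (rule poly_roots_finite)
  with B inf2 show False by (metis (mono_tags, lifting) finite_subset image_subsetI mem_Collect_eq)
qed

section \<open>Homogeneous polynomials and their factors\<close>

lemma homogeneousD: "homogeneous d F \<Longrightarrow> coeff3 F i j k \<noteq> 0 \<Longrightarrow> i + j + k = d"
  by (auto simp: homogeneous_def)

lemma homogeneous_0 [simp]: "homogeneous d 0"
  by (simp add: homogeneous_def)

lemma homogeneous_const3 [simp]: "homogeneous 0 (const3 c)"
  by (auto simp: homogeneous_def const3_def coeff_pCons split: nat.splits)

lemma homogeneous_1 [simp]: "homogeneous 0 (1::'a::comm_ring_1 poly3)"
  using homogeneous_const3[of "1::'a"] by simp

lemma homogeneous_of_nat [simp]: "homogeneous 0 (of_nat n::'a::comm_ring_1 poly3)"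
  using homogeneous_const3[of "of_nat n::'a"] by simp

lemma homogeneous_X3 [simp]: "homogeneous (Suc 0) X3"
  by (auto simp: homogeneous_def coeff_pCons split: nat.splits)
lemma homogeneous_Y3 [simp]: "homogeneous (Suc 0) Y3"
  by (auto simp: homogeneous_def coeff_pCons split: nat.splits)
lemma homogeneous_Z3 [simp]: "homogeneous (Suc 0) Z3"
  by (auto simp: homogeneous_def coeff_pCons split: nat.splits)

lemma homogeneous_add:
  "homogeneous d F \<Longrightarrow> homogeneous d G \<Longrightarrow> homogeneous d (F + G :: 'a::comm_monoid_add poly3)"
  unfolding homogeneous_def coeff_add by (metis add_0)

lemma homogeneous_minus: "homogeneous d F \<Longrightarrow> homogeneous d (- F :: 'a::comm_ring_1 poly3)"
  by (simp add: homogeneous_def)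

lemma homogeneous_diff:
  "homogeneous d F \<Longrightarrow> homogeneous d G \<Longrightarrow> homogeneous d (F - G :: 'a::comm_ring_1 poly3)"
  using homogeneous_add[of d F "- G"] homogeneous_minus[of d G] by simp

lemma homogeneous_sum:
  "(\<And>i. i \<in> A \<Longrightarrow> homogeneous d (F i)) \<Longrightarrow> homogeneous d (sum F A :: 'a::comm_monoid_add poly3)"
  by (induction A rule: infinite_finite_induct) (auto intro: homogeneous_add)

lemma homogeneous_mult:
  fixes F G :: "'a::comm_semiring_0 poly3"
  assumes "homogeneous d F" "homogeneous e G"
  shows "homogeneous (d + e) (F * G)"
  unfolding homogeneous_def
proof (intro allI impI)
  fix i j k assume "coeff3 (F * G) i j k \<noteq> 0"
  then have "(\<Sum>c\<le>k. \<Sum>b\<le>j. \<Sum>a\<le>i. coeff3 F a b c * coeff3 G (i - a) (j - b) (k - c)) \<noteq> 0"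
    by (simp only: coeff3_mult not_False_eq_True)
  then obtain a b c where "a \<le> i" "b \<le> j" "c \<le> k"
    and *: "coeff3 F a b c * coeff3 G (i - a) (j - b) (k - c) \<noteq> 0"
    by (meson atMost_iff sum.not_neutral_contains_not_neutral)
  from * have "coeff3 F a b c \<noteq> 0" "coeff3 G (i - a) (j - b) (k - c) \<noteq> 0" by auto
  then have "a + b + c = d" "(i - a) + (j - b) + (k - c) = e"
    using assms by (auto dest: homogeneousD)
  with \<open>a \<le> i\<close> \<open>b \<le> j\<close> \<open>c \<le> k\<close> show "i + j + k = d + e" by linarith
qed

lemma homogeneous_const3_mult: "homogeneous d F \<Longrightarrow> homogeneous d (const3 c * F)"
  using homogeneous_mult[of 0 "const3 c" d F] by simp

lemma homogeneous_power:
  "homogeneous d F \<Longrightarrow> homogeneous (m * d) (F ^ m :: 'a::comm_ring_1 poly3)"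
  by (induction m) (auto intro: homogeneous_mult)

lemma homogeneous_prod:
  "finite A \<Longrightarrow> (\<And>i. i \<in> A \<Longrightarrow> homogeneous (d i) (F i)) \<Longrightarrow>
     homogeneous (sum d A) (prod F A :: 'a::comm_ring_1 poly3)"
  by (induction A rule: finite_induct) (auto intro: homogeneous_mult)

lemma homogeneous_unique:
  assumes "homogeneous d F" "homogeneous e F" "F \<noteq> 0"
  shows "d = e"
proof -
  obtain i j k where "coeff3 F i j k \<noteq> 0" using assms(3) by (blast elim: poly3_nonzeroE)
  with assms show ?thesis by (metis homogeneousD)
qed

text \<open>The homogeneous component of degree \<open>e\<close>.\<close>

definition comp3 :: "nat \<Rightarrow> 'a::comm_monoid_add poly3 \<Rightarrow> 'a poly3" where
  "comp3 e F = (\<Sum>k\<le>e. monom (\<Sum>j\<le>e. monom (\<Sum>i\<le>e.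
     monom (if i + j + k = e then coeff3 F i j k else 0) i) j) k)"

lemma coeff_sum_monom: "Polynomial.coeff (\<Sum>k\<le>e. monom (h k) k) n = (if n \<le> e then h n else 0)"
proof -
  have "Polynomial.coeff (\<Sum>k\<le>e. monom (h k) k) n = (\<Sum>k\<le>e. if k = n then h n else 0)"
    unfolding coeff_sum by (intro sum.cong) auto
  then show ?thesis by simp
qed

lemma coeff3_comp3: "coeff3 (comp3 e F) i j k = (if i + j + k = e then coeff3 F i j k else 0)"
  by (simp add: comp3_def coeff_sum_monom)

lemma comp3_mult:
  fixes F G :: "'a::comm_semiring_0 poly3"
  shows "comp3 e (F * G) = (\<Sum>s\<le>e. comp3 s F * comp3 (e - s) G)"
proof (rule poly3_eqI)
  fix i j k
  have "coeff3 (\<Sum>s\<le>e. comp3 s F * comp3 (e - s) G) i j k =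
    (\<Sum>c\<le>k. \<Sum>b\<le>j. \<Sum>a\<le>i. \<Sum>s\<le>e. coeff3 (comp3 s F) a b c *
        coeff3 (comp3 (e - s) G) (i - a) (j - b) (k - c))"
    unfolding coeff_sum coeff3_mult
    by (subst sum.swap, rule sum.cong[OF refl], subst sum.swap, rule sum.cong[OF refl], rule sum.swap)
  also have "\<dots> = (\<Sum>c\<le>k. \<Sum>b\<le>j. \<Sum>a\<le>i. if i + j + k = e then
        coeff3 F a b c * coeff3 G (i - a) (j - b) (k - c) else 0)"
  proof (intro sum.cong refl)
    fix a b c assume abc: "c \<in> {..k}" "b \<in> {..j}" "a \<in> {..i}"
    let ?g = "coeff3 F a b c * coeff3 G (i - a) (j - b) (k - c)"
    have "(\<Sum>s\<le>e. coeff3 (comp3 s F) a b c * coeff3 (comp3 (e - s) G) (i - a) (j - b) (k - c)) =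
       (\<Sum>s\<le>e. if s = a + b + c then (if i + j + k = e then ?g else 0) else 0)"
      using abc by (intro sum.cong refl) (auto simp: coeff3_comp3)
    also have "\<dots> = (if i + j + k = e then ?g else 0)"
      using abc by (subst sum.delta) auto
    finally show "(\<Sum>s\<le>e. coeff3 (comp3 s F) a b c * coeff3 (comp3 (e - s) G) (i - a) (j - b) (k - c)) =
      (if i + j + k = e then ?g else 0)" .
  qed
  also have "\<dots> = coeff3 (comp3 e (F * G)) i j k"
    by (simp add: coeff3_comp3 coeff3_mult)
  finally show "coeff3 (comp3 e (F * G)) i j k = coeff3 (\<Sum>s\<le>e. comp3 s F * comp3 (e - s) G) i j k" ..
qed

lemma comp3_eq_0_iff: "comp3 e F = 0 \<longleftrightarrow> (\<forall>i j k. coeff3 F i j k \<noteq> 0 \<longrightarrow> i + j + k \<noteq> e)"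
proof
  assume *: "comp3 e F = 0"
  show "\<forall>i j k. coeff3 F i j k \<noteq> 0 \<longrightarrow> i + j + k \<noteq> e"
  proof (intro allI impI)
    fix i j k assume "coeff3 F i j k \<noteq> 0"
    with coeff3_comp3[where e = e and F = F and i = i and j = j and k = k] show "i + j + k \<noteq> e" unfolding * by auto
  qed
next
  assume "\<forall>i j k. coeff3 F i j k \<noteq> 0 \<longrightarrow> i + j + k \<noteq> e"
  then show "comp3 e F = 0" by (intro poly3_eqI) (auto simp: coeff3_comp3)
qed

lemma finite_support3: "finite {(i, j, k). coeff3 F i j k \<noteq> 0}"
proof -
  have "{(i, j, k). coeff3 F i j k \<noteq> 0} \<subseteq>
    (\<Union>k\<in>{..degree F}. \<Union>j\<in>{..degree (Polynomial.coeff F k)}.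
       (\<lambda>i. (i, j, k)) ` {..degree (Polynomial.coeff (Polynomial.coeff F k) j)})"
    by (auto simp: image_iff) (metis coeff_0 le_degree)+
  then show ?thesis by (rule finite_subset) auto
qed

text \<open>Over a domain the product of the top components of the factors is nonzero, and so is
  that of the bottom ones. Both lie in the single degree \<open>d\<close>, so top and bottom degree
  agree in each factor.\<close>

lemma homogeneous_factor:
  fixes F G :: "'a::idom poly3"
  assumes "homogeneous d (F * G)" "F * G \<noteq> 0"
  obtains a b where "homogeneous a F" "homogeneous b G" "d = a + b"
proof -
  define S where "S = (\<lambda>F::'a poly3. {e. comp3 e F \<noteq> 0})"
  have S_eq: "S H = (\<lambda>(i, j, k). i + j + k) ` {(i, j, k). coeff3 H i j k \<noteq> 0}" for H
  proof (rule Set.set_eqI)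
    show "e \<in> S H \<longleftrightarrow> e \<in> (\<lambda>(i, j, k). i + j + k) ` {(i, j, k). coeff3 H i j k \<noteq> 0}" for e
      unfolding S_def mem_Collect_eq comp3_eq_0_iff image_def by (simp, blast)
  qed
  have fin: "finite (S H)" for H unfolding S_eq using finite_support3 by blast
  have ne: "S H \<noteq> {}" if nz: "H \<noteq> 0" for H
  proof -
    obtain i j k where "coeff3 H i j k \<noteq> 0" using nz by (blast elim: poly3_nonzeroE)
    then show ?thesis unfolding S_eq by auto
  qed
  have F: "F \<noteq> 0" and G: "G \<noteq> 0" using assms by auto
  have deg: "e = d" if "comp3 e (F * G) \<noteq> 0" for e
    using that assms(1) unfolding comp3_eq_0_iff by (metis homogeneousD)
  have zero: "comp3 s H = 0" if "s \<notin> S H" for s H using that by (auto simp: S_def)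
  \<comment> \<open>\<open>sep\<close> says that \<open>(a, b)\<close> is the only pair of occurring
    degrees with sum \<open>a + b\<close>, so the component of the product in that degree is a
    single nonzero product.\<close>
  have extremal: "a + b = d" if ab: "a \<in> S F" "b \<in> S G"
    and sep: "\<And>s. s \<le> a + b \<Longrightarrow> s \<noteq> a \<Longrightarrow> s \<notin> S F \<or> a + b - s \<notin> S G" for a b
  proof (rule deg)
    have "comp3 (a + b) (F * G) = (\<Sum>s\<le>a + b. if s = a then comp3 a F * comp3 b G else 0)"
      unfolding comp3_mult
    proof (intro sum.cong refl)
      fix s assume s: "s \<in> {..a + b}"
      show "comp3 s F * comp3 (a + b - s) G = (if s = a then comp3 a F * comp3 b G else 0)"
      proof (cases "s = a")
        case False
        with sep[of s] s have "comp3 s F = 0 \<or> comp3 (a + b - s) G = 0" by (auto intro: zero)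
        with False show ?thesis by auto
      qed simp
    qed
    also have "\<dots> = comp3 a F * comp3 b G" by (subst sum.delta) auto
    also have "\<dots> \<noteq> 0" using ab by (simp add: S_def)
    finally show "comp3 (a + b) (F * G) \<noteq> 0" .
  qed
  have le: "s \<le> Max (S H)" "Min (S H) \<le> s" if "s \<in> S H" for s H using that fin by auto
  have max: "Max (S F) + Max (S G) = d"
  proof (rule extremal[OF Max_in[OF fin ne[OF F]] Max_in[OF fin ne[OF G]]])
    fix s assume "s \<le> Max (S F) + Max (S G)" "s \<noteq> Max (S F)"
    then show "s \<notin> S F \<or> Max (S F) + Max (S G) - s \<notin> S G"
      using le(1)[of s F] le(1)[of "Max (S F) + Max (S G) - s" G] by linarith
  qed
  have min: "Min (S F) + Min (S G) = d"
  proof (rule extremal[OF Min_in[OF fin ne[OF F]] Min_in[OF fin ne[OF G]]])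
    fix s assume "s \<le> Min (S F) + Min (S G)" "s \<noteq> Min (S F)"
    then show "s \<notin> S F \<or> Min (S F) + Min (S G) - s \<notin> S G"
      using le(2)[of s F] le(2)[of "Min (S F) + Min (S G) - s" G] by linarith
  qed
  have hom: "homogeneous (Max (S H)) H" if "Max (S H) \<le> Min (S H)" for H
    unfolding homogeneous_def
  proof (intro allI impI)
    fix i j k assume "coeff3 H i j k \<noteq> 0"
    then have "i + j + k \<in> S H" unfolding S_eq by (intro image_eqI[of _ _ "(i, j, k)"]) auto
    then have "i + j + k \<le> Max (S H)" "Min (S H) \<le> i + j + k" using fin by auto
    with that show "i + j + k = Max (S H)" by linarith
  qed
  have "Min (S F) \<le> Max (S F)" "Min (S G) \<le> Max (S G)"
    using fin ne F G by (auto intro!: Min_le Max_in)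
  with max min have "Max (S F) \<le> Min (S F)" "Max (S G) \<le> Min (S G)" by linarith+
  from that[OF hom[OF this(1)] hom[OF this(2)]] max show ?thesis by simp
qed

subsection \<open>Partial derivatives\<close>

lemma map_poly_add_hom:
  assumes "\<And>a b. D (a + b) = D a + D b" "D 0 = 0"
  shows "map_poly D (p + q) = map_poly D p + map_poly D q"
  by (rule poly_eqI) (simp add: coeff_map_poly assms)

text \<open>A derivation of the coefficient ring stays one when applied to all coefficients; this
  covers the two inner variables, whose derivatives are nested in \<open>map_poly\<close>.\<close>

lemma map_poly_leibniz:
  fixes D :: "'a::comm_semiring_0 \<Rightarrow> 'a"
  assumes "\<And>a b. D (a + b) = D a + D b" "D 0 = 0" "\<And>a b. D (a * b) = D a * b + a * D b"
  shows "map_poly D (p * q) = map_poly D p * q + p * map_poly D q"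
proof (rule poly_eqI)
  fix n
  have sum: "D (sum f A) = (\<Sum>x\<in>A. D (f x))" for f :: "nat \<Rightarrow> 'a" and A
    by (induction A rule: infinite_finite_induct) (auto simp: assms)
  show "Polynomial.coeff (map_poly D (p * q)) n =
      Polynomial.coeff (map_poly D p * q + p * map_poly D q) n"
    by (simp add: coeff_map_poly assms coeff_mult sum sum.distrib)
qed

lemma ddx_add [simp]: "ddx (F + G) = ddx F + ddx G"
  unfolding ddx_def by (intro map_poly_add_hom) (auto simp: pderiv_add)
lemma ddy_add [simp]: "ddy (F + G) = ddy F + ddy G"
  unfolding ddy_def by (intro map_poly_add_hom) (auto simp: pderiv_add)
lemma ddz_add [simp]: "ddz (F + G) = ddz F + ddz G"
  by (simp add: ddz_def pderiv_add)

lemma ddx_mult: "ddx (F * G) = ddx F * G + F * ddx G"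
  unfolding ddx_def
  by (intro map_poly_leibniz map_poly_add_hom) (auto simp: pderiv_add pderiv_mult)
lemma ddy_mult: "ddy (F * G) = ddy F * G + F * ddy G"
  unfolding ddy_def by (intro map_poly_leibniz) (auto simp: pderiv_add pderiv_mult)
lemma ddz_mult: "ddz (F * G) = ddz F * G + F * ddz G"
  by (simp add: ddz_def pderiv_mult)

lemma dd_0 [simp]: "ddx 0 = 0" "ddy 0 = 0" "ddz 0 = 0"
  by (simp_all add: ddx_def ddy_def ddz_def)
lemma dd_const3 [simp]: "ddx (const3 c) = 0" "ddy (const3 c) = 0" "ddz (const3 c) = 0"
  by (simp_all add: ddx_def ddy_def ddz_def const3_def map_poly_pCons pderiv_pCons)
lemma dd_1 [simp]: "ddx 1 = 0" "ddy 1 = 0" "ddz 1 = 0"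
  using dd_const3[of 1] by simp_all
lemma dd_const3_mult [simp]: "ddx (const3 c * F) = const3 c * ddx F"
  "ddy (const3 c * F) = const3 c * ddy F" "ddz (const3 c * F) = const3 c * ddz F"
  by (simp_all add: ddx_mult ddy_mult ddz_mult)

lemma coeff3_dd:
  "coeff3 (ddx F) i j k = of_nat (Suc i) * coeff3 F (Suc i) j k"
  "coeff3 (ddy F) i j k = of_nat (Suc j) * coeff3 F i (Suc j) k"
  "coeff3 (ddz F) i j k = of_nat (Suc k) * coeff3 F i j (Suc k)"
  by (simp_all add: ddx_def ddy_def ddz_def coeff_map_poly coeff_pderiv of_nat_poly distrib_right)

lemma dd_commute: "ddy (ddx F) = ddx (ddy F)" "ddz (ddx F) = ddx (ddz F)" "ddz (ddy F) = ddy (ddz F)"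
  by (intro poly3_eqI, simp only: coeff3_dd mult.left_commute)+

lemma dd_vars [simp]:
  "ddx X3 = 1" "ddy X3 = 0" "ddz X3 = 0"
  "ddx Y3 = 0" "ddy Y3 = 1" "ddz Y3 = 0"
  "ddx Z3 = 0" "ddy Z3 = 0" "ddz Z3 = 1"
  by (simp_all add: ddx_def ddy_def ddz_def map_poly_pCons pderiv_pCons one_pCons)

lemma euler:
  assumes "homogeneous n F"
  shows "X3 * ddx F + Y3 * ddy F + Z3 * ddz F = of_nat n * F"
proof (rule poly3_eqI)
  fix i j k
  have "coeff3 (X3 * ddx F + Y3 * ddy F + Z3 * ddz F) i j k = of_nat (i + j + k) * coeff3 F i j k"
    unfolding coeff_add coeff3_X3_mult coeff3_Y3_mult coeff3_Z3_mult
    by (cases i; cases j; cases k) (simp_all only: coeff3_dd, simp_all add: algebra_simps)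
  also have "\<dots> = of_nat n * coeff3 F i j k"
    using homogeneousD[OF assms, where i = i and j = j and k = k] by (cases "coeff3 F i j k = 0") auto
  also have "\<dots> = coeff3 (of_nat n * F) i j k"
    by (subst const3_of_nat[symmetric]) (simp only: coeff3_const3_mult)
  finally show "coeff3 (X3 * ddx F + Y3 * ddy F + Z3 * ddz F) i j k = coeff3 (of_nat n * F) i j k" .
qed

lemma homogeneous_dd:
  assumes "homogeneous n F"
  shows "homogeneous (n - 1) (ddx F)" "homogeneous (n - 1) (ddy F)" "homogeneous (n - 1) (ddz F)"
  unfolding homogeneous_def coeff3_dd using assms by (auto dest!: homogeneousD)

lemma dd_eq_0_imp_const3:
  fixes F :: "'a::field_char_0 poly3"
  assumes "ddx F = 0" "ddy F = 0" "ddz F = 0"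
  obtains c where "F = const3 c"
proof -
  have "coeff3 F (Suc i) j k = 0" "coeff3 F i (Suc j) k = 0" "coeff3 F i j (Suc k) = 0" for i j k
    using coeff3_dd[where F = F and i = i and j = j and k = k] assms
    by (simp_all add: of_nat_neq_0 del: of_nat_Suc)
  then have "F = const3 (coeff3 F 0 0 0)"
    by (intro poly3_eqI) (auto simp: const3_def coeff_pCons split: nat.splits)
  then show ?thesis ..
qed

definition lin3 :: "'a::comm_ring_1 \<times> 'a \<times> 'a \<Rightarrow> 'a poly3" where
  "lin3 = (\<lambda>(a, b, c). const3 a * X3 + const3 b * Y3 + const3 c * Z3)"

lemma eval3_lin3 [simp]: "eval3 (lin3 (a, b, c)) (x, y, z) = a * x + b * y + c * z"
  by (simp only: lin3_def prod.case eval3_add eval3_mult eval3_const3 eval3_X3 eval3_Y3 eval3_Z3)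

lemma homogeneous_lin3 [simp]: "homogeneous (Suc 0) (lin3 v)"
  by (cases v) (auto simp only: lin3_def prod.case intro!: homogeneous_add homogeneous_const3_mult
      homogeneous_X3 homogeneous_Y3 homogeneous_Z3)

lemma dd_lin3 [simp]: "ddx (lin3 (a, b, c)) = const3 a" "ddy (lin3 (a, b, c)) = const3 b"
  "ddz (lin3 (a, b, c)) = const3 c"
  by (simp_all only: lin3_def prod.case ddx_add ddy_add ddz_add dd_const3_mult dd_vars) simp_all

subsection \<open>Linear systems and forms of a given degree\<close>

text \<open>Gaussian elimination, by induction on the set of equations: the new equation is either
  trivial or is used to eliminate one unknown \<open>y\<close>.\<close>

lemma underdetermined_system:
  fixes A :: "'e \<Rightarrow> 'x \<Rightarrow> 'a::field"
  assumes "finite E" "finite U" "card E < card U"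
  obtains c where "\<exists>x\<in>U. c x \<noteq> 0" "\<And>e. e \<in> E \<Longrightarrow> (\<Sum>x\<in>U. c x * A e x) = 0"
proof -
  have "\<exists>c. (\<exists>x\<in>U. c x \<noteq> 0) \<and> (\<forall>e\<in>E. (\<Sum>x\<in>U. c x * A e x) = 0)"
    using assms
  proof (induction E arbitrary: U A rule: finite_induct)
    case empty
    then obtain x where "x \<in> U" by (cases "U = {}") auto
    then show ?case by (intro exI[of _ "\<lambda>_. 1"]) auto
  next
    case (insert e E U A)
    show ?case
    proof (cases "\<forall>x\<in>U. A e x = 0")
      case True
      from insert.IH[of U A] insert.prems insert.hyps
      obtain c where "\<exists>x\<in>U. c x \<noteq> 0" "\<forall>e\<in>E. (\<Sum>x\<in>U. c x * A e x) = 0" by auto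
      with True show ?thesis by (intro exI[of _ c]) auto
    next
      case False
      then obtain y where y: "y \<in> U" "A e y \<noteq> 0" by auto
      let ?U = "U - {y}"
      have "card E < card ?U" "finite ?U"
        using insert.prems insert.hyps y by (simp_all add: card_Diff_singleton)
      \<comment> \<open>Subtracting the right multiple of equation \<open>e\<close> removes
        \<open>y\<close> from the others; \<open>c'\<close> then recovers the value of
        \<open>y\<close> from equation \<open>e\<close>.\<close>
      with insert.IH[of ?U "\<lambda>e' x. A e' x - A e' y * A e x / A e y"]
      obtain c where c: "\<exists>x\<in>?U. c x \<noteq> 0"
        "\<And>e'. e' \<in> E \<Longrightarrow> (\<Sum>x\<in>?U. c x * (A e' x - A e' y * A e x / A e y)) = 0" by auto
      define c' where "c' = c(y := - (\<Sum>x\<in>?U. c x * A e x) / A e y)"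
      have sum: "(\<Sum>x\<in>U. c' x * A e' x) =
        - (\<Sum>x\<in>?U. c x * A e x) / A e y * A e' y + (\<Sum>x\<in>?U. c x * A e' x)" for e'
      proof -
        have "(\<Sum>x\<in>U. c' x * A e' x) = c' y * A e' y + (\<Sum>x\<in>?U. c' x * A e' x)"
          using y insert.prems by (simp add: sum.remove)
        also have "(\<Sum>x\<in>?U. c' x * A e' x) = (\<Sum>x\<in>?U. c x * A e' x)"
          by (intro sum.cong) (auto simp: c'_def)
        finally show ?thesis by (simp add: c'_def)
      qed
      have "(\<Sum>x\<in>U. c' x * A e' x) = 0" if "e' \<in> insert e E" for e'
      proof (cases "e' = e")
        case True
        then show ?thesis unfolding sum using y by simp
      next
        case False
        with that have "(\<Sum>x\<in>?U. c x * (A e' x - A e' y * A e x / A e y)) = 0" by (intro c) auto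
        then have "(\<Sum>x\<in>?U. c x * A e' x) = (\<Sum>x\<in>?U. c x * A e x) * (A e' y / A e y)"
          by (simp add: algebra_simps sum_subtractf sum_distrib_left)
        then show ?thesis unfolding sum by simp
      qed
      moreover have "\<exists>x\<in>U. c' x \<noteq> 0" using c(1) by (auto simp: c'_def)
      ultimately show ?thesis by blast
    qed
  qed
  then show ?thesis using that by blast
qed

section \<open>Monomials of a given degree and the dimension count\<close>

definition exps :: "nat \<Rightarrow> (nat \<times> nat \<times> nat) set" where
  "exps e = {(i, j, k). i + j + k = e}"

lemma exps_eq: "exps e = (\<lambda>(i, j). (i, j, e - i - j)) ` (SIGMA i:{..e}. {..e - i})"
  by (auto simp: exps_def image_iff)

lemma finite_exps [simp]: "finite (exps e)"
  unfolding exps_eq by auto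

lemma card_exps: "2 * card (exps e) = (e + 1) * (e + 2)"
proof -
  have "card (exps e) = (\<Sum>i\<le>e. e - i + 1)"
    unfolding exps_eq by (subst card_image) (auto simp: inj_on_def)
  also have "\<dots> = (\<Sum>i\<le>e. i + 1)"
    by (rule sum.reindex_bij_witness[of _ "\<lambda>i. e - i" "\<lambda>i. e - i"]) auto
  also have "2 * \<dots> = (e + 1) * (e + 2)"
    by (induction e) auto
  finally show ?thesis .
qed

text \<open>In dimensions of spaces of forms this is the count of the Koszul complex: a complete
  intersection of degrees \<open>a\<close> and \<open>b\<close> imposes \<open>a * b\<close>
  conditions on forms of degree \<open>d\<close>.\<close>

lemma card_exps_diff:
  assumes "a + b \<le> d"
  shows "card (exps d) + card (exps (d - a - b)) = card (exps (d - a)) + card (exps (d - b)) + a * b"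
proof -
  obtain r where r: "d = a + b + r" using assms le_Suc_ex by blast
  have "2 * (card (exps d) + card (exps (d - a - b))) =
      2 * (card (exps (d - a)) + card (exps (d - b)) + a * b)"
    unfolding distrib_left card_exps by (simp add: r algebra_simps)
  then show ?thesis by simp
qed

definition mono3 :: "nat \<times> nat \<times> nat \<Rightarrow> 'a::comm_semiring_1 poly3" where
  "mono3 = (\<lambda>(i, j, k). monom (monom (monom 1 i) j) k)"

lemma coeff3_mono3: "coeff3 (mono3 \<nu>) i j k = (if \<nu> = (i, j, k) then 1 else 0)"
  by (cases \<nu>) (auto simp: mono3_def)

lemma homogeneous_mono3: "\<nu> \<in> exps e \<Longrightarrow> homogeneous e (mono3 \<nu>)"
  by (auto simp: homogeneous_def coeff3_mono3 exps_def)

lemma coeff3_sum_mono3: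
  fixes c :: "nat \<times> nat \<times> nat \<Rightarrow> 'a::comm_ring_1"
  assumes "finite S"
  shows "coeff3 (\<Sum>\<nu>\<in>S. const3 (c \<nu>) * mono3 \<nu>) i j k = (if (i, j, k) \<in> S then c (i, j, k) else 0)"
proof -
  have "coeff3 (\<Sum>\<nu>\<in>S. const3 (c \<nu>) * mono3 \<nu>) i j k = (\<Sum>\<nu>\<in>S. if \<nu> = (i, j, k) then c \<nu> else 0)"
    unfolding coeff_sum coeff3_const3_mult by (intro sum.cong) (auto simp: coeff3_mono3)
  with assms show ?thesis by simp
qed

text \<open>The exponents are those of the leading monomial of \<open>F\<close> for the
  lexicographic order with \<open>z\<close> first and \<open>x\<close> last. Over a domain leading
  monomials multiply, so every nonzero multiple of \<open>F\<close> contains a monomial divisible by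
  that of \<open>F\<close>.\<close>

lemma lead_coeff3_mult:
  fixes F :: "'a::idom poly3"
  assumes "F \<noteq> 0"
  obtains l1 l2 l3 where "coeff3 F l1 l2 l3 \<noteq> 0"
    "\<And>H. H \<noteq> 0 \<Longrightarrow> \<exists>m1 m2 m3. coeff3 (F * H) (l1 + m1) (l2 + m2) (l3 + m3) \<noteq> 0"
proof (rule that)
  let ?l = "\<lambda>F::'a poly3. Polynomial.coeff F (degree F)"
  let ?m = "\<lambda>F::'a poly3. Polynomial.coeff (?l F) (degree (?l F))"
  have ne: "coeff3 H (degree (?m H)) (degree (?l H)) (degree H) \<noteq> 0" if "H \<noteq> 0" for H
    using that by simp
  from ne[OF assms] show "coeff3 F (degree (?m F)) (degree (?l F)) (degree F) \<noteq> 0" .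
  fix H :: "'a poly3" assume H: "H \<noteq> 0"
  have "coeff3 (F * H) (degree (?m F) + degree (?m H)) (degree (?l F) + degree (?l H)) (degree F + degree H)
    = coeff3 F (degree (?m F)) (degree (?l F)) (degree F) * coeff3 H (degree (?m H)) (degree (?l H)) (degree H)"
    by (simp only: coeff_mult_degree_sum)
  also have "\<dots> \<noteq> 0" using ne[OF assms] ne[OF H] by simp
  finally show "\<exists>m1 m2 m3. coeff3 (F * H) (degree (?m F) + m1) (degree (?l F) + m2) (degree F + m3) \<noteq> 0"
    by blast
qed

text \<open>A linear system for the coefficients of \<open>P\<close>, \<open>Q\<close> and the
  \<open>c j\<close> has more unknowns than equations by \<open>card_exps_diff\<close>. The Koszul
  solutions \<open>(P, Q) = (- g * H, f * H)\<close> must be excluded, which extra equations do: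
  \<open>Q\<close> may contain no monomial divisible by the leading monomial of \<open>f\<close>.
  The sort constraints make the polynomial ring factorial.\<close>

lemma combination_in_ideal:
  fixes f g :: "'a::{field_char_0,factorial_ring_gcd,semiring_gcd_mult_normalize} poly3"
    and G :: "'j \<Rightarrow> 'a poly3"
  assumes cop: "coprime f g" and f: "homogeneous a f" "f \<noteq> 0" and g: "homogeneous b g"
    and d: "a + b \<le> d" and J: "finite J" "a * b < card J"
    and G: "\<And>j. j \<in> J \<Longrightarrow> homogeneous d (G j)"
  obtains c P Q where "\<exists>j\<in>J. c j \<noteq> 0" "(\<Sum>j\<in>J. const3 (c j) * G j) = P * f + Q * g"
proof -
  obtain l1 l2 l3 where l: "coeff3 f l1 l2 l3 \<noteq> 0"
    and lead: "\<And>H. H \<noteq> 0 \<Longrightarrow> \<exists>m1 m2 m3. coeff3 (f * H) (l1 + m1) (l2 + m2) (l3 + m3) \<noteq> 0"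
    using lead_coeff3_mult[OF f(2)] by metis
  from l f(1) have la: "l1 + l2 + l3 = a" by (auto dest: homogeneousD)
  \<comment> \<open>The unknowns: the coefficients of \<open>P\<close>, those of \<open>Q\<close>,
    and the \<open>c j\<close>.\<close>
  define U where "U = exps (d - a) <+> (exps (d - b) <+> J)"
  \<comment> \<open>The equations: one for each monomial of degree \<open>d\<close>, and the
    normalisation of \<open>Q\<close>, indexed by the cofactor of the leading monomial of
    \<open>f\<close>.\<close>
  define E where "E = exps d <+> exps (d - a - b)"
  define V where "V x = (case x of Inl \<nu> \<Rightarrow> mono3 \<nu> * f | Inr (Inl \<nu>) \<Rightarrow> mono3 \<nu> * g | Inr (Inr j) \<Rightarrow> G j)" for x
  define A :: "_ \<Rightarrow> _ \<Rightarrow> 'a" where "A e x = (case e of Inl (i, j, k) \<Rightarrow> coeff3 (V x) i j k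
      | Inr (i, j, k) \<Rightarrow> (case x of Inr (Inl \<nu>) \<Rightarrow> if \<nu> = (l1 + i, l2 + j, l3 + k) then 1 else 0 | _ \<Rightarrow> 0))" for e x
  have fin: "finite U" "finite E" using J by (auto simp: U_def E_def)
  have "card E < card U"
    using card_exps_diff[OF d] J by (simp add: U_def E_def card_Plus)
  from underdetermined_system[OF fin(2,1) this, of A]
  obtain c where c: "\<exists>x\<in>U. c x \<noteq> 0" and sys: "\<And>e. e \<in> E \<Longrightarrow> (\<Sum>x\<in>U. c x * A e x) = 0" by blast
  define P where "P = (\<Sum>\<nu>\<in>exps (d - a). const3 (c (Inl \<nu>)) * mono3 \<nu>)"
  define Q where "Q = (\<Sum>\<nu>\<in>exps (d - b). const3 (c (Inr (Inl \<nu>))) * mono3 \<nu>)"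
  define S where "S = (\<Sum>j\<in>J. const3 (c (Inr (Inr j))) * G j)"
  have PQ: "homogeneous (d - b) Q"
    unfolding Q_def by (intro homogeneous_sum homogeneous_const3_mult homogeneous_mono3)
  have W: "P * f + Q * g + S = (\<Sum>x\<in>U. const3 (c x) * V x)"
    using J by (simp add: U_def sum.Plus V_def P_def Q_def S_def sum_distrib_right mult.assoc add.assoc)
  have hV: "homogeneous d (V x)" if "x \<in> U" for x
  proof -
    have "homogeneous (d - a + a) (mono3 \<nu> * f)" if "\<nu> \<in> exps (d - a)" for \<nu>
      using that f by (intro homogeneous_mult homogeneous_mono3)
    moreover have "homogeneous (d - b + b) (mono3 \<nu> * g)" if "\<nu> \<in> exps (d - b)" for \<nu>
      using that g by (intro homogeneous_mult homogeneous_mono3)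
    ultimately show ?thesis using that d G by (auto simp: U_def V_def)
  qed
  have zero: "P * f + Q * g + S = 0"
  proof (rule poly3_eqI)
    fix i j k
    show "coeff3 (P * f + Q * g + S) i j k = coeff3 0 i j k"
    proof (cases "i + j + k = d")
      case True
      then have "Inl (i, j, k) \<in> E" by (auto simp: E_def exps_def)
      from sys[OF this] show ?thesis unfolding W by (simp add: coeff_sum A_def)
    next
      case False
      have "homogeneous d (P * f + Q * g + S)"
        unfolding W by (intro homogeneous_sum homogeneous_const3_mult hV)
      with False show ?thesis using homogeneousD by fastforce
    qed
  qed
  \<comment> \<open>A solution without the \<open>G j\<close> would be a Koszul relation with
    \<open>Q = f * H\<close>, and the normalisation leaves only \<open>H = 0\<close>.\<close>
  have "\<exists>j\<in>J. c (Inr (Inr j)) \<noteq> 0"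
  proof (rule ccontr)
    assume no: "\<not> ?thesis"
    then have "S = 0" by (auto simp: S_def)
    with zero have PfQg: "P * f + Q * g = 0" by simp
    then have "Q * g = f * (- P)" by (simp add: eq_neg_iff_add_eq_0 algebra_simps)
    then have "f dvd Q * g" by simp
    with cop have "f dvd Q" using coprime_dvd_mult_left_iff by blast
    then obtain H where H: "Q = f * H" by blast
    have "H = 0"
    proof (rule ccontr)
      assume "H \<noteq> 0"
      from lead[OF this] obtain m1 m2 m3 where m: "coeff3 Q (l1 + m1) (l2 + m2) (l3 + m3) \<noteq> 0"
        unfolding H by blast
      then have "l1 + m1 + (l2 + m2) + (l3 + m3) = d - b" using PQ homogeneousD by blast
      with la d have deg: "m1 + m2 + m3 = d - a - b" by linarith
      have mem: "(l1 + m1, l2 + m2, l3 + m3) \<in> exps (d - b)"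
        using la deg d by (simp add: exps_def)
      have "Inr (m1, m2, m3) \<in> E" using deg by (auto simp: E_def exps_def)
      from sys[OF this] have "(\<Sum>\<nu>\<in>exps (d - b). c (Inr (Inl \<nu>)) *
          (if \<nu> = (l1 + m1, l2 + m2, l3 + m3) then 1 else 0)) = 0"
        using J by (simp add: U_def sum.Plus A_def)
      also have "(\<Sum>\<nu>\<in>exps (d - b). c (Inr (Inl \<nu>)) *
          (if \<nu> = (l1 + m1, l2 + m2, l3 + m3) then 1 else 0)) =
        (\<Sum>\<nu>\<in>exps (d - b). (if \<nu> = (l1 + m1, l2 + m2, l3 + m3) then c (Inr (Inl \<nu>)) else 0))"
        by (intro sum.cong) auto
      also have "\<dots> = c (Inr (Inl (l1 + m1, l2 + m2, l3 + m3)))"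
        using mem by (subst sum.delta) auto
      finally have "coeff3 Q (l1 + m1) (l2 + m2) (l3 + m3) = 0"
        unfolding Q_def by (subst coeff3_sum_mono3) auto
      with m show False by simp
    qed
    with H have Q0: "Q = 0" by simp
    with PfQg f have P0: "P = 0" by simp
    have "c x = 0" if "x \<in> U" for x
    proof -
      have "c (Inl (i, j, k)) = 0" if "(i, j, k) \<in> exps (d - a)" for i j k
        using that coeff3_sum_mono3[where S = "exps (d - a)" and c = "\<lambda>\<nu>. c (Inl \<nu>)" and i = i and j = j and k = k]
        P0 unfolding P_def by simp
      moreover have "c (Inr (Inl (i, j, k))) = 0" if "(i, j, k) \<in> exps (d - b)" for i j k
        using that coeff3_sum_mono3[where S = "exps (d - b)" and c = "\<lambda>\<nu>. c (Inr (Inl \<nu>))" and i = i and j = j and k = k]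
        Q0 unfolding Q_def by simp
      ultimately show ?thesis using that no by (auto simp: U_def)
    qed
    with c show False by blast
  qed
  moreover have "S = (- P) * f + (- Q) * g" using zero by (simp add: eq_neg_iff_add_eq_0 algebra_simps)
  ultimately show ?thesis using that[of "\<lambda>j. c (Inr (Inr j))" "- P" "- Q"] by (simp add: S_def)
qed

section \<open>Vector algebra in three coordinates and gradients\<close>

definition dot3 :: "'a::comm_ring_1 \<times> 'a \<times> 'a \<Rightarrow> 'a \<times> 'a \<times> 'a \<Rightarrow> 'a" where
  "dot3 = (\<lambda>(a, b, c) (x, y, z). a * x + b * y + c * z)"

definition cross3 :: "'a::comm_ring_1 \<times> 'a \<times> 'a \<Rightarrow> 'a \<times> 'a \<times> 'a \<Rightarrow> 'a \<times> 'a \<times> 'a" where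
  "cross3 = (\<lambda>(a, b, c) (x, y, z). (b * z - c * y, c * x - a * z, a * y - b * x))"

definition smult3 :: "'a::comm_ring_1 \<Rightarrow> 'a \<times> 'a \<times> 'a \<Rightarrow> 'a \<times> 'a \<times> 'a" where
  "smult3 t = (\<lambda>(x, y, z). (t * x, t * y, t * z))"

lemmas vec3_defs = dot3_def cross3_def smult3_def zero_prod_def

lemma dot3_add: "dot3 a (u + w) = dot3 a u + dot3 a w" "dot3 (u + w) a = dot3 u a + dot3 w a"
  by (cases a; cases u; cases w; simp add: dot3_def algebra_simps)+

lemma dot3_smult: "dot3 a (smult3 t u) = t * dot3 a u" "dot3 (smult3 t u) a = t * dot3 u a"
  by (cases a; cases u; simp add: vec3_defs algebra_simps)+

lemma dot3_commute: "dot3 a b = dot3 b a"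
  by (cases a; cases b; simp add: dot3_def algebra_simps)

lemma dot3_0 [simp]: "dot3 a 0 = 0" "dot3 0 a = 0"
  by (cases a; simp add: vec3_defs)+

lemma cross3_parallel:
  fixes u w :: "'a::field \<times> 'a \<times> 'a"
  assumes "cross3 u w = 0" "u \<noteq> 0"
  obtains t where "w = smult3 t u"
proof -
  obtain a b c where u: "u = (a, b, c)" by (cases u)
  obtain x y z where w: "w = (x, y, z)" by (cases w)
  have eq: "b * z = c * y" "c * x = a * z" "a * y = b * x"
    using assms(1) by (simp_all add: u w vec3_defs)
  consider "a \<noteq> 0" | "b \<noteq> 0" | "c \<noteq> 0" using assms(2) by (auto simp: u zero_prod_def)
  then show ?thesis
  proof cases
    case 1
    then have "w = smult3 (x / a) u" using eq by (simp add: u w vec3_defs field_simps)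
    then show ?thesis by (rule that)
  next
    case 2
    then have "w = smult3 (y / b) u" using eq by (simp add: u w vec3_defs field_simps)
    then show ?thesis by (rule that)
  next
    case 3
    then have "w = smult3 (z / c) u" using eq by (simp add: u w vec3_defs field_simps)
    then show ?thesis by (rule that)
  qed
qed

text \<open>The kernel of \<open>a\<close> has dimension at least two, so it is not contained in the
  line spanned by \<open>v\<close>.\<close>

lemma kernel_vector1:
  fixes a v :: "'a::field_char_0 \<times> 'a \<times> 'a"
  assumes "v \<noteq> 0"
  obtains t where "cross3 t v \<noteq> 0" "dot3 a t = 0"
proof (rule ccontr)
  assume "\<not> thesis"
  with that have no: "cross3 t v = 0" if "dot3 a t = 0" for t using that by blast
  obtain a1 a2 a3 where a: "a = (a1, a2, a3)" by (cases a)
  obtain x y z where v: "v = (x, y, z)" by (cases v)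
  \<comment> \<open>These vectors span the kernel of \<open>a\<close> when \<open>a\<close> is
    nonzero. If all are parallel to \<open>v\<close>, the products of corresponding coordinates of
    \<open>a\<close> and \<open>v\<close> vanish, as \<open>2\<close> is invertible.\<close>
  have *: "cross3 (0, a3, -a2) v = 0" "cross3 (-a3, 0, a1) v = 0" "cross3 (a2, -a1, 0) v = 0"
    by (rule no, simp add: a dot3_def algebra_simps)+
  have diag: "a1 * x = 0" "a2 * y = 0" "a3 * z = 0"
  proof -
    have "a3 * z = - (a2 * y)" "a3 * z = - (a1 * x)" "a2 * y = - (a1 * x)"
      using * by (simp_all add: v vec3_defs eq_neg_iff_add_eq_0 add.commute)
    then have "2 * (a1 * x) = 0" "2 * (a2 * y) = 0" "2 * (a3 * z) = 0" by simp_all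
    then show "a1 * x = 0" "a2 * y = 0" "a3 * z = 0" by (simp_all del: mult_eq_0_iff add: mult_eq_0_iff[of 2])
  qed
  have "a = 0"
  proof (rule ccontr)
    assume "a \<noteq> 0"
    with * diag have "v = 0" by (auto simp: a v vec3_defs)
    with assms show False by simp
  qed
  then have "cross3 (1, 0, 0) v = 0" "cross3 (0, 1, 0) v = 0" by (auto intro!: no)
  with assms show False by (auto simp: v vec3_defs)
qed

lemma kernel_vector2:
  fixes a b v :: "'a::field_char_0 \<times> 'a \<times> 'a"
  assumes "v \<noteq> 0" "cross3 a b = 0"
  obtains t where "cross3 t v \<noteq> 0" "dot3 a t = 0" "dot3 b t = 0"
proof (cases "a = 0")
  case True
  with kernel_vector1[OF assms(1), of b] that show ?thesis by auto
next
  case False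
  from cross3_parallel[OF assms(2) this] obtain r where "b = smult3 r a" .
  with kernel_vector1[OF assms(1), of a] that show ?thesis by (auto simp: dot3_smult)
qed

text \<open>The three candidate forms vanish at \<open>u\<close>, and their values at
  \<open>w\<close> are the coordinates of \<open>cross3 u w\<close>.\<close>

lemma separating_form:
  fixes u w :: "'a::comm_ring_1 \<times> 'a \<times> 'a"
  assumes "cross3 u w \<noteq> 0"
  obtains a where "dot3 a u = 0" "dot3 a w \<noteq> 0"
proof -
  obtain u1 u2 u3 where u: "u = (u1, u2, u3)" by (cases u)
  obtain w1 w2 w3 where w: "w = (w1, w2, w3)" by (cases w)
  from assms consider "dot3 (0, -u3, u2) w \<noteq> 0" | "dot3 (u3, 0, -u1) w \<noteq> 0" | "dot3 (-u2, u1, 0) w \<noteq> 0"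
    by (auto simp: u w vec3_defs)
  then show ?thesis
    by cases (rule that[rotated], assumption, simp add: u dot3_def algebra_simps)+
qed

lemma nonvanishing_form:
  fixes w :: "'a::comm_ring_1 \<times> 'a \<times> 'a"
  assumes "w \<noteq> 0"
  obtains a where "dot3 a w \<noteq> 0"
proof -
  obtain w1 w2 w3 where w: "w = (w1, w2, w3)" by (cases w)
  from assms consider "dot3 (1, 0, 0) w \<noteq> 0" | "dot3 (0, 1, 0) w \<noteq> 0" | "dot3 (0, 0, 1) w \<noteq> 0"
    by (auto simp: w vec3_defs)
  then show ?thesis by cases (use that in auto)
qed

lemma eval3_lin3_dot3: "eval3 (lin3 a) v = dot3 a v"
  by (cases a; cases v) (simp add: dot3_def)

definition grad3 :: "'a::idom poly3 \<Rightarrow> 'a \<times> 'a \<times> 'a \<Rightarrow> 'a \<times> 'a \<times> 'a" where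
  "grad3 F v = (eval3 (ddx F) v, eval3 (ddy F) v, eval3 (ddz F) v)"

lemma grad3_add: "grad3 (F + G) v = grad3 F v + grad3 G v"
  by (simp add: grad3_def)
lemma grad3_mult: "grad3 (F * G) v = smult3 (eval3 G v) (grad3 F v) + smult3 (eval3 F v) (grad3 G v)"
  by (simp add: grad3_def smult3_def ddx_mult ddy_mult ddz_mult algebra_simps)
lemma grad3_const3 [simp]: "grad3 (const3 c) v = 0"
  by (simp add: grad3_def zero_prod_def)
lemma grad3_lin3 [simp]: "grad3 (lin3 a) v = a"
  by (cases a) (simp add: grad3_def)

lemma euler_grad3:
  assumes "homogeneous n F"
  shows "dot3 v (grad3 F v) = of_nat n * eval3 F v"
proof -
  obtain x y z where v: "v = (x, y, z)" by (cases v)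
  from arg_cong[OF euler[OF assms], of "\<lambda>G. eval3 G v"]
  show ?thesis by (simp only: v eval3_add eval3_mult eval3_X3 eval3_Y3 eval3_Z3 eval3_of_nat dot3_def
      grad3_def prod.case)
qed

subsection \<open>Transversality at the base points\<close>

text \<open>The base points impose \<open>n\<^sup>2\<close> independent conditions on forms of large degree, all of them
  satisfied by the ideal \<open>(f, g)\<close>.  A point where \<open>f\<close> and \<open>g\<close> are tangent to each other would
  impose one more, the derivative along the common tangent direction.\<close>

lemma transversal_base_points:
  fixes f g :: "'a::{field_char_0,factorial_ring_gcd,semiring_gcd_mult_normalize} poly3"
  assumes cop: "coprime f g" and f: "homogeneous n f" and g: "homogeneous n g"
    and V: "finite V" "card V = n\<^sup>2" "\<And>v. v \<in> V \<Longrightarrow> v \<noteq> 0"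
      "\<And>u w. u \<in> V \<Longrightarrow> w \<in> V \<Longrightarrow> u \<noteq> w \<Longrightarrow> cross3 u w \<noteq> 0"
    and vanish: "\<And>v. v \<in> V \<Longrightarrow> eval3 f v = 0" "\<And>v. v \<in> V \<Longrightarrow> eval3 g v = 0"
    and p: "p \<in> V"
  shows "cross3 (grad3 f p) (grad3 g p) \<noteq> 0"
proof
  assume "cross3 (grad3 f p) (grad3 g p) = 0"
  \<comment> \<open>\<open>t\<close> is the common tangent direction: killed by both gradients and
    not proportional to \<open>p\<close>, hence nonzero on the plane.\<close>
  with kernel_vector2[OF V(3)[OF p]] obtain t where t: "cross3 t p \<noteq> 0"
    "dot3 (grad3 f p) t = 0" "dot3 (grad3 g p) t = 0" by metis
  have "cross3 p t \<noteq> 0" using t(1) by (cases p; cases t) (auto simp: vec3_defs mult.commute)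
  then obtain a where a: "dot3 a p = 0" "dot3 a t \<noteq> 0" by (rule separating_form)
  have "\<exists>b. dot3 b u = 0 \<and> dot3 b w \<noteq> 0" if uw: "u \<in> V" "w \<in> V" "u \<noteq> w" for u w
    using separating_form[OF V(4)[OF uw]] by metis
  then obtain b where b: "\<And>u w. u \<in> V \<Longrightarrow> w \<in> V \<Longrightarrow> u \<noteq> w \<Longrightarrow> dot3 (b u w) u = 0"
     "\<And>u w. u \<in> V \<Longrightarrow> w \<in> V \<Longrightarrow> u \<noteq> w \<Longrightarrow> dot3 (b u w) w \<noteq> 0" by metis
  have "\<exists>l. dot3 l w \<noteq> 0" if "w \<in> V" for w using nonvanishing_form[OF V(3)[OF that]] by metis
  then obtain l where l: "\<And>w. w \<in> V \<Longrightarrow> dot3 (l w) w \<noteq> 0" by metis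
  \<comment> \<open>\<open>H w\<close> vanishes at every point of \<open>V\<close> except
    \<open>w\<close>; the power of \<open>lin3 (l w)\<close> raises the degree beyond
    \<open>2 * n\<close>, where the dimension count applies.\<close>
  define H where "H w = (\<Prod>u\<in>V - {w}. lin3 (b u w) ^ 2) * lin3 (l w) ^ (2 * n)" for w
  \<comment> \<open>One form for each base point, nonzero there only, and a further one at
    \<open>None\<close> that vanishes at all base points but has nonzero derivative at
    \<open>p\<close> along \<open>t\<close>: one more than the \<open>n * n\<close> conditions
    available.\<close>
  define G where "G = case_option (lin3 a * H p) (\<lambda>w. lin3 (l w) * H w)"
  define d where "d = (\<Sum>u\<in>V - {p}. 2) + 2 * n + 1"
  have cardV: "card (V - {w}) = card (V - {p})" if "w \<in> V" for w
    using that p V by (simp add: card_Diff_singleton)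
  have hH: "homogeneous ((\<Sum>u\<in>V - {p}. 2) + 2 * n) (H w)" if "w \<in> V" for w
  proof -
    have "homogeneous ((\<Sum>u\<in>V - {w}. 2 * Suc 0) + 2 * n * Suc 0) (H w)"
      unfolding H_def using V(1)
      by (intro homogeneous_mult homogeneous_prod homogeneous_power homogeneous_lin3) auto
    then show ?thesis using cardV[OF that] by simp
  qed
  have hG: "homogeneous d (G j)" if "j \<in> insert None (Some ` V)" for j
  proof -
    have *: "homogeneous d (lin3 c * H w)" if "w \<in> V" for c w
      using homogeneous_mult[OF homogeneous_lin3[of c] hH[OF that]] by (simp add: d_def)
    show ?thesis
    proof (cases j)
      case None
      then show ?thesis using *[OF p] by (simp add: G_def)
    next
      case (Some w)
      with that have "w \<in> V" by auto
      from *[OF this] show ?thesis by (simp add: G_def Some)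
    qed
  qed
  have f0: "f \<noteq> 0"
  proof
    assume "f = 0"
    with cop have "g dvd 1" by simp
    then obtain h where "1 = g * h" by blast
    from arg_cong[OF this, of "\<lambda>G. eval3 G p"] show False using vanish(2)[OF p] by simp
  qed
  have J: "finite (insert None (Some ` V))" "n * n < card (insert None (Some ` V))" "n + n \<le> d"
    using V(1,2) by (simp_all add: card_image power2_eq_square d_def)
  obtain c P Q where c: "\<exists>j\<in>insert None (Some ` V). c j \<noteq> 0"
    and eq: "(\<Sum>j\<in>insert None (Some ` V). const3 (c j) * G j) = P * f + Q * g"
    by (rule combination_in_ideal[OF cop f f0 g J(3,1,2) hG])
  have eq': "const3 (c None) * (lin3 a * H p) + (\<Sum>w\<in>V. const3 (c (Some w)) * (lin3 (l w) * H w)) =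
      P * f + Q * g"
    unfolding eq[symmetric] using V(1) by (subst sum.insert) (auto simp: G_def sum.reindex)
  have H0: "eval3 (H w) v = 0" if "w \<in> V" "v \<in> V" "w \<noteq> v" for w v
    using that V(1) b(1)[of v w] by (auto simp: H_def eval3_lin3_dot3 intro!: prod_zero bexI[of _ v])
  have H1: "eval3 (H w) w \<noteq> 0" if "w \<in> V" for w
    using that V(1) b(2)[of _ w] l by (auto simp: H_def eval3_lin3_dot3)
  \<comment> \<open>Evaluation at \<open>v\<close> isolates the form belonging to \<open>v\<close>,
    since the extra form vanishes at all base points.\<close>
  have cv: "c (Some v) = 0" if v: "v \<in> V" for v
  proof -
    have "dot3 a v * eval3 (H p) v = 0"
      using H0[OF p v] a by (cases "v = p") auto
    with vanish[OF v] have "(\<Sum>w\<in>V. c (Some w) * (dot3 (l w) v * eval3 (H w) v)) = 0"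
      using arg_cong[OF eq', of "\<lambda>G. eval3 G v"] by (auto simp add: eval3_lin3_dot3)
    also have "(\<Sum>w\<in>V. c (Some w) * (dot3 (l w) v * eval3 (H w) v)) =
      (\<Sum>w\<in>V. if w = v then c (Some v) * (dot3 (l v) v * eval3 (H v) v) else 0)"
      using H0 v by (intro sum.cong) auto
    finally show ?thesis using l[OF v] H1[OF v] v V(1) by simp
  qed
  then have "const3 (c None) * (lin3 a * H p) = P * f + Q * g" using eq' by simp
  \<comment> \<open>The right-hand side has zero derivative along \<open>t\<close> at
    \<open>p\<close>: there \<open>f\<close> and \<open>g\<close> vanish and \<open>t\<close> kills
    both gradients.\<close>
  from arg_cong[OF this, of "\<lambda>G. dot3 t (grad3 G p)"]
  have "c None * (eval3 (H p) p * dot3 t a) = 0"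
    using vanish[OF p] t(2,3) a(1)
    by (simp add: grad3_add grad3_mult dot3_add dot3_smult eval3_lin3_dot3 dot3_commute[of t])
  then have "c None = 0" using H1[OF p] a(2) by (simp add: dot3_commute)
  with cv c show False by auto
qed

subsection \<open>The Jacobian ideal of a reduced curve\<close>

lemma const3_dvd_cancel:
  fixes p :: "'a::field poly3"
  assumes "p dvd const3 c * F" "c \<noteq> 0"
  shows "p dvd F"
proof -
  have "F = const3 (inverse c) * (const3 c * F)"
    using assms(2) by (simp add: mult.assoc[symmetric] const3_mult[symmetric])
  with assms(1) show ?thesis by (metis dvd_mult)
qed

text \<open>The coefficients form a Vandermonde matrix with distinct nodes; divided differences
  isolate \<open>C\<close>, then \<open>B\<close>, then \<open>A\<close>.\<close>

lemma dvd_three_combinations: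
  fixes p :: "'a::field poly3"
  assumes "p dvd A + const3 r * B + const3 (r^2) * C" "p dvd A + const3 s * B + const3 (s^2) * C"
    "p dvd A + const3 t * B + const3 (t^2) * C" "r \<noteq> s" "r \<noteq> t" "s \<noteq> t"
  shows "p dvd A" "p dvd B" "p dvd C"
proof -
  have step: "p dvd B + const3 (r + u) * C" if "p dvd A + const3 u * B + const3 (u^2) * C" "r \<noteq> u" for u
  proof (rule const3_dvd_cancel)
    show "r - u \<noteq> 0" using that by simp
    have "const3 (r - u) * (B + const3 (r + u) * C) =
       (A + const3 r * B + const3 (r^2) * C) - (A + const3 u * B + const3 (u^2) * C)"
      by (simp add: const3_add const3_diff const3_mult power2_eq_square algebra_simps)
    with dvd_diff[OF assms(1) that(1)] show "p dvd const3 (r - u) * (B + const3 (r + u) * C)" by simp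
  qed
  have 1: "p dvd B + const3 (r + s) * C" "p dvd B + const3 (r + t) * C" using step assms by auto
  have "const3 (s - t) * C = (B + const3 (r + s) * C) - (B + const3 (r + t) * C)"
    by (simp add: const3_add const3_diff algebra_simps)
  with dvd_diff[OF 1] have "p dvd const3 (s - t) * C" by simp
  then show C: "p dvd C" using assms by (auto intro: const3_dvd_cancel)
  have "B = (B + const3 (r + s) * C) - const3 (r + s) * C" by simp
  with 1(1) C show B: "p dvd B" by (metis dvd_diff dvd_mult)
  have "A = (A + const3 r * B + const3 (r^2) * C) - const3 r * B - const3 (r^2) * C" by simp
  with assms(1) B C show "p dvd A" by (metis dvd_diff dvd_mult)
qed

text \<open>A nonzero multiple of \<open>p\<close> has degree at least \<open>e\<close>. The last
  hypothesis covers \<open>e = 0\<close>, where truncated subtraction makes \<open>e - 1\<close>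
  equal to \<open>e\<close>.\<close>

lemma homogeneous_not_dvd_derivative:
  fixes p :: "'a::idom poly3"
  assumes p: "homogeneous e p" and D: "homogeneous (e - 1) D" "p dvd D" and "e = 0 \<Longrightarrow> D = 0"
  shows "D = 0"
proof (rule ccontr)
  assume D0: "D \<noteq> 0"
  with assms(4) have e: "e \<noteq> 0" by auto
  obtain c where c: "D = p * c" using D(2) by blast
  have "homogeneous (e - 1) (p * c)" "p * c \<noteq> 0" using D D0 c by auto
  then obtain a b where ab: "homogeneous a p" "e - 1 = a + b" by (rule homogeneous_factor)
  have "p \<noteq> 0" using D0 c by auto
  with homogeneous_unique[OF p ab(1)] ab(2) e show False by simp
qed

lemma homogeneous_0_imp_dd_0:
  assumes "homogeneous 0 F"
  shows "ddx F = 0" "ddy F = 0" "ddz F = 0"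
proof -
  have *: "coeff3 F i j k = 0" if "i + j + k \<noteq> 0" for i j k
    using homogeneousD[OF assms] that by blast
  show "ddx F = 0" by (rule poly3_eqI) (simp add: coeff3_dd *)
  show "ddy F = 0" by (rule poly3_eqI) (simp add: coeff3_dd *)
  show "ddz F = 0" by (rule poly3_eqI) (simp add: coeff3_dd *)
qed

text \<open>As \<open>F\<close> is squarefree, \<open>F = p * R\<close> with \<open>p\<close> not
  dividing \<open>R\<close>. By the product rule \<open>p\<close> divides its own derivatives, which
  vanish for degree reasons; in characteristic zero \<open>p\<close> is then constant.\<close>

lemma prime_not_dvd_gradient:
  fixes F p :: "'a::{field_char_0,factorial_ring_gcd,semiring_gcd_mult_normalize} poly3"
  assumes F: "squarefree F" "homogeneous n F" and p: "prime_elem p" "p dvd F"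
    and dvd: "p dvd ddx F" "p dvd ddy F" "p dvd ddz F"
  shows False
proof -
  obtain R where R: "F = p * R" using p(2) by blast
  have F0: "F \<noteq> 0" using F(1) by auto
  have nR: "\<not> p dvd R"
  proof
    assume "p dvd R"
    then have "p\<^sup>2 dvd F" unfolding R power2_eq_square by (intro mult_dvd_mono) auto
    with F(1) have "p dvd 1" unfolding squarefree_def by blast
    with p(1) show False by (simp add: prime_elem_def)
  qed
  have "homogeneous n (p * R)" "p * R \<noteq> 0" using F(2) F0 unfolding R by simp_all
  then obtain e where e: "homogeneous e p" by (rule homogeneous_factor)
  have cancel: "p dvd P" if "p dvd P * R + p * Q" for P Q
  proof -
    have "p dvd P * R + p * Q - p * Q" using that by (rule dvd_diff) simp
    then have "p dvd P * R" by simp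
    with nR p(1) show ?thesis by (simp add: prime_elem_dvd_mult_iff)
  qed
  have "p dvd ddx p" "p dvd ddy p" "p dvd ddz p"
    using cancel[of "ddx p" "ddx R"] cancel[of "ddy p" "ddy R"] cancel[of "ddz p" "ddz R"] dvd
    unfolding R ddx_mult ddy_mult ddz_mult by simp_all
  have "D = 0" if "homogeneous (e - 1) D" "p dvd D" "homogeneous 0 p \<Longrightarrow> D = 0" for D
  proof (rule homogeneous_not_dvd_derivative[OF e that(1,2)])
    assume "e = 0"
    with e that(3) show "D = 0" by simp
  qed
  from this[OF homogeneous_dd(1)[OF e] \<open>p dvd ddx p\<close> homogeneous_0_imp_dd_0(1)]
    this[OF homogeneous_dd(2)[OF e] \<open>p dvd ddy p\<close> homogeneous_0_imp_dd_0(2)]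
    this[OF homogeneous_dd(3)[OF e] \<open>p dvd ddz p\<close> homogeneous_0_imp_dd_0(3)]
  have "ddx p = 0" "ddy p = 0" "ddz p = 0" by simp_all
  then obtain c where c: "p = const3 c" by (rule dd_eq_0_imp_const3)
  with p(1) have "c \<noteq> 0" by auto
  have "p dvd const3 c * 1" by (simp add: c)
  then have "p dvd 1" using \<open>c \<noteq> 0\<close> by (rule const3_dvd_cancel)
  with p(1) show False by (simp add: prime_elem_def)
qed

text \<open>\<open>F\<close> has finitely many prime factors and there are infinitely many
  parameters \<open>t\<close>. If every \<open>t\<close> failed, one prime would serve three
  parameters; any three vectors \<open>(1, t, t^2)\<close> being independent, it would divide the
  whole gradient.\<close>

lemma coprime_derivative:
  fixes F :: "'a::{field_char_0,factorial_ring_gcd,semiring_gcd_mult_normalize} poly3"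
  assumes F: "squarefree F" "homogeneous n F"
  obtains t where "coprime F (ddx F + const3 t * ddy F + const3 (t^2) * ddz F)"
proof (rule ccontr)
  assume "\<not> thesis"
  with that have no: "\<not> coprime F (ddx F + const3 t * ddy F + const3 (t^2) * ddz F)" for t by blast
  have F0: "F \<noteq> 0" using F(1) by auto
  have "\<exists>p. p \<in> prime_factors F \<and> p dvd ddx F + const3 t * ddy F + const3 (t^2) * ddz F" for t
  proof -
    let ?B = "ddx F + const3 t * ddy F + const3 (t^2) * ddz F"
    have "\<not> is_unit (gcd F ?B)" "gcd F ?B \<noteq> 0"
      using no[of t] F0 by (simp_all only: is_unit_gcd gcd_eq_0_iff simp_thms)
    from prime_divisor_exists[OF this(2,1)] obtain p where p: "p dvd gcd F ?B" "prime p" by blast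
    have "p dvd F" "p dvd ?B" using dvd_trans[OF p(1) gcd_dvd1] dvd_trans[OF p(1) gcd_dvd2] .
    with F0 p(2) show ?thesis by (intro exI[of _ p]) (simp add: in_prime_factors_iff)
  qed
  then have "\<exists>P. \<forall>t. P t \<in> prime_factors F \<and> P t dvd ddx F + const3 t * ddy F + const3 (t^2) * ddz F"
    by (intro choice allI)
  then obtain P where P: "\<And>t. P t \<in> prime_factors F"
    "\<And>t. P t dvd ddx F + const3 t * ddy F + const3 (t^2) * ddz F" by blast
  have "range P \<subseteq> prime_factors F" using P(1) by blast
  then have "finite (range P)" by (rule finite_subset) simp
  then obtain t0 where inf: "infinite {t \<in> UNIV. P t = P t0}"
    using pigeonhole_infinite[of "UNIV :: 'a set" P] infinite_UNIV_char_0 by blast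
  obtain B where B: "B \<subseteq> {t. P t = P t0}" "card B = 3"
    using infinite_arbitrarily_large[OF inf, of 3] by blast
  from B(2) obtain r s t where "B = {r, s, t}" "r \<noteq> s" "s \<noteq> t" "r \<noteq> t"
    unfolding card_3_iff by blast
  with B(1) have "P r = P t0" "P s = P t0" "P t = P t0" "r \<noteq> s" "r \<noteq> t" "s \<noteq> t"
    by simp_all
  note * = P(2)[of r, unfolded this(1)] P(2)[of s, unfolded this(2)] P(2)[of t, unfolded this(3)] this(4-6)
  have "prime_elem (P t0)" "P t0 dvd F" using P(1)[of t0] by (auto simp: in_prime_factors_iff)
  then show False
    by (rule prime_not_dvd_gradient[OF F]) (rule dvd_three_combinations[OF *])+
qed

text \<open>An ideal of the polynomial ring, unlike \<open>jacobian_sheaf\<close>; localisation at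
  \<open>v\<close> is expressed by multipliers that do not vanish at \<open>v\<close>.\<close>

definition jacobian_ideal :: "'a::idom poly3 \<Rightarrow> 'a poly3 set" where
  "jacobian_ideal F = {A * ddx F + B * ddy F + C * ddz F | A B C. True}"

lemma jacobian_ideal_add:
  assumes "G \<in> jacobian_ideal F" "H \<in> jacobian_ideal F"
  shows "G + H \<in> jacobian_ideal F"
proof -
  from assms obtain A B C A' B' C' where "G = A * ddx F + B * ddy F + C * ddz F"
    "H = A' * ddx F + B' * ddy F + C' * ddz F" by (auto simp: jacobian_ideal_def)
  then have "G + H = (A + A') * ddx F + (B + B') * ddy F + (C + C') * ddz F" by (simp add: algebra_simps)
  then show ?thesis by (auto simp: jacobian_ideal_def)
qed

lemma jacobian_ideal_mult:
  assumes "G \<in> jacobian_ideal F"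
  shows "H * G \<in> jacobian_ideal F"
proof -
  from assms obtain A B C where "G = A * ddx F + B * ddy F + C * ddz F" by (auto simp: jacobian_ideal_def)
  then have "H * G = (H * A) * ddx F + (H * B) * ddy F + (H * C) * ddz F" by (simp add: algebra_simps)
  then show ?thesis by (auto simp: jacobian_ideal_def)
qed

lemma dd_in_jacobian_ideal: "ddx F \<in> jacobian_ideal F" "ddy F \<in> jacobian_ideal F" "ddz F \<in> jacobian_ideal F"
proof -
  have "ddx F = 1 * ddx F + 0 * ddy F + 0 * ddz F" "ddy F = 0 * ddx F + 1 * ddy F + 0 * ddz F"
    "ddz F = 0 * ddx F + 0 * ddy F + 1 * ddz F" by simp_all
  then show "ddx F \<in> jacobian_ideal F" "ddy F \<in> jacobian_ideal F" "ddz F \<in> jacobian_ideal F"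
    unfolding jacobian_ideal_def by blast+
qed

lemma form_in_jacobian_ideal:
  fixes F :: "'a::field_char_0 poly3"
  assumes "homogeneous n F" "n \<ge> 1"
  shows "F \<in> jacobian_ideal F"
proof -
  have "F = const3 (inverse (of_nat n)) * (X3 * ddx F + Y3 * ddy F + Z3 * ddz F)"
    unfolding euler[OF assms(1)] const3_of_nat[symmetric] mult.assoc[symmetric] const3_mult[symmetric]
    using assms(2) by simp
  also have "\<dots> \<in> jacobian_ideal F"
    by (intro jacobian_ideal_mult jacobian_ideal_add dd_in_jacobian_ideal)
  finally show ?thesis .
qed

text \<open>Projecting from the point \<open>v\<close> eliminates all but one direction.\<close>

lemma power_in_jacobian_ideal:
  fixes F :: "'a::{field_char_0,factorial_ring_gcd,semiring_gcd_mult_normalize} poly3"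
  assumes F: "squarefree F" "homogeneous n F" "n \<ge> 1" and v: "v \<noteq> 0" and av: "dot3 a v = 0"
  obtains N G where "eval3 G v \<noteq> 0" "G * lin3 a ^ N \<in> jacobian_ideal F"
proof -
  obtain t where cop: "coprime F (ddx F + const3 t * ddy F + const3 (t^2) * ddz F)" (is "coprime F ?B")
    using coprime_derivative[OF F(1,2)] .
  have F0: "F \<noteq> 0" using F(1) by auto
  have hB: "homogeneous (n - 1) ?B"
    by (intro homogeneous_add homogeneous_const3_mult homogeneous_dd F)
  obtain a' where a': "dot3 a' v \<noteq> 0" using nonvanishing_form[OF v] .
  \<comment> \<open>Any degree with \<open>D \<ge> n + (n - 1)\<close> and
    \<open>D + 1 > n * (n - 1)\<close> serves the dimension count for \<open>F\<close> and its
    derivative \<open>?B\<close>.\<close>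
  define D where "D = n + (n - 1) + n * (n - 1)"
  \<comment> \<open>The \<open>D + 1\<close> monomials of degree \<open>D\<close> in one linear form
    vanishing at \<open>v\<close> and one not vanishing there; they are too many to be independent
    modulo \<open>F\<close> and \<open>?B\<close>.\<close>
  define M where "M j = lin3 a ^ j * lin3 a' ^ (D - j)" for j
  have hM: "homogeneous D (M j)" if "j \<in> {..D}" for j
    using homogeneous_mult[OF homogeneous_power[OF homogeneous_lin3, of j a] homogeneous_power[OF homogeneous_lin3, of "D - j" a']]
      that by (simp add: M_def)
  have DJ: "n + (n - 1) \<le> D" "finite {..D}" "n * (n - 1) < card {..D}" by (auto simp: D_def)
  obtain c P Q where c: "\<exists>j\<in>{..D}. c j \<noteq> 0"
    and eq: "(\<Sum>j\<le>D. const3 (c j) * M j) = P * F + Q * ?B"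
    by (rule combination_in_ideal[OF cop F(2) F0 hB DJ hM])
  have in_ideal: "(\<Sum>j\<le>D. const3 (c j) * M j) \<in> jacobian_ideal F"
    unfolding eq
    by (intro jacobian_ideal_add jacobian_ideal_mult dd_in_jacobian_ideal form_in_jacobian_ideal[OF F(2,3)])
  \<comment> \<open>The lowest exponent of \<open>lin3 a\<close> that occurs. Dividing by that power
    leaves \<open>G\<close>, whose value at \<open>v\<close> comes from the term
    \<open>j = N\<close> alone.\<close>
  define N where "N = (LEAST j. c j \<noteq> 0)"
  from c obtain j where j: "j \<le> D" "c j \<noteq> 0" by auto
  have N: "c N \<noteq> 0" "\<And>j. j < N \<Longrightarrow> c j = 0" "N \<le> D"
    unfolding N_def using LeastI[of "\<lambda>j. c j \<noteq> 0", OF j(2)]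
      Least_le[of "\<lambda>j. c j \<noteq> 0", OF j(2)] j(1) by (auto dest: not_less_Least)
  define G where "G = (\<Sum>j\<in>{N..D}. const3 (c j) * (lin3 a ^ (j - N) * lin3 a' ^ (D - j)))"
  have "(\<Sum>j\<le>D. const3 (c j) * M j) = (\<Sum>j\<in>{N..D}. const3 (c j) * M j)"
    using N(2) by (intro sum.mono_neutral_right) auto
  also have "\<dots> = G * lin3 a ^ N"
    unfolding G_def sum_distrib_right
  proof (intro sum.cong refl)
    fix j assume "j \<in> {N..D}"
    then have "lin3 a ^ j = lin3 a ^ (j - N) * lin3 a ^ N" by (simp add: power_add[symmetric])
    then show "const3 (c j) * M j = const3 (c j) * (lin3 a ^ (j - N) * lin3 a' ^ (D - j)) * lin3 a ^ N"
      by (simp add: M_def ac_simps)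
  qed
  finally have GN: "G * lin3 a ^ N \<in> jacobian_ideal F" using in_ideal by simp
  have "eval3 G v = (\<Sum>j\<in>{N..D}. if j = N then c N * dot3 a' v ^ (D - N) else 0)"
    unfolding G_def eval3_sum using av by (intro sum.cong) (auto simp: eval3_lin3_dot3 power_0_left)
  also have "\<dots> = c N * dot3 a' v ^ (D - N)" using N(3) by (subst sum.delta) auto
  finally have "eval3 G v \<noteq> 0" using N(1) a' by simp
  from that[OF this GN] show ?thesis .
qed

text \<open>A vector field tangent to the curve preserves its Jacobian ideal.  If it had a nonzero transverse
  direction at the singular point \<open>v\<close>, differentiating would lower the exponent of a power of a local
  parameter lying in the ideal, down to exponent zero.\<close>

lemma tangent_field_at_singular_point:
  fixes F A B C e :: "'a::{field_char_0,factorial_ring_gcd,semiring_gcd_mult_normalize} poly3"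
  assumes F: "squarefree F" "homogeneous n F" "n \<ge> 1"
    and v: "v \<noteq> 0" "grad3 F v = 0"
    and field: "A * ddx F + B * ddy F + C * ddz F = e * F"
    and a: "dot3 a v = 0"
  shows "dot3 a (eval3 A v, eval3 B v, eval3 C v) = 0"
proof (rule ccontr)
  assume nz: "\<not> ?thesis"
  let ?I = "jacobian_ideal F"
  define D where "D H = A * ddx H + B * ddy H + C * ddz H" for H
  have D_add: "D (G + H) = D G + D H" for G H by (simp add: D_def algebra_simps)
  have D_mult: "D (G * H) = D G * H + G * D H" for G H
    by (simp add: D_def ddx_mult ddy_mult ddz_mult algebra_simps)
  have FI: "F \<in> ?I" using form_in_jacobian_ideal[OF F(2,3)] .
  note I = jacobian_ideal_add jacobian_ideal_mult dd_in_jacobian_ideal FI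
  have DF: "D F = e * F" by (simp add: D_def field)
  \<comment> \<open>The commutator of \<open>D\<close> with a partial derivative is a field with
    derivatives of \<open>A\<close>, \<open>B\<close>, \<open>C\<close> as coefficients, so it sends
    \<open>F\<close> into the ideal.\<close>
  have "D (ddx F) = ddx (D F) + ((- ddx A) * ddx F + (- ddx B) * ddy F + (- ddx C) * ddz F)"
    by (simp add: D_def ddx_mult dd_commute algebra_simps)
  also have "\<dots> \<in> ?I" unfolding DF ddx_mult by (intro I)
  finally have Dx: "D (ddx F) \<in> ?I" .
  have "D (ddy F) = ddy (D F) + ((- ddy A) * ddx F + (- ddy B) * ddy F + (- ddy C) * ddz F)"
    by (simp add: D_def ddy_mult dd_commute algebra_simps)
  also have "\<dots> \<in> ?I" unfolding DF ddy_mult by (intro I)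
  finally have Dy: "D (ddy F) \<in> ?I" .
  have "D (ddz F) = ddz (D F) + ((- ddz A) * ddx F + (- ddz B) * ddy F + (- ddz C) * ddz F)"
    by (simp add: D_def ddz_mult dd_commute algebra_simps)
  also have "\<dots> \<in> ?I" unfolding DF ddz_mult by (intro I)
  finally have Dz: "D (ddz F) \<in> ?I" .
  have DI: "D H \<in> ?I" if H: "H \<in> ?I" for H
  proof -
    from H obtain P Q R where "H = P * ddx F + Q * ddy F + R * ddz F"
      by (auto simp: jacobian_ideal_def)
    then have "D H = D P * ddx F + P * D (ddx F) + (D Q * ddy F + Q * D (ddy F)) + (D R * ddz F + R * D (ddz F))"
      by (simp add: D_add D_mult)
    also have "\<dots> \<in> ?I" by (intro I Dx Dy Dz)
    finally show ?thesis .
  qed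
  have D_power: "D (H ^ Suc M) = of_nat (Suc M) * H ^ M * D H" for H M
    by (induction M) (simp_all add: D_mult algebra_simps)
  have DL: "eval3 (D (lin3 a)) v \<noteq> 0"
    using nz by (cases a) (simp add: D_def dot3_def mult.commute)
  obtain N G where "eval3 G v \<noteq> 0" "G * lin3 a ^ N \<in> ?I"
    using power_in_jacobian_ideal[OF F v(1) a] .
  then have "\<exists>G. eval3 G v \<noteq> 0 \<and> G \<in> ?I"
  proof (induction N arbitrary: G)
    case 0
    then show ?case by auto
  next
    case (Suc M)
    let ?L = "lin3 a"
    \<comment> \<open>The terms with \<open>D G\<close> cancel. What remains has exponent
      \<open>M\<close>, and its cofactor does not vanish at \<open>v\<close>: \<open>D ?L\<close> is
      nonzero there by assumption, and \<open>Suc M\<close> by characteristic zero.\<close>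
    have "(of_nat (Suc M) * (G * G) * D ?L) * ?L ^ M =
        G * D (G * ?L ^ Suc M) + (- D G) * (G * ?L ^ Suc M)"
      unfolding D_mult[of G] D_power by (simp add: algebra_simps)
    also have "\<dots> \<in> ?I" by (intro I DI Suc.prems)
    finally have 1: "(of_nat (Suc M) * (G * G) * D ?L) * ?L ^ M \<in> ?I" .
    have 2: "eval3 (of_nat (Suc M) * (G * G) * D ?L) v \<noteq> 0"
      using Suc.prems(1) DL by (simp del: of_nat_Suc)
    from Suc.IH[OF 2 1] show ?case .
  qed
  then obtain P Q R where "eval3 (P * ddx F + Q * ddy F + R * ddz F) v \<noteq> 0"
    by (auto simp: jacobian_ideal_def)
  with v(2) show False by (simp add: grad3_def zero_prod_def)
qed

subsection \<open>Local rings of the plane\<close>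

text \<open>The stalk \<open>twist a p\<close> in terms of a coordinate vector \<open>v\<close> of
  \<open>p\<close>, so that vanishing becomes evaluation at one vector; \<open>loc v 0\<close> is
  the local ring.\<close>

definition loc :: "'a::field \<times> 'a \<times> 'a \<Rightarrow> int \<Rightarrow> 'a ratfun3 set" where
  "loc v a = {Fract A B | A B i j.
      homogeneous i A \<and> homogeneous j B \<and> eval3 B v \<noteq> 0 \<and> int i - int j = a}"

lemma P2_representative:
  assumes "p \<in> P2"
  obtains v where "v \<in> p" "v \<noteq> 0" "p = proj_rel `` {v}"
    "\<And>d F. homogeneous d F \<Longrightarrow> vanishes_at F p \<longleftrightarrow> eval3 F v = 0"
    "\<And>a. twist a p = loc v a"
proof -
  from assms obtain v where v: "v \<noteq> (0, 0, 0)" "p = proj_rel `` {v}"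
    by (auto simp: P2_def quotient_def)
  obtain x y z where xyz: "v = (x, y, z)" by (cases v)
  have p: "p = {(c * x, c * y, c * z) | c. c \<noteq> 0}"
    using v by (auto simp: xyz proj_rel_def)
  have van: "vanishes_at F p \<longleftrightarrow> eval3 F v = 0" if "homogeneous d F" for d F
  proof -
    have "vanishes_at F p \<longleftrightarrow> (\<forall>c. c \<noteq> 0 \<longrightarrow> eval3 F (c * x, c * y, c * z) = 0)"
      unfolding vanishes_at_def p by auto
    also have "\<dots> \<longleftrightarrow> eval3 F v = 0"
      using eval3_scale[OF that, of _ x y z] by (auto simp: xyz intro!: exI[of _ 1])
    finally show ?thesis .
  qed
  show ?thesis
  proof (rule that[OF _ _ v(2) van])
    show "v \<in> p" unfolding p xyz by (auto intro!: exI[of _ 1])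
    show "v \<noteq> 0" using v by (simp add: zero_prod_def)
    show "twist a p = loc v a" for a
      unfolding twist_def loc_def using van by (intro Collect_cong) blast
  qed
qed

lemma to_ratfun_hom [simp]:
  "to_ratfun (F + G) = to_ratfun F + to_ratfun G"
  "to_ratfun (F - G) = to_ratfun F - to_ratfun G"
  "to_ratfun (F * G) = to_ratfun F * to_ratfun G"
  "to_ratfun (- F) = - to_ratfun F"
  "to_ratfun 0 = 0" "to_ratfun 1 = 1"
  by (simp_all add: to_ratfun_def fract_collapse)

lemma to_ratfun_of_nat [simp]: "to_ratfun (of_nat n) = of_nat n"
  by (simp add: to_ratfun_def of_nat_fract)

lemma to_ratfun_eq_0_iff [simp]: "to_ratfun F = 0 \<longleftrightarrow> F = 0"
  by (simp add: to_ratfun_def Zero_fract_def eq_fract)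

lemma Fract_to_ratfun: "B \<noteq> 0 \<Longrightarrow> Fract A B = to_ratfun A / to_ratfun B"
  by (simp add: to_ratfun_def)

lemma locE:
  assumes "x \<in> loc v a"
  obtains A B i j where "x = Fract A B" "homogeneous i A" "homogeneous j B" "eval3 B v \<noteq> 0" "B \<noteq> 0"
    "int i - int j = a"
proof -
  from assms obtain A B i j where "x = Fract A B" "homogeneous i A" "homogeneous j B" "eval3 B v \<noteq> 0"
    "int i - int j = a" by (auto simp: loc_def)
  with that show ?thesis by (metis eval3_0)
qed

lemma locI: "homogeneous i A \<Longrightarrow> homogeneous j B \<Longrightarrow> eval3 B v \<noteq> 0 \<Longrightarrow> a = int i - int j \<Longrightarrow>
    Fract A B \<in> loc v a"
  by (auto simp: loc_def)

lemma loc_form: "homogeneous d F \<Longrightarrow> to_ratfun F \<in> loc v (int d)"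
  unfolding to_ratfun_def by (rule locI[of d _ 0]) auto


lemma unit_form:
  fixes v :: "'a::field \<times> 'a \<times> 'a"
  assumes "v \<noteq> 0"
  obtains L where "homogeneous d L" "eval3 L v \<noteq> 0"
proof -
  obtain a where "dot3 a v \<noteq> 0" using nonvanishing_form[OF assms] .
  then have "eval3 (lin3 a ^ d) v \<noteq> 0" by (simp add: eval3_lin3_dot3)
  moreover have "homogeneous d (lin3 a ^ d)" using homogeneous_power[OF homogeneous_lin3[of a], of d] by simp
  ultimately show ?thesis by (rule that[rotated])
qed

text \<open>The residue map of the local ring, extended to all degrees by evaluating at the chosen
  coordinate vector.\<close>

definition val3 :: "'a::field \<times> 'a \<times> 'a \<Rightarrow> 'a ratfun3 \<Rightarrow> 'a" where
  "val3 v x = (THE c. \<exists>A B. x = Fract A B \<and> eval3 B v \<noteq> 0 \<and> c = eval3 A v / eval3 B v)"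

lemma val3_Fract: "eval3 B v \<noteq> 0 \<Longrightarrow> val3 v (Fract A B) = eval3 A v / eval3 B v"
proof -
  assume B: "eval3 B v \<noteq> 0"
  have "eval3 A' v / eval3 B' v = eval3 A v / eval3 B v"
    if "Fract A B = Fract A' B'" "eval3 B' v \<noteq> 0" for A' B'
  proof -
    from that B have "A * B' = A' * B" by (metis eq_fract(1) eval3_0)
    from arg_cong[OF this, of "\<lambda>F. eval3 F v"] B that show ?thesis by (simp add: field_simps)
  qed
  with B show ?thesis unfolding val3_def by (intro the_equality) (blast, metis)
qed

lemma val3_to_ratfun [simp]: "val3 v (to_ratfun F) = eval3 F v"
  by (simp add: to_ratfun_def val3_Fract)

lemma val3_0 [simp]: "val3 v 0 = 0" and val3_1 [simp]: "val3 v 1 = 1"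
  using val3_to_ratfun[of v 0] val3_to_ratfun[of v 1] by (simp_all del: val3_to_ratfun)

lemma val3_add: "x \<in> loc v a \<Longrightarrow> y \<in> loc v b \<Longrightarrow> val3 v (x + y) = val3 v x + val3 v y"
  by (elim locE) (simp add: val3_Fract field_simps)
lemma val3_mult: "x \<in> loc v a \<Longrightarrow> y \<in> loc v b \<Longrightarrow> val3 v (x * y) = val3 v x * val3 v y"
  by (elim locE) (simp add: val3_Fract)
lemma val3_minus: "x \<in> loc v a \<Longrightarrow> val3 v (- x) = - val3 v x"
  by (elim locE) (simp add: val3_Fract)

lemma loc_mult: "x \<in> loc v a \<Longrightarrow> y \<in> loc v b \<Longrightarrow> c = a + b \<Longrightarrow> x * y \<in> loc v c"
proof (elim locE)
  fix A B i j A' B' i' j'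
  assume *: "x = Fract A B" "homogeneous i A" "homogeneous j B" "eval3 B v \<noteq> 0" "int i - int j = a"
    "y = Fract A' B'" "homogeneous i' A'" "homogeneous j' B'" "eval3 B' v \<noteq> 0" "int i' - int j' = b" "c = a + b"
  show "x * y \<in> loc v c"
    unfolding *(1,6) mult_fract
    by (rule locI[of "i + i'" _ "j + j'"]) (use * in \<open>auto intro: homogeneous_mult\<close>)
qed

lemma loc_add: "x \<in> loc v a \<Longrightarrow> y \<in> loc v a \<Longrightarrow> x + y \<in> loc v a"
proof (elim locE)
  fix A B i j A' B' i' j'
  assume *: "x = Fract A B" "homogeneous i A" "homogeneous j B" "eval3 B v \<noteq> 0" "int i - int j = a" "B \<noteq> 0"
    "y = Fract A' B'" "homogeneous i' A'" "homogeneous j' B'" "eval3 B' v \<noteq> 0" "int i' - int j' = a" "B' \<noteq> 0"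
  have eq: "i' + j = i + j'" using * by linarith
  have "homogeneous (i + j') (A * B' + A' * B)"
    using homogeneous_mult[of i A j' B'] homogeneous_mult[of i' A' j B] * eq
    by (auto intro: homogeneous_add)
  with * show "x + y \<in> loc v a"
    by (auto intro!: locI[of "i + j'" _ "j + j'"] homogeneous_mult)
qed

lemma loc_minus: "x \<in> loc v a \<Longrightarrow> - x \<in> loc v a"
  by (elim locE) (auto intro: locI homogeneous_minus)

lemma loc_diff: "x \<in> loc v a \<Longrightarrow> y \<in> loc v a \<Longrightarrow> x - y \<in> loc v a"
  using loc_add[of x v a "- y"] loc_minus[of y v a] by simp

lemma val3_diff: "x \<in> loc v a \<Longrightarrow> y \<in> loc v a \<Longrightarrow> val3 v (x - y) = val3 v x - val3 v y"
  using val3_add[of x v a "- y" a] loc_minus[of y v a] val3_minus[of y v a] by simp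

lemma loc_0 [simp]:
  assumes "v \<noteq> 0"
  shows "0 \<in> loc v a"
proof -
  obtain L where "homogeneous (nat (- a)) L" "eval3 L v \<noteq> 0" using unit_form[OF assms] .
  then have "Fract 0 L \<in> loc v a" by (intro locI[of "nat a"]) auto
  then show ?thesis by (simp add: fract_collapse)
qed

lemma loc_1 [simp]: "1 \<in> loc v 0"
  using loc_form[of 0 1 v] by simp

lemma loc_of_nat [simp]: "of_nat n \<in> loc v 0"
  using loc_form[of 0 "of_nat n" v] by simp

lemma val3_of_nat [simp]: "val3 v (of_nat n) = of_nat n"
  using val3_to_ratfun[of v "of_nat n"] by (simp del: val3_to_ratfun)

lemma loc_inverse:
  assumes "x \<in> loc v a" "val3 v x \<noteq> 0" "b = - a"
  shows "inverse x \<in> loc v b" "val3 v (inverse x) = inverse (val3 v x)"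
proof -
  from assms(1) obtain A B i j where *: "x = Fract A B" "homogeneous i A" "homogeneous j B"
    "eval3 B v \<noteq> 0" "int i - int j = a" by (elim locE)
  with assms have A: "eval3 A v \<noteq> 0" by (auto simp: val3_Fract)
  with * assms show "inverse x \<in> loc v b" by (auto intro: locI)
  from A * show "val3 v (inverse x) = inverse (val3 v x)" by (simp add: val3_Fract)
qed

lemma loc_divide:
  assumes "x \<in> loc v a" "y \<in> loc v b" "val3 v y \<noteq> 0" "c = a - b"
  shows "x / y \<in> loc v c"
  unfolding divide_inverse using assms loc_inverse[of y v b] by (intro loc_mult) auto

text \<open>A local generator of the invertible sheaf of degree \<open>a\<close>; multiplication by
  it shifts degrees.\<close>

lemma unit_loc:
  assumes "v \<noteq> 0"
  obtains x where "x \<in> loc v a" "val3 v x \<noteq> 0"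
proof -
  obtain L where L: "homogeneous (nat a) L" "eval3 L v \<noteq> 0" using unit_form[OF assms] .
  obtain M where M: "homogeneous (nat (- a)) M" "eval3 M v \<noteq> 0" using unit_form[OF assms] .
  have "Fract L M \<in> loc v a" by (rule locI[OF L(1) M]) simp
  moreover have "val3 v (Fract L M) \<noteq> 0" using L M by (simp add: val3_Fract)
  ultimately show ?thesis by (rule that)
qed

section \<open>Vector fields in homogeneous coordinates over the local rings\<close>

definition vloc :: "'a::field \<times> 'a \<times> 'a \<Rightarrow> int \<Rightarrow> ('a ratfun3 \<times> 'a ratfun3 \<times> 'a ratfun3) set" where
  "vloc v a = loc v a \<times> loc v a \<times> loc v a"

definition vgrad :: "'a::field poly3 \<Rightarrow> 'a ratfun3 \<times> 'a ratfun3 \<times> 'a ratfun3" where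
  "vgrad F = (to_ratfun (ddx F), to_ratfun (ddy F), to_ratfun (ddz F))"

definition euler3 :: "'a::field ratfun3 \<times> 'a ratfun3 \<times> 'a ratfun3" where
  "euler3 = (to_ratfun X3, to_ratfun Y3, to_ratfun Z3)"

lemma vloc_add: "x \<in> vloc v a \<Longrightarrow> y \<in> vloc v a \<Longrightarrow> x + y \<in> vloc v a"
  by (auto simp: vloc_def intro: loc_add)
lemma vloc_diff: "x \<in> vloc v a \<Longrightarrow> y \<in> vloc v a \<Longrightarrow> x - y \<in> vloc v a"
  by (auto simp: vloc_def intro: loc_diff)
lemma vloc_smult: "t \<in> loc v a \<Longrightarrow> x \<in> vloc v b \<Longrightarrow> c = a + b \<Longrightarrow> smult3 t x \<in> vloc v c"
  by (auto simp: vloc_def smult3_def intro: loc_mult)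
lemma loc_dot3: "x \<in> vloc v a \<Longrightarrow> y \<in> vloc v b \<Longrightarrow> c = a + b \<Longrightarrow> dot3 x y \<in> loc v c"
  by (auto simp: vloc_def dot3_def intro!: loc_add loc_mult)
lemma vloc_cross3: "x \<in> vloc v a \<Longrightarrow> y \<in> vloc v b \<Longrightarrow> c = a + b \<Longrightarrow> cross3 x y \<in> vloc v c"
  by (auto simp: vloc_def cross3_def intro!: loc_diff loc_mult)
lemma vloc_vgrad: "homogeneous n F \<Longrightarrow> n \<ge> 1 \<Longrightarrow> a = int n - 1 \<Longrightarrow> vgrad F \<in> vloc v a"
  using homogeneous_dd[of n F] loc_form[of "n - 1" _ v] by (auto simp: vloc_def vgrad_def of_nat_diff)
lemma vloc_euler3: "euler3 \<in> vloc v 1"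
  using loc_form[OF homogeneous_X3, of v] loc_form[OF homogeneous_Y3, of v] loc_form[OF homogeneous_Z3, of v]
  by (simp add: vloc_def euler3_def)
lemma dot3_euler3: "homogeneous n F \<Longrightarrow> dot3 euler3 (vgrad F) = of_nat n * to_ratfun F"
  using arg_cong[OF euler[of n F], of to_ratfun] by (simp only: dot3_def euler3_def vgrad_def prod.case
    to_ratfun_hom to_ratfun_of_nat)
lemma vgrad_add: "vgrad (F + G) = vgrad F + vgrad G"
  by (simp add: vgrad_def)
lemma dot3_diff: "dot3 a (u - w) = dot3 a u - dot3 a w" "dot3 (u - w) a = dot3 u a - dot3 w a"
  by (cases a; cases u; cases w; simp add: dot3_def algebra_simps)+

lemma cross3_cross3: "cross3 w (cross3 u x) = smult3 (dot3 w x) u - smult3 (dot3 w u) x"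
  by (cases u; cases w; cases x) (simp add: vec3_defs algebra_simps)
lemma dot3_cross3_cyclic: "dot3 a (cross3 b c) = dot3 b (cross3 c a)"
  by (cases a; cases b; cases c) (simp add: vec3_defs algebra_simps)
lemma dot3_cross3_self [simp]: "dot3 a (cross3 a b) = 0" "dot3 b (cross3 a b) = 0"
    "dot3 (cross3 a b) a = 0" "dot3 (cross3 a b) b = 0"
  by (cases a; cases b; simp add: vec3_defs algebra_simps)+
lemma smult3_0 [simp]: "smult3 t 0 = 0" "smult3 0 x = 0"
  by (cases x; simp add: vec3_defs)+
lemma smult3_1 [simp]: "smult3 1 x = x"
  by (cases x) (simp add: vec3_defs)

lemma gradient_wedge_eq: "gradient_wedge f g = cross3 (vgrad f) (vgrad g)"
  by (simp add: gradient_wedge_def cross3_def vgrad_def)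

lemma jacobian_sheaf_eq:
  assumes "\<And>a. twist a p = loc v a"
  shows "jacobian_sheaf d F p = (\<lambda>c. dot3 c (vgrad F)) ` vloc v (1 - int d)"
  unfolding jacobian_sheaf_def assms by (auto simp: image_iff dot3_def vgrad_def vloc_def) blast

lemma log_tangent_sheaf_eq:
  assumes "\<And>a. twist a p = loc v a"
  shows "log_tangent_sheaf F a p = {\<theta> \<in> vloc v a. dot3 \<theta> (vgrad F) = 0}"
  unfolding log_tangent_sheaf_def assms by (auto simp: dot3_def vgrad_def vloc_def)

text \<open>The hypotheses say that \<open>t\<close> times the identity is the product of a matrix
  with two columns \<open>r\<close>, \<open>s\<close> and one with two rows \<open>p\<close>,
  \<open>q\<close>. Such a product has determinant zero, and here the determinant is the cube of
  \<open>t\<close>.\<close>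

lemma scalar_matrix_of_rank_2:
  fixes t :: "'a::idom"
  assumes "t - r1 * p1 - s1 * q1 = 0" "- (r1 * p2) - s1 * q2 = 0" "- (r1 * p3) - s1 * q3 = 0" "- (r2 * p1) -
    s2 * q1 = 0" "t - r2 * p2 - s2 * q2 = 0" "- (r2 * p3) - s2 * q3 = 0" "- (r3 * p1) - s3 * q1 = 0" "-
    (r3 * p2) - s3 * q2 = 0" "t - r3 * p3 - s3 * q3 = 0"
  shows "t = 0"
proof -
  have "a + b = t" if "t - a - b = 0" for a b using that by (simp add: algebra_simps)
  moreover have "a + b = 0" if "- a - b = 0" for a b :: 'a
    using that by (metis add.inverse_inverse diff_eq_eq add.left_inverse add_0)
  ultimately have eqs: "r1 * p1 + s1 * q1 = t" "r1 * p2 + s1 * q2 = 0" "r1 * p3 + s1 * q3 = 0" "r2 * p1 + s2 * q1 = 0" "r2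
    * p2 + s2 * q2 = t" "r2 * p3 + s2 * q3 = 0" "r3 * p1 + s3 * q1 = 0" "r3 * p2 + s3 * q2 = 0" "r3 * p3
    + s3 * q3 = t"
    using assms by blast+
  have "(r1 * p1 + s1 * q1) * ((r2 * p2 + s2 * q2) * (r3 * p3 + s3 * q3) - (r2 * p3 + s2 * q3) * (r3 * p2 + s3 * q2))
      - (r1 * p2 + s1 * q2) * ((r2 * p1 + s2 * q1) * (r3 * p3 + s3 * q3) - (r2 * p3 + s2 * q3) * (r3 * p1 + s3 * q1))
      + (r1 * p3 + s1 * q3) * ((r2 * p1 + s2 * q1) * (r3 * p2 + s3 * q2) - (r2 * p2 + s2 * q2) * (r3 * p1 + s3 * q1)) = 0"
    by (simp add: algebra_simps)
  then show ?thesis by (simp add: eqs)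
qed

text \<open>Three elements generating an ideal that two of its elements also generate satisfy a relation with a unit
  coefficient, since the identity matrix of size 3 does not factor through a 2-dimensional space.\<close>

lemma two_generators_relation:
  fixes F :: "'a::field poly3"
  assumes v: "v \<noteq> 0"
    and u: "u \<in> (\<lambda>c. dot3 c G) ` vloc v a" and w: "w \<in> (\<lambda>c. dot3 c G) ` vloc v a"
    and gen: "(\<lambda>c. dot3 c G) ` vloc v a \<subseteq> {r * u + s * w | r s. r \<in> loc v 0 \<and> s \<in> loc v 0}"
  obtains \<theta> where "\<theta> \<in> vloc v 0" "dot3 \<theta> G = 0"
    "(val3 v (fst \<theta>), val3 v (fst (snd \<theta>)), val3 v (snd (snd \<theta>))) \<noteq> 0"
proof -
  obtain t where t: "t \<in> loc v a" "val3 v t \<noteq> 0" using unit_loc[OF v] .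
  obtain p where p: "u = dot3 p G" "p \<in> vloc v a" using u by auto
  obtain q where q: "w = dot3 q G" "q \<in> vloc v a" using w by auto
  obtain p1 p2 p3 where p': "p = (p1, p2, p3)" by (cases p)
  obtain q1 q2 q3 where q': "q = (q1, q2, q3)" by (cases q)
  have pq: "p1 \<in> loc v a" "p2 \<in> loc v a" "p3 \<in> loc v a" "q1 \<in> loc v a" "q2 \<in> loc v a" "q3 \<in> loc v a"
    using p q by (auto simp: p' q' vloc_def)
  obtain G1 G2 G3 where G: "G = (G1, G2, G3)" by (cases G)
  have row: "\<exists>r s. r \<in> loc v 0 \<and> s \<in> loc v 0 \<and> dot3 c G = r * u + s * w" if "c \<in> vloc v a" for c
    using gen that by blast
  from row[of "(t, 0, 0)"] obtain r1 s1 where 1: "r1 \<in> loc v 0" "s1 \<in> loc v 0" "t * G1 = r1 * u + s1 * w"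
    using t v by (auto simp: vloc_def G dot3_def)
  from row[of "(0, t, 0)"] obtain r2 s2 where 2: "r2 \<in> loc v 0" "s2 \<in> loc v 0" "t * G2 = r2 * u + s2 * w"
    using t v by (auto simp: vloc_def G dot3_def)
  from row[of "(0, 0, t)"] obtain r3 s3 where 3: "r3 \<in> loc v 0" "s3 \<in> loc v 0" "t * G3 = r3 * u + s3 * w"
    using t v by (auto simp: vloc_def G dot3_def)
  \<comment> \<open>Each coordinate of \<open>G\<close>, times \<open>t\<close>, is expressed
    through the two generators, and these in turn through \<open>G\<close>; \<open>R\<close> is the
    resulting relation.\<close>
  define R where "R e r s = smult3 t e - smult3 r p - smult3 s q" for e r s
  define V where "V \<theta> = (val3 v (fst \<theta>), val3 v (fst (snd \<theta>)), val3 v (snd (snd \<theta>)))" for \<theta>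
  have rel: "dot3 (R (1, 0, 0) r1 s1) G = 0" "dot3 (R (0, 1, 0) r2 s2) G = 0" "dot3 (R (0, 0, 1) r3 s3) G = 0"
    using 1(3) 2(3) 3(3) by (simp_all add: R_def dot3_diff dot3_smult p q) (simp_all add: G dot3_def)
  have mem: "R e r s \<in> vloc v a" if "e \<in> {(1, 0, 0), (0, 1, 0), (0, 0, 1)}" "r \<in> loc v 0" "s \<in> loc v 0" for e r s
    unfolding R_def using that t p q v
    by (intro vloc_diff vloc_smult[of _ v 0] vloc_smult[of t v a _ 0]) (auto simp: vloc_def)
  have comp: "val3 v (t * e - r * x - s * y) = val3 v t * val3 v e - val3 v r * val3 v x - val3 v s * val3 v y"
    if "e \<in> loc v 0" "r \<in> loc v 0" "s \<in> loc v 0" "x \<in> loc v a" "y \<in> loc v a" for e r s x y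
  proof -
    have m: "t * e \<in> loc v a" "r * x \<in> loc v a" "s * y \<in> loc v a"
      using that t by (auto intro: loc_mult)
    show ?thesis
      using val3_diff[OF loc_diff[OF m(1,2)] m(3)] val3_diff[OF m(1,2)]
        val3_mult[OF t(1) that(1)] val3_mult[OF that(2,4)] val3_mult[OF that(3,5)] by simp
  qed
  \<comment> \<open>If no relation had a unit coefficient, reduction modulo the maximal ideal would
    make the scalar matrix of \<open>val3 v t\<close> have rank at most two.\<close>
  have "\<exists>\<theta>. \<theta> \<in> vloc v a \<and> dot3 \<theta> G = 0 \<and> V \<theta> \<noteq> 0"
  proof (rule ccontr)
    assume no: "\<not> ?thesis"
    have "V (R (1, 0, 0) r1 s1) = 0" "V (R (0, 1, 0) r2 s2) = 0" "V (R (0, 0, 1) r3 s3) = 0"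
      using no rel mem 1 2 3 by blast+
    then have z:
      "val3 v t - val3 v r1 * val3 v p1 - val3 v s1 * val3 v q1 = 0"
      "- (val3 v r1 * val3 v p2) - val3 v s1 * val3 v q2 = 0"
      "- (val3 v r1 * val3 v p3) - val3 v s1 * val3 v q3 = 0"
      "- (val3 v r2 * val3 v p1) - val3 v s2 * val3 v q1 = 0"
      "val3 v t - val3 v r2 * val3 v p2 - val3 v s2 * val3 v q2 = 0"
      "- (val3 v r2 * val3 v p3) - val3 v s2 * val3 v q3 = 0"
      "- (val3 v r3 * val3 v p1) - val3 v s3 * val3 v q1 = 0"
      "- (val3 v r3 * val3 v p2) - val3 v s3 * val3 v q2 = 0"
      "val3 v t - val3 v r3 * val3 v p3 - val3 v s3 * val3 v q3 = 0"
      using 1(1,2) 2(1,2) 3(1,2) pq v comp[of 0] comp[of 1]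
      by (simp_all add: V_def R_def smult3_def p' q' zero_prod_def)
    have "val3 v t = 0"
      by (rule scalar_matrix_of_rank_2[OF z])
    with t show False by simp
  qed
  then obtain \<theta> where \<theta>: "\<theta> \<in> vloc v a" "dot3 \<theta> G = 0" "V \<theta> \<noteq> 0" by blast
  obtain r where r: "r \<in> loc v (- a)" "val3 v r \<noteq> 0" using unit_loc[OF v] .
  have 1: "smult3 r \<theta> \<in> vloc v 0" using r \<theta> by (intro vloc_smult) auto
  have 2: "dot3 (smult3 r \<theta>) G = 0" using \<theta> by (simp add: dot3_smult)
  have "V (smult3 r \<theta>) = smult3 (val3 v r) (V \<theta>)"
    using \<theta>(1) r(1) by (cases \<theta>) (auto simp: V_def smult3_def vloc_def intro: val3_mult)
  moreover have "smult3 (val3 v r) (V \<theta>) \<noteq> 0" using \<theta>(3) r(2) by (cases "V \<theta>") (auto simp: vec3_defs)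
  ultimately have 3: "V (smult3 r \<theta>) \<noteq> 0" by simp
  from that[OF 1 2] 3 show ?thesis by (simp add: V_def)
qed

lemma to_ratfun_eq_iff [simp]: "to_ratfun F = to_ratfun G \<longleftrightarrow> F = G"
  using to_ratfun_eq_0_iff[of "F - G"] by (simp del: to_ratfun_eq_0_iff) 

lemma of_nat_ratfun_eq_0_iff [simp]: "(of_nat n :: 'a::field_char_0 ratfun3) = 0 \<longleftrightarrow> n = 0"
  by (metis of_nat_eq_0_iff to_ratfun_eq_0_iff to_ratfun_of_nat)

text \<open>Multiplication with the product of the denominators gives polynomial components of one
  degree, so that statements about polynomial fields apply.\<close>

lemma common_denominator:
  assumes "\<theta> \<in> vloc v 0"
  obtains A B C H d where "homogeneous d A" "homogeneous d B" "homogeneous d C" "eval3 H v \<noteq> 0"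
    "smult3 (to_ratfun H) \<theta> = (to_ratfun A, to_ratfun B, to_ratfun C)"
    "(eval3 A v, eval3 B v, eval3 C v) =
       smult3 (eval3 H v) (val3 v (fst \<theta>), val3 v (fst (snd \<theta>)), val3 v (snd (snd \<theta>)))"
proof -
  obtain x y z where \<theta>: "\<theta> = (x, y, z)" by (cases \<theta>)
  obtain A1 B1 i1 j1 where 1: "x = Fract A1 B1" "homogeneous i1 A1" "homogeneous j1 B1" "eval3 B1 v \<noteq> 0"
    "B1 \<noteq> 0" "int i1 - int j1 = 0" using assms by (auto simp: \<theta> vloc_def elim!: locE)
  obtain A2 B2 i2 j2 where 2: "y = Fract A2 B2" "homogeneous i2 A2" "homogeneous j2 B2" "eval3 B2 v \<noteq> 0"
    "B2 \<noteq> 0" "int i2 - int j2 = 0" using assms by (auto simp: \<theta> vloc_def elim!: locE)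
  obtain A3 B3 i3 j3 where 3: "z = Fract A3 B3" "homogeneous i3 A3" "homogeneous j3 B3" "eval3 B3 v \<noteq> 0"
    "B3 \<noteq> 0" "int i3 - int j3 = 0" using assms by (auto simp: \<theta> vloc_def elim!: locE)
  show ?thesis
  proof (rule that[of "j1 + j2 + j3" "A1 * (B2 * B3)" "A2 * (B1 * B3)" "A3 * (B1 * B2)" "B1 * B2 * B3"])
    have "homogeneous (j1 + (j2 + j3)) (A1 * (B2 * B3))" "homogeneous (j2 + (j1 + j3)) (A2 * (B1 * B3))"
      "homogeneous (j3 + (j1 + j2)) (A3 * (B1 * B2))"
      using 1 2 3 by (auto intro!: homogeneous_mult)
    then show "homogeneous (j1 + j2 + j3) (A1 * (B2 * B3))" "homogeneous (j1 + j2 + j3) (A2 * (B1 * B3))"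
      "homogeneous (j1 + j2 + j3) (A3 * (B1 * B2))" by (simp_all add: ac_simps)
    show "eval3 (B1 * B2 * B3) v \<noteq> 0" using 1 2 3 by simp
    show "smult3 (to_ratfun (B1 * B2 * B3)) \<theta> =
      (to_ratfun (A1 * (B2 * B3)), to_ratfun (A2 * (B1 * B3)), to_ratfun (A3 * (B1 * B2)))"
      using 1(1,5) 2(1,5) 3(1,5) by (simp add: \<theta> smult3_def Fract_to_ratfun)
    show "(eval3 (A1 * (B2 * B3)) v, eval3 (A2 * (B1 * B3)) v, eval3 (A3 * (B1 * B2)) v) =
       smult3 (eval3 (B1 * B2 * B3) v) (val3 v (fst \<theta>), val3 v (fst (snd \<theta>)), val3 v (snd (snd \<theta>)))"
      using 1 2 3 by (simp add: \<theta> smult3_def val3_Fract)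
  qed
qed

text \<open>What is needed of a product \<open>u = \<Phi>(l, g)\<close> of \<open>k\<close> members of the pencil: \<open>u1\<close> and \<open>u2\<close> are the partial
  derivatives of the binary form \<open>\<Phi>\<close> at \<open>(l, g)\<close>.\<close>

definition binary_form :: "'a::field poly3 \<Rightarrow> 'a poly3 \<Rightarrow> nat \<Rightarrow> nat \<Rightarrow> 'a poly3 \<Rightarrow> 'a poly3 \<Rightarrow> 'a poly3 \<Rightarrow> bool" where
  "binary_form l g n k u u1 u2 \<longleftrightarrow>
     homogeneous (k * n) u \<and> homogeneous (k * n) (l * u1) \<and> homogeneous (k * n - n) u2 \<and> (k = 0 \<longrightarrow> u2 = 0) \<and>
     ddx u = u1 * ddx l + u2 * ddx g \<and> ddy u = u1 * ddy l + u2 * ddy g \<and> ddz u = u1 * ddz l + u2 * ddz g \<and>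
     l * u1 + g * u2 = of_nat k * u"

lemma vgrad_binary_form:
  assumes "binary_form l g n k u u1 u2"
  shows "vgrad (l * u) = smult3 (to_ratfun (u + l * u1)) (vgrad l) + smult3 (to_ratfun (l * u2)) (vgrad g)"
  using assms unfolding binary_form_def
  by (auto simp: vgrad_def smult3_def ddx_mult ddy_mult ddz_mult algebra_simps)

text \<open>\<open>u + l * u1\<close> and \<open>l * u2\<close> are the partial derivatives of the
  binary form of \<open>l * u\<close>, which has degree \<open>Suc k\<close>; this is its Euler
  relation.\<close>

lemma euler_binary_form:
  assumes "binary_form l g n k u u1 u2"
  shows "l * (u + l * u1) + g * (l * u2) = of_nat (Suc k) * (u * l)"
proof -
  have "l * (u + l * u1) + g * (l * u2) = l * (u + (l * u1 + g * u2))" by (simp add: algebra_simps)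
  also have "l * u1 + g * u2 = of_nat k * u" using assms by (simp add: binary_form_def)
  finally show ?thesis by (simp add: algebra_simps)
qed

text \<open>The local form of the fact that \<open>l\<close> lies in the ideal of its derivatives along the fibres of the
  pencil: near \<open>v\<close> the function \<open>l/g\<close> is an eigenfunction of a vector field.  The given field \<open>\<theta>\<close> differs
  from a field \<open>N\<close> killing \<open>g\<close> by a multiple \<open>q\<close> of the Euler field, and \<open>q\<close> cannot vanish at \<open>v\<close>,
  for \<open>N\<close> would then be tangent to the curve and nonzero at the singular point.\<close>

lemma scaling_field:
  fixes l g :: "'a::{field_char_0,factorial_ring_gcd,semiring_gcd_mult_normalize} poly3"
  assumes l: "squarefree l" "homogeneous n l" "n \<ge> 1" and g: "homogeneous n g"
    and v: "v \<noteq> 0" "eval3 l v = 0" "grad3 l v = 0" "eval3 g v \<noteq> 0" "eval3 u v \<noteq> 0"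
    and u: "binary_form l g n k u u1 u2"
    and \<theta>: "\<theta> \<in> vloc v 0" "dot3 \<theta> (vgrad (l * u)) = 0"
      "(val3 v (fst \<theta>), val3 v (fst (snd \<theta>)), val3 v (snd (snd \<theta>))) \<noteq> 0"
  obtains \<chi> where "\<chi> \<in> vloc v 1" "dot3 \<chi> (vgrad l) = to_ratfun l" "dot3 \<chi> (vgrad g) = 0"
proof -
  obtain A B C H d where A: "homogeneous d A" "homogeneous d B" "homogeneous d C" and H: "eval3 H v \<noteq> 0"
    and eq: "smult3 (to_ratfun H) \<theta> = (to_ratfun A, to_ratfun B, to_ratfun C)" (is "_ = ?A")
    and ev: "(eval3 A v, eval3 B v, eval3 C v) =
       smult3 (eval3 H v) (val3 v (fst \<theta>), val3 v (fst (snd \<theta>)), val3 v (snd (snd \<theta>)))" (is "?Av = _")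
    using common_denominator[OF \<theta>(1)] .
  have Av: "?Av \<noteq> 0"
    unfolding ev using \<theta>(3) H by (auto simp: smult3_def zero_prod_def)
  \<comment> \<open>The partial derivative in the variable \<open>l\<close> of the binary form of
    \<open>l * u\<close>; it is a unit at \<open>v\<close> because \<open>l\<close> vanishes there
    and \<open>u\<close> does not.\<close>
  define U where "U = u + l * u1"
  define q where "q = A * ddx g + B * ddy g + C * ddz g"
  have hU: "homogeneous (k * n) U" "homogeneous (k * n) u"
    using u unfolding U_def binary_form_def by (auto intro: homogeneous_add)
  have hq: "homogeneous (d + (n - 1)) q"
    unfolding q_def by (intro homogeneous_add homogeneous_mult A homogeneous_dd g)
  have Uv: "eval3 U v \<noteq> 0" using v by (simp add: U_def)
  have qR: "to_ratfun q = dot3 ?A (vgrad g)" by (simp add: q_def vgrad_def dot3_def)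
  \<comment> \<open>The combination of the cleared field with components \<open>F\<close> and the
    Euler field with components \<open>T\<close> that kills \<open>g\<close>: the former sends
    \<open>g\<close> to \<open>q\<close>, the latter to \<open>n * g\<close>.\<close>
  define N where "N F T = of_nat n * g * F - q * T" for F T
  let ?N = "(to_ratfun (N A X3), to_ratfun (N B Y3), to_ratfun (N C Z3))"
  have N: "?N = smult3 (of_nat n * to_ratfun g) ?A - smult3 (to_ratfun q) euler3"
    by (simp only: N_def smult3_def euler3_def to_ratfun_hom to_ratfun_of_nat prod.case diff_Pair)
  have Ng: "dot3 ?N (vgrad g) = 0"
    unfolding N by (simp add: dot3_diff dot3_smult dot3_euler3[OF g] qR[symmetric])
  have "dot3 ?A (vgrad (l * u)) = 0"
    unfolding eq[symmetric] using \<theta>(2) by (simp add: dot3_smult)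
  then have AF: "to_ratfun U * dot3 ?A (vgrad l) = - to_ratfun (l * u2) * to_ratfun q"
    unfolding vgrad_binary_form[OF u] U_def[symmetric] qR dot3_add dot3_smult
    by (simp add: eq_neg_iff_add_eq_0)
  \<comment> \<open>Up to the units \<open>U\<close>, \<open>u\<close> and a nonzero integer, the
    field \<open>?N\<close> multiplies \<open>l\<close> by \<open>q\<close>; the Euler relation of
    the binary form collects the terms.\<close>
  have "to_ratfun U * dot3 ?N (vgrad l) =
      of_nat n * to_ratfun g * (to_ratfun U * dot3 ?A (vgrad l)) - of_nat n * to_ratfun q * to_ratfun (l * U)"
    unfolding N by (simp add: dot3_diff dot3_smult dot3_euler3[OF l(2)] algebra_simps)
  also have "\<dots> = - of_nat n * to_ratfun q * to_ratfun (l * U + g * (l * u2))"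
    unfolding AF by (simp add: algebra_simps)
  also have "\<dots> = - (of_nat (n * Suc k) * to_ratfun q * to_ratfun u) * to_ratfun l"
    unfolding U_def euler_binary_form[OF u] by (simp only: to_ratfun_hom to_ratfun_of_nat of_nat_mult, simp)
  finally have key: "to_ratfun U * dot3 ?N (vgrad l) = - (of_nat (n * Suc k) * to_ratfun q * to_ratfun u) * to_ratfun l" .
  \<comment> \<open>Otherwise \<open>U\<close> times \<open>?N\<close> is a tangent field whose
    value at \<open>v\<close> is a nonzero multiple of \<open>?Av\<close>, so \<open>?Av\<close> is
    \<open>t\<close> times \<open>v\<close>. Applied to \<open>g\<close> this gives
    \<open>q = t * n * g\<close> at \<open>v\<close>, hence \<open>t = 0\<close>, contradicting
    \<open>?Av \<noteq> 0\<close>.\<close>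
  have qv: "eval3 q v \<noteq> 0"
  proof
    assume q0: "eval3 q v = 0"
    have "to_ratfun (U * N A X3 * ddx l + U * N B Y3 * ddy l + U * N C Z3 * ddz l) =
        to_ratfun U * dot3 ?N (vgrad l)"
      by (simp add: dot3_def vgrad_def algebra_simps)
    also have "\<dots> = to_ratfun (- (of_nat (n * Suc k) * q * u) * l)"
      unfolding key by (simp only: to_ratfun_hom to_ratfun_of_nat)
    finally have field: "U * N A X3 * ddx l + U * N B Y3 * ddy l + U * N C Z3 * ddz l =
        (- (of_nat (n * Suc k) * q * u)) * l" by (simp only: to_ratfun_eq_iff)
    have evN: "eval3 (U * N F T) v = eval3 U v * of_nat n * eval3 g v * eval3 F v" for F T
      by (simp add: N_def q0)
    have perp: "dot3 a ?Av = 0" if "dot3 a v = 0" for a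
    proof -
      have "dot3 a (eval3 (U * N A X3) v, eval3 (U * N B Y3) v, eval3 (U * N C Z3) v) = 0"
        by (rule tangent_field_at_singular_point[OF l v(1,3) field that])
      then have "eval3 U v * of_nat n * eval3 g v * dot3 a ?Av = 0"
        unfolding evN by (cases a) (simp add: dot3_def algebra_simps)
      then show ?thesis using Uv v(4) l(3) by simp
    qed
    then have "cross3 v ?Av = 0" using separating_form by metis
    then obtain t where t: "?Av = smult3 t v" using cross3_parallel v(1) by metis
    have "eval3 q v = dot3 ?Av (grad3 g v)" by (simp add: q_def dot3_def grad3_def)
    also have "\<dots> = t * (of_nat n * eval3 g v)"
      unfolding t dot3_smult euler_grad3[OF g] ..
    finally have "t = 0" using q0 v(4) l(3) by simp
    with t Av show False by simp
  qed
  \<comment> \<open>The factor that normalises \<open>?N\<close> so that it sends \<open>l\<close>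
    to \<open>l\<close> itself.\<close>
  define c where "c = - to_ratfun U / (of_nat (n * Suc k) * to_ratfun q * to_ratfun u)"
  have nz: "of_nat (n * Suc k) * to_ratfun q * to_ratfun u \<noteq> 0"
    unfolding mult_eq_0_iff of_nat_ratfun_eq_0_iff to_ratfun_eq_0_iff using qv v l(3) by auto
  have lu: "to_ratfun u \<in> loc v (int (k * n))" "to_ratfun q \<in> loc v (int d + int n - 1)"
    "to_ratfun U \<in> loc v (int (k * n))"
    using loc_form[OF hU(1), of v] loc_form[OF hU(2), of v] loc_form[OF hq, of v] l(3)
    by (simp_all add: of_nat_diff algebra_simps)
  have c_loc: "c \<in> loc v (1 - int d - int n)"
    unfolding c_def
  proof (rule loc_divide)
    have 1: "of_nat (n * Suc k) * to_ratfun q \<in> loc v (int d + int n - 1)"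
      by (rule loc_mult[OF loc_of_nat lu(2)]) simp
    show 2: "of_nat (n * Suc k) * to_ratfun q * to_ratfun u \<in> loc v (int d + int n - 1 + int (k * n))"
      by (rule loc_mult[OF 1 lu(1)]) simp
    have "val3 v (of_nat (n * Suc k) * to_ratfun q * to_ratfun u) = of_nat (n * Suc k) * eval3 q v * eval3 u v"
      by (simp only: val3_mult[OF 1 lu(1)] val3_mult[OF loc_of_nat lu(2)] val3_of_nat val3_to_ratfun)
    also have "\<dots> \<noteq> 0" unfolding mult_eq_0_iff of_nat_eq_0_iff using qv v l(3) by simp
    finally show "val3 v (of_nat (n * Suc k) * to_ratfun q * to_ratfun u) \<noteq> 0" .
    show "- to_ratfun U \<in> loc v (int (k * n))" by (rule loc_minus[OF lu(3)])
  qed simp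
  have N_loc: "?N \<in> vloc v (int d + int n)"
  proof -
    have hN: "homogeneous (n + d) (N F T)" if "homogeneous d F" "homogeneous (Suc 0) T" for F T
    proof -
      have "homogeneous (0 + n + d) (of_nat n * g * F)" by (intro homogeneous_mult that g homogeneous_of_nat)
      moreover have "homogeneous (d + (n - 1) + Suc 0) (q * T)" by (intro homogeneous_mult that hq)
      moreover have "d + (n - 1) + Suc 0 = n + d" using l(3) by simp
      ultimately show ?thesis unfolding N_def by (metis add_0 homogeneous_diff)
    qed
    show ?thesis
      using loc_form[OF hN[OF A(1) homogeneous_X3], of v] loc_form[OF hN[OF A(2) homogeneous_Y3], of v]
        loc_form[OF hN[OF A(3) homogeneous_Z3], of v] by (simp add: vloc_def add.commute)
  qed
  show ?thesis
  proof (rule that)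
    show "smult3 c ?N \<in> vloc v 1" by (rule vloc_smult[OF c_loc N_loc]) simp
    have "dot3 (smult3 c ?N) (vgrad l) =
        - (to_ratfun U * dot3 ?N (vgrad l)) / (of_nat (n * Suc k) * to_ratfun q * to_ratfun u)"
      unfolding c_def dot3_smult by simp
    also have "\<dots> = to_ratfun l" unfolding key using nz by simp
    finally show "dot3 (smult3 c ?N) (vgrad l) = to_ratfun l" .
    show "dot3 (smult3 c ?N) (vgrad g) = 0" by (simp only: dot3_smult Ng mult_zero_right)
  qed
qed

text \<open>The denominator \<open>B'\<close> of the reduced fraction divides \<open>P * G\<close>
  and \<open>Q * H\<close> with \<open>G\<close> and \<open>H\<close> not vanishing at
  \<open>v\<close>; as \<open>P\<close> and \<open>Q\<close> are coprime, it divides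
  \<open>G * H\<close>. Geometrically, poles cannot be confined to codimension two.\<close>

lemma loc_of_coprime:
  fixes P Q :: "'a::{field_char_0,factorial_ring_gcd,semiring_gcd_mult_normalize} poly3"
  assumes v: "v \<noteq> 0" and x: "x = Fract A B" "homogeneous i A" "homogeneous j B" "B \<noteq> 0"
    and cop: "coprime P Q" and P: "x * to_ratfun P \<in> loc v a" and Q: "x * to_ratfun Q \<in> loc v b"
  shows "x \<in> loc v (int i - int j)"
proof (cases "A = 0")
  case True
  with x v show ?thesis by (simp add: fract_collapse)
next
  case False
  obtain A' B' c where A': "A = A' * c" "B = B' * c" "coprime A' B'"
    using gcd_coprime_exists[of A B] x(4) by auto
  have ne: "A' \<noteq> 0" "B' \<noteq> 0" "c \<noteq> 0" using A' False x by auto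
  have "homogeneous i (A' * c)" "A' * c \<noteq> 0" "homogeneous j (B' * c)" "B' * c \<noteq> 0" using A' ne x by auto
  then obtain i' a' j' b' where h: "homogeneous i' A'" "homogeneous a' c" "i = i' + a'"
    "homogeneous j' B'" "homogeneous b' c" "j = j' + b'" by (metis homogeneous_factor)
  have "a' = b'" using homogeneous_unique[OF h(2,5) ne(3)] .
  have x': "x = Fract A' B'"
    unfolding x A' using ne by (simp add: eq_fract)
  have dvd: "\<exists>H. eval3 H v \<noteq> 0 \<and> B' dvd R * H" if R: "x * to_ratfun R \<in> loc v a" for R a
  proof -
    obtain C E where CE: "x * to_ratfun R = Fract C E" "eval3 E v \<noteq> 0" "E \<noteq> 0" using R by (auto elim!: locE)
    then have "A' * R * E = C * B'" using ne by (simp add: x' to_ratfun_def eq_fract)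
    then have "B' dvd A' * (R * E)" by (metis dvd_triv_right mult.assoc)
    then have "B' dvd R * E" using A'(3) by (simp add: coprime_commute coprime_dvd_mult_right_iff)
    with CE show ?thesis by blast
  qed
  from dvd[OF P] dvd[OF Q] obtain G H where GH: "eval3 G v \<noteq> 0" "B' dvd P * G" "eval3 H v \<noteq> 0" "B' dvd Q * H"
    by blast
  have "B' dvd gcd (P * (G * H)) (Q * (G * H))"
    using GH by (metis dvd_mult2 gcd_greatest mult.assoc mult.left_commute mult.commute)
  also have "gcd (P * (G * H)) (Q * (G * H)) dvd G * H"
    using cop by (simp add: gcd_mult_right gcd_mult_left coprime_iff_gcd_eq_1 gcd.commute)
  finally have "B' dvd G * H" .
  then obtain K where "G * H = B' * K" by blast
  from arg_cong[OF this, of "\<lambda>F. eval3 F v"] GH have "eval3 B' v \<noteq> 0" by auto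
  then have "Fract A' B' \<in> loc v (int i' - int j')" by (intro locI[OF h(1,4)]) auto
  then show ?thesis using h \<open>a' = b'\<close> by (simp add: x')
qed

subsection \<open>The zero scheme at a point\<close>

definition functional_values ::
    "'a::field \<times> 'a \<times> 'a \<Rightarrow> 'a ratfun3 \<times> 'a ratfun3 \<times> 'a ratfun3 \<Rightarrow> int \<Rightarrow>
     'a ratfun3 \<times> 'a ratfun3 \<times> 'a ratfun3 \<Rightarrow> 'a ratfun3 set" where
  "functional_values v G a s =
     {\<phi> s | \<phi>. linear_functional (loc v 0) {\<theta> \<in> vloc v a. dot3 \<theta> G = 0} \<phi>}"

lemma functional_valuesI:
  "linear_functional (loc v 0) {\<theta> \<in> vloc v a. dot3 \<theta> G = 0} \<phi> \<Longrightarrow> x = \<phi> s \<Longrightarrow>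
     x \<in> functional_values v G a s"
  by (auto simp: functional_values_def)

lemma zero_scheme_sheaf_eq:
  assumes "\<And>a. twist a p = loc v a"
  shows "zero_scheme_sheaf F a s p = functional_values v (vgrad F) a s"
  by (simp add: zero_scheme_sheaf_def functional_values_def assms log_tangent_sheaf_eq[OF assms])

lemma linear_functionalI:
  assumes "\<And>\<theta>. \<theta> \<in> E \<Longrightarrow> \<phi> \<theta> \<in> R"
    and "\<And>\<theta> \<eta>. \<theta> \<in> E \<Longrightarrow> \<eta> \<in> E \<Longrightarrow> \<phi> (\<theta> + \<eta>) = \<phi> \<theta> + \<phi> \<eta>"
    and "\<And>c \<theta>. c \<in> R \<Longrightarrow> \<theta> \<in> E \<Longrightarrow> \<phi> (smult3 c \<theta>) = c * \<phi> \<theta>"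
  shows "linear_functional R E \<phi>"
proof -
  have "\<phi> (c * P, c * Q, c * S) = c * \<phi> (P, Q, S)" if "c \<in> R" "(P, Q, S) \<in> E" for c P Q S
    using assms(3)[OF that] by (simp add: smult3_def)
  with assms(1,2) show ?thesis unfolding linear_functional_def by blast
qed

lemma linear_functional_smult:
  "linear_functional R E \<phi> \<Longrightarrow> c \<in> R \<Longrightarrow> \<theta> \<in> E \<Longrightarrow> \<phi> (smult3 c \<theta>) = c * \<phi> \<theta>"
  unfolding linear_functional_def smult3_def by (cases \<theta>) simp

text \<open>Multiples of one functional with invertible value at \<open>s\<close> attain every
  value.\<close>

lemma functional_values_unit:
  assumes "linear_functional (loc v 0) {\<theta> \<in> vloc v a. dot3 \<theta> G = 0} \<phi>"
    and s: "s \<in> vloc v a" "dot3 s G = 0" and r: "r \<in> loc v 0" "r * \<phi> s = 1"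
  shows "functional_values v G a s = loc v 0"
proof
  show "functional_values v G a s \<subseteq> loc v 0"
  proof
    fix y assume "y \<in> functional_values v G a s"
    then obtain \<psi> where "linear_functional (loc v 0) {\<theta> \<in> vloc v a. dot3 \<theta> G = 0} \<psi>" "y = \<psi> s"
      unfolding functional_values_def by blast
    with s show "y \<in> loc v 0" unfolding linear_functional_def by blast
  qed
  show "loc v 0 \<subseteq> functional_values v G a s"
  proof
    fix x assume x: "x \<in> loc v 0"
    have "linear_functional (loc v 0) {\<theta> \<in> vloc v a. dot3 \<theta> G = 0} (\<lambda>\<theta>. x * r * \<phi> \<theta>)"
    proof (rule linear_functionalI)
      show "x * r * \<phi> \<theta> \<in> loc v 0" if "\<theta> \<in> {\<theta> \<in> vloc v a. dot3 \<theta> G = 0}" for \<theta>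
      proof -
        have "\<phi> \<theta> \<in> loc v 0" using assms(1) that unfolding linear_functional_def by blast
        with x r(1) show ?thesis by (auto intro!: loc_mult)
      qed
      show "x * r * \<phi> (\<theta> + \<eta>) = x * r * \<phi> \<theta> + x * r * \<phi> \<eta>"
        if "\<theta> \<in> {\<theta> \<in> vloc v a. dot3 \<theta> G = 0}" "\<eta> \<in> {\<theta> \<in> vloc v a. dot3 \<theta> G = 0}" for \<theta> \<eta>
      proof -
        have "\<phi> (\<theta> + \<eta>) = \<phi> \<theta> + \<phi> \<eta>"
          using assms(1) that unfolding linear_functional_def by blast
        then show ?thesis by (simp add: distrib_left)
      qed
      show "x * r * \<phi> (smult3 c \<theta>) = c * (x * r * \<phi> \<theta>)"
        if "c \<in> loc v 0" "\<theta> \<in> {\<theta> \<in> vloc v a. dot3 \<theta> G = 0}" for c \<theta>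
        using linear_functional_smult[OF assms(1) that] by simp
    qed
    moreover have "x = x * r * \<phi> s" using r(2) by (simp add: mult.assoc)
    ultimately show "x \<in> functional_values v G a s"
      by (rule functional_valuesI)
  qed
qed

text \<open>Some coordinate of \<open>s\<close> is nonzero at \<open>v\<close>, and a coordinate,
  shifted to degree zero by a generator \<open>t\<close>, is a functional.\<close>

lemma functional_values_nonvanishing:
  assumes v: "v \<noteq> 0" and s: "s \<in> vloc v a" "dot3 s G = 0"
    and nz: "(val3 v (fst s), val3 v (fst (snd s)), val3 v (snd (snd s))) \<noteq> 0"
  shows "functional_values v G a s = loc v 0"
proof -
  obtain s1 s2 s3 where s': "s = (s1, s2, s3)" by (cases s)
  have "\<exists>e. e \<in> vloc v 0 \<and> val3 v (dot3 e s) \<noteq> 0"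
  proof -
    from nz consider "val3 v s1 \<noteq> 0" | "val3 v s2 \<noteq> 0" | "val3 v s3 \<noteq> 0"
      by (auto simp: s' zero_prod_def)
    then show ?thesis
    proof cases
      case 1 then show ?thesis using v by (intro exI[of _ "(1, 0, 0)"]) (auto simp: s' dot3_def vloc_def)
    next
      case 2 then show ?thesis using v by (intro exI[of _ "(0, 1, 0)"]) (auto simp: s' dot3_def vloc_def)
    next
      case 3 then show ?thesis using v by (intro exI[of _ "(0, 0, 1)"]) (auto simp: s' dot3_def vloc_def)
    qed
  qed
  then obtain e where e: "e \<in> vloc v 0" "val3 v (dot3 e s) \<noteq> 0" by blast
  obtain t where t: "t \<in> loc v (- a)" "val3 v t \<noteq> 0" using unit_loc[OF v] .
  have es: "dot3 e s \<in> loc v a" by (rule loc_dot3[OF e(1) s(1)]) simp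
  have tes: "t * dot3 e s \<in> loc v 0" "val3 v (t * dot3 e s) \<noteq> 0"
    using loc_mult[OF t(1) es] val3_mult[OF t(1) es] t e by simp_all
  have "linear_functional (loc v 0) {\<theta> \<in> vloc v a. dot3 \<theta> G = 0} (\<lambda>\<theta>. t * dot3 e \<theta>)"
  proof (rule linear_functionalI)
    show "t * dot3 e \<theta> \<in> loc v 0" if "\<theta> \<in> {\<theta> \<in> vloc v a. dot3 \<theta> G = 0}" for \<theta>
      using that by (intro loc_mult[OF t(1) loc_dot3[OF e(1)]]) auto
  qed (simp_all add: dot3_add dot3_smult distrib_left)
  then show ?thesis
  proof (rule functional_values_unit[OF _ s])
    show "inverse (t * dot3 e s) \<in> loc v 0" using loc_inverse(1)[OF tes] by simp
    have "t * dot3 e s \<noteq> 0" using tes(2) by auto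
    then show "inverse (t * dot3 e s) * (t * dot3 e s) = 1" by (rule left_inverse)
  qed
qed

lemma cross3_commute: "cross3 a b = - cross3 b a"
  by (cases a; cases b) (simp add: cross3_def algebra_simps)
lemma smult3_smult3: "smult3 a (smult3 b x) = smult3 (a * b) x"
  by (cases x) (simp add: smult3_def ac_simps)
lemma smult3_add: "smult3 (a + b) x = smult3 a x + smult3 b x" "smult3 a (x + y) = smult3 a x + smult3 a y"
  by (cases x; cases y; simp add: smult3_def algebra_simps)+
lemma smult3_diff: "smult3 a (x - y) = smult3 a x - smult3 a y"
  by (cases x; cases y) (simp add: smult3_def algebra_simps)

text \<open>Away from the curve the kernel of \<open>\<nabla>F\<close> is a direct summand, complementary to the Euler field.\<close>

lemma functional_values_off_curve:
  fixes F :: "'a::field_char_0 poly3"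
  assumes v: "v \<noteq> 0" and F: "homogeneous N F" "N \<ge> 1" "eval3 F v \<noteq> 0"
    and s: "s \<in> vloc v a" "dot3 s (vgrad F) = 0"
  shows "functional_values v (vgrad F) a s = (\<lambda>c. dot3 c s) ` vloc v (- a)"
proof
  let ?E = "{\<theta> \<in> vloc v a. dot3 \<theta> (vgrad F) = 0}"
  show "(\<lambda>c. dot3 c s) ` vloc v (- a) \<subseteq> functional_values v (vgrad F) a s"
  proof
    fix x assume "x \<in> (\<lambda>c. dot3 c s) ` vloc v (- a)"
    then obtain c where c: "c \<in> vloc v (- a)" "x = dot3 c s" by blast
    have "linear_functional (loc v 0) ?E (dot3 c)"
      by (rule linear_functionalI) (auto simp: dot3_add dot3_smult intro!: loc_dot3[OF c(1)])
    with c show "x \<in> functional_values v (vgrad F) a s" unfolding functional_values_def by blast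
  qed
  show "functional_values v (vgrad F) a s \<subseteq> (\<lambda>c. dot3 c s) ` vloc v (- a)"
  proof
    fix x assume "x \<in> functional_values v (vgrad F) a s"
    then obtain \<phi> where \<phi>: "linear_functional (loc v 0) ?E \<phi>" "x = \<phi> s" unfolding functional_values_def by blast
    obtain t where t: "t \<in> loc v a" "val3 v t \<noteq> 0" using unit_loc[OF v] .
    then have t0: "t \<noteq> 0" by auto
    have ti: "inverse t \<in> loc v (- a)" using loc_inverse(1)[OF t] by simp
    let ?NF = "of_nat N * to_ratfun F"
    \<comment> \<open>Projection along the Euler field onto the kernel of the gradient; the divisor
      \<open>?NF\<close> is the Euler derivative of \<open>F\<close>, a unit at
      \<open>v\<close>.\<close>
    define \<pi> where "\<pi> \<theta> = \<theta> - smult3 (dot3 \<theta> (vgrad F) / ?NF) euler3" for \<theta>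
    have lF: "to_ratfun F \<in> loc v (int N)" using loc_form[OF F(1)] .
    have NF: "?NF \<in> loc v (int N)" "val3 v ?NF \<noteq> 0"
      using loc_mult[OF loc_of_nat lF] val3_mult[OF loc_of_nat[of N] lF] F(2,3) by simp_all
    then have NF0: "?NF \<noteq> 0" by (metis val3_0)
    have \<pi>: "\<pi> \<theta> \<in> ?E" if "\<theta> \<in> vloc v a" for \<theta>
    proof -
      have "dot3 \<theta> (vgrad F) / ?NF \<in> loc v (a - 1)"
        by (rule loc_divide[OF loc_dot3[OF that vloc_vgrad[OF F(1,2)]] NF]) auto
      then have "\<pi> \<theta> \<in> vloc v a"
        unfolding \<pi>_def using vloc_euler3[of v] by (intro vloc_diff that vloc_smult[of _ v "a - 1" _ 1]) auto
      moreover have "dot3 (\<pi> \<theta>) (vgrad F) = 0"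
        unfolding \<pi>_def dot3_diff dot3_smult dot3_euler3[OF F(1)] using NF0 by simp
      ultimately show ?thesis by simp
    qed
    obtain s1 s2 s3 where s': "s = (s1, s2, s3)" by (cases s)
    have si: "s1 \<in> loc v a" "s2 \<in> loc v a" "s3 \<in> loc v a" using s(1) by (auto simp: s' vloc_def)
    have e: "\<pi> (t, 0, 0) \<in> ?E" "\<pi> (0, t, 0) \<in> ?E" "\<pi> (0, 0, t) \<in> ?E"
      by (rule \<pi>, use t(1) v in \<open>simp add: vloc_def\<close>)+
    have r: "s1 / t \<in> loc v 0" "s2 / t \<in> loc v 0" "s3 / t \<in> loc v 0"
      by (rule loc_divide[OF _ t]; use si in simp)+
    have lin: "\<pi> (\<theta> + \<eta>) = \<pi> \<theta> + \<pi> \<eta>" "\<pi> (smult3 c \<theta>) = smult3 c (\<pi> \<theta>)" for \<theta> \<eta> c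
      by (simp_all add: \<pi>_def dot3_add dot3_smult add_divide_distrib smult3_add smult3_diff smult3_smult3)
    have "s = smult3 (s1 / t) (t, 0, 0) + (smult3 (s2 / t) (0, t, 0) + smult3 (s3 / t) (0, 0, t))"
      using t0 by (simp add: s' smult3_def)
    then have "\<pi> s = \<pi> (smult3 (s1 / t) (t, 0, 0) + (smult3 (s2 / t) (0, t, 0) + smult3 (s3 / t) (0, 0, t)))"
      by (rule arg_cong)
    moreover have "\<pi> s = s" using s(2) by (simp add: \<pi>_def)
    ultimately have s_eq: "s = smult3 (s1 / t) (\<pi> (t, 0, 0)) +
        (smult3 (s2 / t) (\<pi> (0, t, 0)) + smult3 (s3 / t) (\<pi> (0, 0, t)))"
      by (simp only: lin)
    have smult_E: "smult3 c \<theta> \<in> ?E" if "c \<in> loc v 0" "\<theta> \<in> ?E" for c \<theta>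
      using that vloc_smult[of c v 0 \<theta> a a] by (simp add: dot3_smult)
    have add_E: "\<theta> + \<eta> \<in> ?E" if "\<theta> \<in> ?E" "\<eta> \<in> ?E" for \<theta> \<eta>
      using that vloc_add[of \<theta> v a \<eta>] by (simp add: dot3_add)
    have add: "\<phi> (\<theta> + \<eta>) = \<phi> \<theta> + \<phi> \<eta>" if "\<theta> \<in> ?E" "\<eta> \<in> ?E" for \<theta> \<eta>
      using \<phi>(1) that unfolding linear_functional_def by blast
    have m: "smult3 (s1 / t) (\<pi> (t, 0, 0)) \<in> ?E" "smult3 (s2 / t) (\<pi> (0, t, 0)) \<in> ?E"
      "smult3 (s3 / t) (\<pi> (0, 0, t)) \<in> ?E"
      by (rule smult_E[OF r(1) e(1)], rule smult_E[OF r(2) e(2)], rule smult_E[OF r(3) e(3)])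
    have "\<phi> s = \<phi> (smult3 (s1 / t) (\<pi> (t, 0, 0)) +
        (smult3 (s2 / t) (\<pi> (0, t, 0)) + smult3 (s3 / t) (\<pi> (0, 0, t))))"
      using s_eq by (rule arg_cong)
    then have phi_s: "\<phi> s = s1 / t * \<phi> (\<pi> (t, 0, 0)) + (s2 / t * \<phi> (\<pi> (0, t, 0)) + s3 / t * \<phi> (\<pi> (0, 0, t)))"
      unfolding add[OF m(1) add_E[OF m(2,3)]] add[OF m(2,3)] linear_functional_smult[OF \<phi>(1) r(1) e(1)]
        linear_functional_smult[OF \<phi>(1) r(2) e(2)] linear_functional_smult[OF \<phi>(1) r(3) e(3)] .
    \<comment> \<open>\<open>\<phi>\<close> after \<open>\<pi>\<close> is a functional on all
      triples of degree \<open>a\<close>; \<open>c\<close> is its coefficient vector, read off on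
      the standard basis scaled by \<open>t\<close>.\<close>
    define c where "c = smult3 (inverse t) (\<phi> (\<pi> (t, 0, 0)), \<phi> (\<pi> (0, t, 0)), \<phi> (\<pi> (0, 0, t)))"
    have "\<phi> s = dot3 c s"
      unfolding phi_s by (simp add: c_def s' dot3_def smult3_def divide_inverse)
    moreover have "c \<in> vloc v (- a)"
      unfolding c_def
    proof (rule vloc_smult[OF ti, of _ 0])
      show "(\<phi> (\<pi> (t, 0, 0)), \<phi> (\<pi> (0, t, 0)), \<phi> (\<pi> (0, 0, t))) \<in> vloc v 0"
      proof -
        have "\<phi> \<theta> \<in> loc v 0" if "\<theta> \<in> ?E" for \<theta>
          using \<phi>(1) that unfolding linear_functional_def by blast
        from this[OF e(1)] this[OF e(2)] this[OF e(3)] show ?thesis by (simp add: vloc_def)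
      qed
    qed simp
    ultimately show "x \<in> (\<lambda>c. dot3 c s) ` vloc v (- a)" using \<phi>(2) by blast
  qed
qed

text \<open>Collects what \<open>scaling_field\<close> yields, with a member \<open>g\<close> not
  through \<open>v\<close>. Both cases rest on it: \<open>jacobian_eq\<close> serves when the curve
  omits \<open>l\<close>, \<open>functional_values_on_curve\<close> when it contains
  \<open>l\<close>.\<close>

locale scaled_singularity =
  fixes v :: "'a::{field_char_0,factorial_ring_gcd,semiring_gcd_mult_normalize} \<times> 'a \<times> 'a"
    and l g :: "'a poly3" and n :: nat and \<chi> :: "'a ratfun3 \<times> 'a ratfun3 \<times> 'a ratfun3"
  assumes v: "v \<noteq> 0" and l: "squarefree l" "homogeneous n l" "n \<ge> 1"
    and g: "homogeneous n g" "eval3 g v \<noteq> 0"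
    and \<chi>: "\<chi> \<in> vloc v 1" "dot3 \<chi> (vgrad l) = to_ratfun l" "dot3 \<chi> (vgrad g) = 0"
begin

definition s where "s = cross3 (vgrad l) (vgrad g)"

definition ng where "ng = of_nat n * to_ratfun g"

lemma s_loc: "s \<in> vloc v (2 * int n - 2)"
  unfolding s_def by (rule vloc_cross3[OF vloc_vgrad[OF l(2,3)] vloc_vgrad[OF g(1) l(3)]]) auto

lemma ng: "ng \<in> loc v (int n)" "val3 v ng \<noteq> 0" "ng \<noteq> 0"
proof -
  show 1: "ng \<in> loc v (int n)" unfolding ng_def by (rule loc_mult[OF loc_of_nat loc_form[OF g(1)]]) simp
  show 2: "val3 v ng \<noteq> 0"
    unfolding ng_def using val3_mult[OF loc_of_nat[of n] loc_form[OF g(1)]] g l(3) by simp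
  show "ng \<noteq> 0" using 2 by auto
qed

text \<open>\<open>\<chi>\<close> kills \<open>g\<close> and the Euler field multiplies it by
  \<open>n\<close>, so the double cross product of \<open>vgrad g\<close> with these two fields is
  \<open>ng\<close> times \<open>\<chi>\<close>. As \<open>ng\<close> is a unit, \<open>l\<close>
  lies in the ideal of the components of \<open>s\<close>.\<close>

lemma l_eq: "ng * to_ratfun l = dot3 (cross3 \<chi> euler3) s"
proof -
  have "dot3 (vgrad l) (cross3 (vgrad g) (cross3 \<chi> euler3)) = ng * to_ratfun l"
    unfolding cross3_cross3 using \<chi>(2,3)
    by (simp add: dot3_diff dot3_smult dot3_commute[of "vgrad g"] dot3_commute[of "vgrad l"] dot3_euler3[OF g(1)] ng_def)
  then show ?thesis unfolding s_def by (metis dot3_cross3_cyclic)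
qed

text \<open>Expansion of the double cross product of the Euler field with \<open>s\<close>. With
  \<open>l_eq\<close> it puts the partial derivatives of \<open>l\<close> into the ideal of the
  components of \<open>s\<close>.\<close>

lemma grad_eq: "smult3 ng (vgrad l) = cross3 euler3 s + smult3 (of_nat n * to_ratfun l) (vgrad g)"
  unfolding s_def cross3_cross3 dot3_euler3[OF g(1)] dot3_euler3[OF l(2)] ng_def by simp

lemma s_nonzero: "s \<noteq> 0"
proof
  assume "s = 0"
  then have "ng * to_ratfun l = 0" using l_eq by simp
  then show False using ng l(1) by auto
qed

text \<open>One inclusion is the cyclic symmetry of the triple product; the other substitutes
  \<open>l_eq\<close> into \<open>grad_eq\<close>.\<close>

lemma jacobian_eq: "(\<lambda>c. dot3 c (vgrad l)) ` vloc v (1 - int n) = (\<lambda>c. dot3 c s) ` vloc v (2 - 2 * int n)"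
proof
  show "(\<lambda>c. dot3 c s) ` vloc v (2 - 2 * int n) \<subseteq> (\<lambda>c. dot3 c (vgrad l)) ` vloc v (1 - int n)"
  proof
    fix x assume "x \<in> (\<lambda>c. dot3 c s) ` vloc v (2 - 2 * int n)"
    then obtain c where c: "c \<in> vloc v (2 - 2 * int n)" "x = dot3 c s" by blast
    have "x = dot3 (cross3 (vgrad g) c) (vgrad l)"
      unfolding c s_def by (metis dot3_commute dot3_cross3_cyclic)
    moreover have "cross3 (vgrad g) c \<in> vloc v (1 - int n)"
      by (rule vloc_cross3[OF vloc_vgrad[OF g(1) l(3)] c(1)]) auto
    ultimately show "x \<in> (\<lambda>c. dot3 c (vgrad l)) ` vloc v (1 - int n)" by blast
  qed
  show "(\<lambda>c. dot3 c (vgrad l)) ` vloc v (1 - int n) \<subseteq> (\<lambda>c. dot3 c s) ` vloc v (2 - 2 * int n)"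
  proof
    fix x assume "x \<in> (\<lambda>c. dot3 c (vgrad l)) ` vloc v (1 - int n)"
    then obtain c where c: "c \<in> vloc v (1 - int n)" "x = dot3 c (vgrad l)" by blast
    \<comment> \<open>The first summand comes from the cross product in \<open>grad_eq\<close>, the
      second from its last term after replacing \<open>l\<close> by means of
      \<open>l_eq\<close>.\<close>
    define d where "d = smult3 (inverse ng) (cross3 c euler3) +
      smult3 (inverse ng * inverse ng * of_nat n * dot3 c (vgrad g)) (cross3 \<chi> euler3)"
    have "ng * (ng * x) = ng * dot3 c (smult3 ng (vgrad l))" by (simp add: c dot3_smult)
    also have "\<dots> = ng * dot3 (cross3 c euler3) s + of_nat n * (ng * to_ratfun l) * dot3 c (vgrad g)"
      unfolding grad_eq dot3_add dot3_smult
      by (simp add: dot3_cross3_cyclic[of c] dot3_cross3_cyclic[of euler3] dot3_commute[of s] algebra_simps)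
    also have "\<dots> = ng * (ng * dot3 d s)"
      unfolding l_eq d_def dot3_add dot3_smult using ng(3) by (simp add: field_simps)
    finally have "x = dot3 d s" using ng(3) by simp
    moreover have "d \<in> vloc v (2 - 2 * int n)"
    proof -
      have i: "inverse ng \<in> loc v (- int n)" using loc_inverse(1)[OF ng(1,2)] by simp
      have "inverse ng * inverse ng * of_nat n * dot3 c (vgrad g) \<in> loc v (- 2 * int n)"
        by (rule loc_mult[OF loc_mult[OF loc_mult[OF i i refl] loc_of_nat refl]
            loc_dot3[OF c(1) vloc_vgrad[OF g(1) l(3) refl] refl]]) simp
      moreover have "cross3 \<chi> euler3 \<in> vloc v 2" by (rule vloc_cross3[OF \<chi>(1) vloc_euler3]) simp
      moreover have "cross3 c euler3 \<in> vloc v (2 - int n)" by (rule vloc_cross3[OF c(1) vloc_euler3]) simp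
      ultimately show ?thesis unfolding d_def
        by (intro vloc_add) (auto intro: vloc_smult[OF i] vloc_smult)
    qed
    ultimately show "x \<in> (\<lambda>c. dot3 c s) ` vloc v (2 - 2 * int n)" by blast
  qed
qed

text \<open>By \<open>l_eq\<close> and \<open>grad_eq\<close>, regularity of \<open>x\<close> times
  \<open>s\<close> passes to \<open>x\<close> times \<open>l\<close> and to \<open>x\<close> times
  the gradient of \<open>l\<close>. Since \<open>l\<close> is coprime to a combination of its
  derivatives, \<open>x\<close> has no pole at \<open>v\<close>.\<close>

lemma regular:
  assumes x: "x = Fract A B" "homogeneous i A" "homogeneous i B" "B \<noteq> 0"
    and s: "smult3 x s \<in> vloc v (2 * int n - 2)"
  shows "x \<in> loc v 0"
proof -
  obtain t where cop: "coprime l (ddx l + const3 t * ddy l + const3 (t^2) * ddz l)" (is "coprime l ?B")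
    using coprime_derivative[OF l(1,2)] .
  have i: "inverse ng \<in> loc v (- int n)" using loc_inverse(1)[OF ng(1,2)] by simp
  have "x * to_ratfun l = inverse ng * dot3 (cross3 \<chi> euler3) (smult3 x s)"
    using l_eq ng(3) by (simp add: dot3_smult field_simps)
  also have "\<dots> \<in> loc v (int n)"
    by (rule loc_mult[OF i loc_dot3[OF vloc_cross3[OF \<chi>(1) vloc_euler3 refl] s refl]]) simp
  finally have 1: "x * to_ratfun l \<in> loc v (int n)" .
  have "smult3 ng (smult3 x (vgrad l)) = cross3 euler3 (smult3 x s) + smult3 (of_nat n * (x * to_ratfun l)) (vgrad g)"
    using arg_cong[OF grad_eq, of "smult3 x"] by (cases s) (auto simp: vgrad_def euler3_def vec3_defs algebra_simps)
  then have "smult3 x (vgrad l) = smult3 (inverse ng)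
      (cross3 euler3 (smult3 x s) + smult3 (of_nat n * (x * to_ratfun l)) (vgrad g))"
    using ng(3) by (metis (no_types, lifting) mult.assoc left_inverse smult3_1 smult3_smult3)
  also have "\<dots> \<in> vloc v (int n - 1)"
    by (rule vloc_smult[OF i vloc_add[OF vloc_cross3[OF vloc_euler3 s refl]
        vloc_smult[OF loc_mult[OF loc_of_nat 1 refl] vloc_vgrad[OF g(1) l(3) refl]]]]) simp_all
  finally have "x * to_ratfun (ddx l) \<in> loc v (int n - 1)" "x * to_ratfun (ddy l) \<in> loc v (int n - 1)"
    "x * to_ratfun (ddz l) \<in> loc v (int n - 1)" by (simp_all add: vgrad_def smult3_def vloc_def)
  then have "x * to_ratfun (ddx l) + to_ratfun (const3 t) * (x * to_ratfun (ddy l))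
     + to_ratfun (const3 (t^2)) * (x * to_ratfun (ddz l)) \<in> loc v (int n - 1)"
    by (auto intro!: loc_add loc_mult[OF loc_form[OF homogeneous_const3]])
  then have 2: "x * to_ratfun ?B \<in> loc v (int n - 1)" by (simp add: algebra_simps)
  from loc_of_coprime[OF v x cop 1 2] show ?thesis by simp
qed

text \<open>If the curve contains the singular member \<open>l\<close>, then \<open>s\<close> is a member of a local frame:
  subtracting multiples of the Euler field and of \<open>\<chi>\<close> makes a field kill both \<open>l\<close> and \<open>g\<close>.\<close>

lemma functional_values_on_curve:
  assumes u: "binary_form l g n k u u1 u2" "eval3 u v \<noteq> 0" and lv: "eval3 l v = 0"
  obtains \<phi> where
    "linear_functional (loc v 0) {\<theta> \<in> vloc v (2 * int n - 2). dot3 \<theta> (vgrad (l * u)) = 0} \<phi>" "\<phi> s = 1"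
proof -
  let ?E = "{\<theta> \<in> vloc v (2 * int n - 2). dot3 \<theta> (vgrad (l * u)) = 0}"
  let ?l = "to_ratfun l" and ?g = "to_ratfun g"
  have l0: "?l \<noteq> 0" using l(1) by auto
  have g0: "?g \<noteq> 0" using g(2) by auto
  define U where "U = u + l * u1"
  have hU: "homogeneous (k * n) U"
    using u unfolding U_def binary_form_def by (auto intro: homogeneous_add)
  have Uv: "val3 v (to_ratfun U) \<noteq> 0" unfolding val3_to_ratfun using u(2) lv by (simp add: U_def)
  then have U0: "to_ratfun U \<noteq> 0" by auto
  \<comment> \<open>For \<open>k = 0\<close> the degree here is negative, and \<open>u2\<close> is
    zero.\<close>
  have u2: "to_ratfun u2 \<in> loc v (int (k * n) - int n)"
  proof (cases "k = 0")
    case True then show ?thesis using u v by (simp add: binary_form_def)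
  next
    case False
    then have "n \<le> k * n" by simp
    then show ?thesis using u loc_form[of "k * n - n" u2 v] by (simp add: binary_form_def of_nat_diff)
  qed
  \<comment> \<open>The logarithmic derivative of \<open>l / g\<close> along the field; it equals
    \<open>1\<close> for \<open>\<chi>\<close>.\<close>
  define c where "c \<theta> = dot3 \<theta> (vgrad l) / ?l - dot3 \<theta> (vgrad g) / ?g" for \<theta>
  \<comment> \<open>The Euler multiple makes the derivative of \<open>g\<close> vanish without
    changing that of \<open>l / g\<close>; the multiple of \<open>\<chi>\<close> then makes the
    derivative of \<open>l\<close> vanish too.\<close>
  define R where "R \<theta> = \<theta> - smult3 (dot3 \<theta> (vgrad g) / ng) euler3 - smult3 (c \<theta>) \<chi>" for \<theta>
  obtain s1 s2 s3 where s': "s = (s1, s2, s3)" by (cases s)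
  obtain e where e: "dot3 e s \<noteq> 0" "e \<in> vloc v 0"
  proof -
    from s_nonzero consider "dot3 (1, 0, 0) s \<noteq> 0" | "dot3 (0, 1, 0) s \<noteq> 0" | "dot3 (0, 0, 1) s \<noteq> 0"
      by (auto simp: s' vec3_defs)
    then show ?thesis by cases (rule that, assumption, use v in \<open>simp add: vloc_def\<close>)+
  qed
  define \<phi> where "\<phi> \<theta> = dot3 e (R \<theta>) / dot3 e s" for \<theta>
  have kill: "dot3 (R \<theta>) (vgrad g) = 0" "dot3 (R \<theta>) (vgrad l) = 0" for \<theta>
    unfolding R_def dot3_diff dot3_smult dot3_euler3[OF g(1)] dot3_euler3[OF l(2)] \<chi>(2,3) c_def ng_def
    using l0 g0 l(3) by (simp_all add: field_simps)
  \<comment> \<open>Over the function field a vector orthogonal to both gradients is a multiple of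
    their cross product; \<open>e\<close> reads off the factor.\<close>
  have par: "R \<theta> = smult3 (\<phi> \<theta>) s" for \<theta>
  proof -
    have "cross3 s (R \<theta>) = 0"
      unfolding s_def by (subst cross3_commute) (simp add: cross3_cross3 kill)
    then obtain t where "R \<theta> = smult3 t s" using cross3_parallel s_nonzero by metis
    then show ?thesis using e(1) by (simp add: \<phi>_def dot3_smult)
  qed
  \<comment> \<open>The definition of \<open>c\<close> divides by \<open>l\<close>, which vanishes
    at \<open>v\<close>. Tangency to \<open>l * u\<close> replaces this by the denominator
    \<open>U\<close>, a unit at \<open>v\<close>.\<close>
  have c_eq: "c \<theta> = - (to_ratfun u2 * dot3 \<theta> (vgrad g)) / to_ratfun U - dot3 \<theta> (vgrad g) / ?g"
    if "\<theta> \<in> ?E" for \<theta>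
  proof -
    have "to_ratfun U * dot3 \<theta> (vgrad l) = - (?l * to_ratfun u2 * dot3 \<theta> (vgrad g))"
      using that unfolding vgrad_binary_form[OF u(1)] U_def[symmetric]
      by (simp add: dot3_add dot3_smult eq_neg_iff_add_eq_0)
    then have "dot3 \<theta> (vgrad l) / ?l = - (to_ratfun u2 * dot3 \<theta> (vgrad g)) / to_ratfun U"
      using U0 l0 by (simp add: field_simps)
    then show ?thesis by (simp add: c_def)
  qed
  have R_loc: "R \<theta> \<in> vloc v (2 * int n - 2)" if \<theta>: "\<theta> \<in> ?E" for \<theta>
  proof -
    have tg: "dot3 \<theta> (vgrad g) \<in> loc v (3 * int n - 3)"
      using \<theta> by (intro loc_dot3[OF _ vloc_vgrad[OF g(1) l(3) refl], of _ _ "2 * int n - 2"]) auto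
    have 1: "dot3 \<theta> (vgrad g) / ng \<in> loc v (2 * int n - 3)"
      by (rule loc_divide[OF tg ng(1,2)]) simp
    have 2: "dot3 \<theta> (vgrad g) / ?g \<in> loc v (2 * int n - 3)"
      using g(2) by (intro loc_divide[OF tg loc_form[OF g(1)]]) auto
    have 3: "- (to_ratfun u2 * dot3 \<theta> (vgrad g)) / to_ratfun U \<in> loc v (2 * int n - 3)"
      by (rule loc_divide[OF loc_minus[OF loc_mult[OF u2 tg refl]] loc_form[OF hU] Uv]) simp
    have "c \<theta> \<in> loc v (2 * int n - 3)" unfolding c_eq[OF \<theta>] by (rule loc_diff[OF 3 2])
    with 1 \<theta> show ?thesis
      unfolding R_def by (intro vloc_diff) (auto intro: vloc_smult[OF _ vloc_euler3] vloc_smult[OF _ \<chi>(1)])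
  qed
  have \<phi>_loc: "\<phi> \<theta> \<in> loc v 0" if \<theta>: "\<theta> \<in> ?E" for \<theta>
  proof -
    obtain A B i j where A: "dot3 e (R \<theta>) = Fract A B" "homogeneous i A" "homogeneous j B" "B \<noteq> 0"
      "int i - int j = 2 * int n - 2"
      using loc_dot3[OF e(2) R_loc[OF \<theta>] refl] by (auto elim!: locE)
    obtain A' B' i' j' where A': "dot3 e s = Fract A' B'" "homogeneous i' A'" "homogeneous j' B'" "B' \<noteq> 0"
      "int i' - int j' = 2 * int n - 2"
      using loc_dot3[OF e(2) s_loc refl] by (auto elim!: locE)
    have "A' \<noteq> 0" using e(1) A'(1) by (auto simp: fract_collapse)
    have eq: "i + j' = j + i'" using A A' by linarith
    have "\<phi> \<theta> = Fract (A * B') (B * A')" "homogeneous (i + j') (A * B')" "homogeneous (i + j') (B * A')"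
      using A A' homogeneous_mult[of i A j' B'] homogeneous_mult[of j B i' A', folded eq]
      by (simp_all add: \<phi>_def)
    then show ?thesis
      by (rule regular) (use A A' \<open>A' \<noteq> 0\<close> R_loc[OF \<theta>] par in auto)
  qed
  show ?thesis
  proof (rule that)
    have c: "c (\<theta> + \<eta>) = c \<theta> + c \<eta>" "c (smult3 t \<theta>) = t * c \<theta>" for \<theta> \<eta> t
      by (simp_all add: c_def dot3_add dot3_smult add_divide_distrib right_diff_distrib)
    have R_add: "R (\<theta> + \<eta>) = R \<theta> + R \<eta>" and R_smult: "R (smult3 t \<theta>) = smult3 t (R \<theta>)" for \<theta> \<eta> t
      by (simp_all add: R_def c dot3_add dot3_smult add_divide_distrib smult3_add smult3_diff smult3_smult3)
    show "linear_functional (loc v 0) ?E \<phi>"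
      by (rule linear_functionalI[OF \<phi>_loc])
        (simp_all add: \<phi>_def R_add R_smult dot3_add dot3_smult add_divide_distrib)
    have "R s = s" by (simp add: R_def c_def s_def)
    then show "\<phi> s = 1" using e(1) by (simp add: \<phi>_def)
  qed
qed

end

subsection \<open>Members of the pencil\<close>

lemma proj_rel_scale:
  fixes v :: "'a::field \<times> 'a \<times> 'a"
  assumes "t \<noteq> 0"
  shows "proj_rel `` {smult3 t v} = proj_rel `` {v}"
proof -
  obtain x y z where v: "v = (x, y, z)" by (cases v)
  have img: "proj_rel `` {(x, y, z)} = (if (x, y, z) = (0, 0, 0) then {} else {(c * x, c * y, c * z) | c. c \<noteq> 0})"
    for x y z :: 'a by (auto simp: proj_rel_def)
  have "{(c * (t * x), c * (t * y), c * (t * z)) | c. c \<noteq> 0} = {(c * x, c * y, c * z) | c. c \<noteq> 0}"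
  proof (intro Set.equalityI subsetI)
    fix w assume "w \<in> {(c * (t * x), c * (t * y), c * (t * z)) | c. c \<noteq> 0}"
    then obtain c where "c \<noteq> 0" "w = (c * (t * x), c * (t * y), c * (t * z))" by blast
    then show "w \<in> {(c * x, c * y, c * z) | c. c \<noteq> 0}"
      using assms by (intro CollectI exI[of _ "c * t"]) (simp add: mult.assoc)
  next
    fix w assume "w \<in> {(c * x, c * y, c * z) | c. c \<noteq> 0}"
    then obtain c where "c \<noteq> 0" "w = (c * x, c * y, c * z)" by blast
    then show "w \<in> {(c * (t * x), c * (t * y), c * (t * z)) | c. c \<noteq> 0}"
      using assms by (intro CollectI exI[of _ "c / t"]) simp
  qed
  with assms show ?thesis unfolding v smult3_def prod.case img by simp
qed

text \<open>Carries \<open>transversal_base_points\<close> from vectors to points: distinct points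
  have nonparallel representatives.\<close>

lemma base_point_transversal:
  fixes f g :: "'a::{field_char_0,factorial_ring_gcd,semiring_gcd_mult_normalize} poly3"
  assumes cop: "coprime f g" and f: "homogeneous n f" and g: "homogeneous n g" and n: "n \<ge> 1"
    and base: "card {p \<in> P2. vanishes_at f p \<and> vanishes_at g p} = n\<^sup>2"
    and p: "p \<in> P2" "v \<noteq> 0" "p = proj_rel `` {v}" "eval3 f v = 0" "eval3 g v = 0"
      "\<And>d F. homogeneous d F \<Longrightarrow> vanishes_at F p \<longleftrightarrow> eval3 F v = 0"
  shows "cross3 (grad3 f v) (grad3 g v) \<noteq> 0"
proof -
  let ?B = "{p \<in> P2. vanishes_at f p \<and> vanishes_at g p}"
  have "\<exists>h. \<forall>x\<in>P2. h x \<noteq> 0 \<and> x = proj_rel `` {h x} \<and>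
      (\<forall>d (F::'a poly3). homogeneous d F \<longrightarrow> vanishes_at F x \<longleftrightarrow> eval3 F (h x) = 0)"
  proof (rule bchoice, rule ballI)
    fix x :: "'a point" assume "x \<in> P2"
    then show "\<exists>w. w \<noteq> 0 \<and> x = proj_rel `` {w} \<and>
      (\<forall>d (F::'a poly3). homogeneous d F \<longrightarrow> vanishes_at F x \<longleftrightarrow> eval3 F w = 0)"
    proof (rule P2_representative)
      fix w assume *: "w \<noteq> 0" "x = proj_rel `` {w}"
        "\<And>d F. homogeneous d F \<Longrightarrow> vanishes_at F x \<longleftrightarrow> eval3 F w = 0"
      show ?thesis by (rule exI[of _ w], intro conjI allI impI) (rule *, assumption?)+
    qed
  qed
  then obtain h0 where H: "\<forall>x\<in>P2. h0 x \<noteq> 0 \<and> x = proj_rel `` {h0 x} \<and>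
      (\<forall>d (F::'a poly3). homogeneous d F \<longrightarrow> vanishes_at F x \<longleftrightarrow> eval3 F (h0 x) = 0)" ..
  have h0: "h0 x \<noteq> 0" "x = proj_rel `` {h0 x}"
    "homogeneous d F \<Longrightarrow> vanishes_at F x \<longleftrightarrow> eval3 (F :: 'a poly3) (h0 x) = 0" if "x \<in> P2" for x d F
  proof -
    note * = bspec[OF H that]
    show "h0 x \<noteq> 0" using * by (rule conjunct1)
    show "x = proj_rel `` {h0 x}" using *[THEN conjunct2] by (rule conjunct1)
    show "vanishes_at F x \<longleftrightarrow> eval3 F (h0 x) = 0" if "homogeneous d F"
      using *[THEN conjunct2, THEN conjunct2] that by iprover
  qed
  \<comment> \<open>The representative of \<open>p\<close> is changed to the given \<open>v\<close>,
    so that the conclusion concerns this vector.\<close>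
  define h where "h = h0(p := v)"
  have h: "h x \<noteq> 0" "x = proj_rel `` {h x}" "homogeneous d F \<Longrightarrow> vanishes_at F x \<longleftrightarrow> eval3 F (h x) = 0"
    if "x \<in> P2" for x d F
  proof -
    show "h x \<noteq> 0" using h0(1)[OF that] p(2) by (simp add: h_def)
    show "x = proj_rel `` {h x}"
    proof (cases "x = p")
      case True
      with p(3) show ?thesis by (simp only: h_def fun_upd_same)
    next
      case False
      then have "h x = h0 x" by (simp add: h_def)
      then show ?thesis using h0(2)[OF that] by (simp only:)
    qed
    show "vanishes_at F x \<longleftrightarrow> eval3 F (h x) = 0" if F: "homogeneous d F"
      using h0(3)[OF \<open>x \<in> P2\<close> F] p(6)[OF F] by (cases "x = p") (simp_all only: h_def fun_upd_same fun_upd_other not_False_eq_True)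
  qed
  have pB: "p \<in> ?B" using p(1,4,5) p(6)[OF f] p(6)[OF g] by simp
  have fin: "finite ?B" using base n by (intro card_ge_0_finite) simp
  have h_eq: "x = y" if "x \<in> P2" "y \<in> P2" "proj_rel `` {h x} = proj_rel `` {h y}" for x y
  proof -
    have "x = proj_rel `` {h x}" by (rule h(2)[OF that(1)])
    also note that(3)
    also have "proj_rel `` {h y} = y" by (rule h(2)[OF that(2), symmetric])
    finally show ?thesis .
  qed
  have inj: "inj_on h ?B"
  proof (rule inj_onI)
    fix x y assume "x \<in> ?B" "y \<in> ?B" "h x = h y"
    then show "x = y" using h_eq[of x y] by simp
  qed
  have cross: "cross3 (h x) (h y) \<noteq> 0" if xy: "x \<in> P2" "y \<in> P2" "x \<noteq> y" for x y
  proof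
    assume "cross3 (h x) (h y) = 0"
    then obtain t where t: "h y = smult3 t (h x)" using cross3_parallel h(1)[OF xy(1)] by metis
    have "t \<noteq> 0" using t h(1)[OF xy(2)] by auto
    then have "proj_rel `` {h y} = proj_rel `` {h x}" unfolding t by (rule proj_rel_scale)
    from h_eq[OF xy(2,1) this] have "x = y" by (rule sym)
    with xy(3) show False by simp
  qed
  have "cross3 (grad3 f (h p)) (grad3 g (h p)) \<noteq> 0"
  proof (rule transversal_base_points[OF cop f g, of "h ` ?B"])
    show "finite (h ` ?B)" using fin by simp
    show "card (h ` ?B) = n\<^sup>2" using card_image[OF inj] base by simp
    show "w \<noteq> 0" if "w \<in> h ` ?B" for w using that h(1) by (elim imageE CollectE conjE) simp
    show "cross3 u w \<noteq> 0" if "u \<in> h ` ?B" "w \<in> h ` ?B" "u \<noteq> w" for u w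
    proof -
      from that(1) obtain x where x: "u = h x" "x \<in> ?B" by (rule imageE)
      from that(2) obtain y where y: "w = h y" "y \<in> ?B" by (rule imageE)
      have "x \<noteq> y"
      proof
        assume "x = y"
        with x(1) y(1) that(3) show False by simp
      qed
      with cross[of x y] x y show ?thesis by simp
    qed
    show "eval3 f w = 0" if "w \<in> h ` ?B" for w using that h(3)[OF _ f] by (elim imageE CollectE conjE) simp
    show "eval3 g w = 0" if "w \<in> h ` ?B" for w using that h(3)[OF _ g] by (elim imageE CollectE conjE) simp
    show "h p \<in> h ` ?B" using pB by (rule imageI)
  qed
  then show ?thesis by (simp add: h_def)
qed

section \<open>Parameters and change of basis in the pencil\<close>

lemma same_param_iff:
  fixes a b c d :: "'a::field"
  assumes "(a, b) \<noteq> (0, 0)" "(c, d) \<noteq> (0, 0)"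
  shows "same_param (a, b) (c, d) \<longleftrightarrow> a * d - b * c = 0"
proof
  assume "same_param (a, b) (c, d)"
  then show "a * d - b * c = 0" by (auto simp: same_param_def)
next
  assume *: "a * d - b * c = 0"
  show "same_param (a, b) (c, d)"
  proof (cases "c = 0")
    case True
    with assms * have "b \<noteq> 0" "d \<noteq> 0" "a = 0" by auto
    with True show ?thesis by (auto simp: same_param_def intro!: exI[of _ "b / d"])
  next
    case False
    with assms * have "a \<noteq> 0" by auto
    with False * show ?thesis by (auto simp: same_param_def field_simps intro!: exI[of _ "a / c"])
  qed
qed

lemma same_param_refl: "same_param q q"
  by (cases q) (auto simp: same_param_def intro!: exI[of _ 1])

lemma same_param_sym: "same_param q q' \<Longrightarrow> same_param q' q"
proof (cases q; cases q')
  fix a b c d assume "same_param q q'" "q = (a, b)" "q' = (c, d)"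
  then obtain t where "t \<noteq> 0" "a = t * c" "b = t * d" by (auto simp: same_param_def)
  with \<open>q = (a, b)\<close> \<open>q' = (c, d)\<close> show "same_param q' q"
    by (auto simp: same_param_def intro!: exI[of _ "inverse t"])
qed

lemma same_param_trans: "same_param q q' \<Longrightarrow> same_param q' q'' \<Longrightarrow> same_param q q''"
proof (cases q; cases q'; cases q'')
  fix a b c d x y assume *: "same_param q q'" "same_param q' q''" "q = (a, b)" "q' = (c, d)" "q'' = (x, y)"
  then obtain t s where "t \<noteq> 0" "a = t * c" "b = t * d" "s \<noteq> 0" "c = s * x" "d = s * y"
    by (auto simp: same_param_def)
  with * show "same_param q q''" by (auto simp: same_param_def intro!: exI[of _ "t * s"])
qed

abbreviation det2 :: "'a::field \<times> 'a \<Rightarrow> 'a \<times> 'a \<Rightarrow> 'a" where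
  "det2 q q' \<equiv> fst q * snd q' - snd q * fst q'"

lemma same_param_det2: "q \<noteq> (0, 0) \<Longrightarrow> q' \<noteq> (0, 0) \<Longrightarrow> same_param q q' \<longleftrightarrow> det2 q q' = 0"
  by (cases q; cases q') (simp add: same_param_iff)

text \<open>Cramer's rule for \<open>c\<close> in the basis \<open>q\<close>,
  \<open>q'\<close>.\<close>

lemma pencil_member_change:
  fixes f g :: "'a::field poly3"
  assumes "det2 q q' \<noteq> 0"
  shows "pencil_member f g c = const3 (det2 c q' / det2 q q') * pencil_member f g q +
    const3 (det2 q c / det2 q q') * pencil_member f g q'"
proof -
  obtain a b where q: "q = (a, b)" by (cases q)
  obtain a' b' where q': "q' = (a', b')" by (cases q')
  obtain x y where c: "c = (x, y)" by (cases c)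
  define A where "A = det2 c q' / det2 q q'"
  define B where "B = det2 q c / det2 q q'"
  have "A * a + B * a' = (x * det2 q q') / det2 q q'" "A * b + B * b' = (y * det2 q q') / det2 q q'"
    by (simp_all add: A_def B_def q q' c add_divide_distrib[symmetric] algebra_simps)
  then have x: "A * a + B * a' = x" and y: "A * b + B * b' = y" using assms by simp_all
  show ?thesis
    unfolding A_def[symmetric] B_def[symmetric]
    by (simp add: q q' c pencil_member_def x[symmetric] y[symmetric] const3_add const3_mult algebra_simps)
qed

lemma homogeneous_pencil_member:
  "homogeneous n f \<Longrightarrow> homogeneous n g \<Longrightarrow> homogeneous n (pencil_member f g (q :: 'a::field \<times> 'a))"
  by (cases q) (auto simp: pencil_member_def intro: homogeneous_add homogeneous_const3_mult)

lemma grad3_const3_mult: "grad3 (const3 c * F) v = smult3 c (grad3 F v)"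
  by (simp add: grad3_def smult3_def)

lemma vgrad_const3_mult: "vgrad (const3 c * F) = smult3 (to_ratfun (const3 c)) (vgrad F)"
  by (simp add: vgrad_def smult3_def)

lemma cross3_smult: "cross3 (smult3 a x) y = smult3 a (cross3 x y)" "cross3 x (smult3 a y) = smult3 a (cross3 x y)"
  by (cases x; cases y; simp add: vec3_defs algebra_simps)+
lemma cross3_add: "cross3 (x + w) y = cross3 x y + cross3 w y" "cross3 x (y + w) = cross3 x y + cross3 x w"
  by (cases x; cases y; cases w; simp add: vec3_defs algebra_simps)+
lemma cross3_self [simp]: "cross3 x x = 0"
  by (cases x) (simp add: vec3_defs)

text \<open>The wedge of gradients is bilinear and alternating, so a change of basis of the pencil
  multiplies it by the determinant, a constant.\<close>

lemma cross3_vgrad_members: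
  "cross3 (vgrad (pencil_member f g q)) (vgrad (pencil_member f g q')) =
     smult3 (to_ratfun (const3 (det2 q q'))) (gradient_wedge f g)"
proof -
  obtain a b where q: "q = (a, b)" by (cases q)
  obtain a' b' where q': "q' = (a', b')" by (cases q')
  have neg: "cross3 (vgrad g) (vgrad f) = smult3 (- 1) (cross3 (vgrad f) (vgrad g))"
    by (cases "vgrad f"; cases "vgrad g") (simp add: vec3_defs)
  show ?thesis
    unfolding gradient_wedge_eq q q' pencil_member_def prod.case vgrad_add vgrad_const3_mult cross3_add
      cross3_smult neg smult3_smult3
    by (simp add: smult3_smult3 smult3_add(1)[symmetric] const3_diff const3_mult mult.commute)
qed

section \<open>Unions of members as binary forms in two members\<close>

lemma binary_form_one: "binary_form l g n 0 1 0 0"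
  by (simp add: binary_form_def)

lemma binary_form_mult:
  fixes l g :: "'a::field poly3"
  assumes u: "binary_form l g n k u u1 u2" and l: "homogeneous n l" and g: "homogeneous n g"
    and m: "m = const3 a * l + const3 b * g"
  shows "binary_form l g n (Suc k) (m * u) (const3 a * u + m * u1) (const3 b * u + m * u2)"
proof -
  have hm: "homogeneous n m" unfolding m by (intro homogeneous_add homogeneous_const3_mult l g)
  have hu: "homogeneous (k * n) u" "homogeneous (k * n) (l * u1)" "homogeneous (k * n - n) u2" "k = 0 \<Longrightarrow> u2 = 0"
    using u by (auto simp: binary_form_def)
  have e: "l * u1 + g * u2 = of_nat k * u" using u by (simp add: binary_form_def)
  have 1: "homogeneous (Suc k * n) (m * u)" using homogeneous_mult[OF hm hu(1)] by simp
  have "homogeneous (n + k * n) (const3 a * (l * u) + m * (l * u1))"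
    by (intro homogeneous_add homogeneous_const3_mult homogeneous_mult l hm hu)
  then have 2: "homogeneous (Suc k * n) (l * (const3 a * u + m * u1))" by (simp add: algebra_simps)
  \<comment> \<open>For \<open>k = 0\<close> truncated subtraction makes
    \<open>n + (k * n - n)\<close> differ from \<open>k * n\<close>; in that case
    \<open>u2 = 0\<close>.\<close>
  have "homogeneous (k * n) (m * u2)"
  proof (cases "k = 0")
    case False
    then have "n + (k * n - n) = k * n" by (cases k) auto
    with homogeneous_mult[OF hm hu(3)] show ?thesis by simp
  qed (simp add: hu(4))
  then have 3: "homogeneous (Suc k * n - n) (const3 b * u + m * u2)"
    using hu(1) by (auto intro: homogeneous_add homogeneous_const3_mult)
  have "l * (const3 a * u + m * u1) + g * (const3 b * u + m * u2) = m * u + m * (l * u1 + g * u2)"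
    by (simp add: m algebra_simps)
  also have "\<dots> = of_nat (Suc k) * (m * u)" unfolding e by (simp add: algebra_simps)
  finally have 4: "l * (const3 a * u + m * u1) + g * (const3 b * u + m * u2) = of_nat (Suc k) * (m * u)" .
  have d: "ddx u = u1 * ddx l + u2 * ddx g" "ddy u = u1 * ddy l + u2 * ddy g" "ddz u = u1 * ddz l + u2 * ddz g"
    using u by (auto simp: binary_form_def)
  have dm: "ddx m = const3 a * ddx l + const3 b * ddx g" "ddy m = const3 a * ddy l + const3 b * ddy g"
    "ddz m = const3 a * ddz l + const3 b * ddz g" by (simp_all add: m)
  show ?thesis
    unfolding binary_form_def ddx_mult ddy_mult ddz_mult d dm
    by (intro conjI 1 2 3 4) (simp_all add: algebra_simps)
qed

lemma binary_form_prod: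
  fixes l g :: "'a::field poly3"
  assumes "finite I" and l: "homogeneous n l" and g: "homogeneous n g"
    and "\<And>i. i \<in> I \<Longrightarrow> \<exists>a b. m i = const3 a * l + const3 b * g"
  shows "\<exists>u1 u2. binary_form l g n (card I) (prod m I) u1 u2"
  using assms(1,4)
proof (induction I rule: finite_induct)
  case empty
  show ?case using binary_form_one[of l g n] by auto
next
  case (insert i I)
  then obtain u1 u2 a b where "binary_form l g n (card I) (prod m I) u1 u2" "m i = const3 a * l + const3 b * g"
    by blast
  from binary_form_mult[OF this(1) l g this(2)] insert show ?case by auto
qed

lemma binary_form_union:
  fixes f g :: "'a::field poly3"
  assumes "finite I" "homogeneous n f" "homogeneous n g" "det2 c c' \<noteq> 0"
  shows "\<exists>u1 u2. binary_form (pencil_member f g c) (pencil_member f g c') n (card I)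
     (union_of_members f g I q) u1 u2"
  unfolding union_of_members_def
  by (rule binary_form_prod[OF assms(1)]) (use assms pencil_member_change[OF assms(4)] homogeneous_pencil_member in blast)+

lemma jacobian_unit:
  fixes F :: "'a::field_char_0 poly3"
  assumes v: "v \<noteq> 0" and F: "homogeneous N F" "N \<ge> 1" and nz: "grad3 F v \<noteq> 0"
  shows "(\<lambda>c. dot3 c (vgrad F)) ` vloc v (1 - int N) = loc v 0"
proof
  show "(\<lambda>c. dot3 c (vgrad F)) ` vloc v (1 - int N) \<subseteq> loc v 0"
    by (rule image_subsetI, rule loc_dot3[OF _ vloc_vgrad[OF F refl]], assumption) simp
  show "loc v 0 \<subseteq> (\<lambda>c. dot3 c (vgrad F)) ` vloc v (1 - int N)"
  proof
    fix x assume x: "x \<in> loc v 0"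
    have step: "x / to_ratfun D \<in> loc v (1 - int N)" "to_ratfun D \<noteq> 0"
      if "homogeneous (N - 1) D" "eval3 D v \<noteq> 0" for D
      using loc_divide[OF x loc_form[OF that(1)]] that(2) F(2) by (auto simp: of_nat_diff)
    from nz consider "eval3 (ddx F) v \<noteq> 0" | "eval3 (ddy F) v \<noteq> 0" | "eval3 (ddz F) v \<noteq> 0"
      by (auto simp: grad3_def zero_prod_def)
    then show "x \<in> (\<lambda>c. dot3 c (vgrad F)) ` vloc v (1 - int N)"
    proof cases
      case 1
      from step[OF homogeneous_dd(1)[OF F(1)] this] v show ?thesis
        by (intro image_eqI[of _ _ "(x / to_ratfun (ddx F), 0, 0)"]) (simp_all add: dot3_def vgrad_def vloc_def)
    next
      case 2
      from step[OF homogeneous_dd(2)[OF F(1)] this] v show ?thesis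
        by (intro image_eqI[of _ _ "(0, x / to_ratfun (ddy F), 0)"]) (simp_all add: dot3_def vgrad_def vloc_def)
    next
      case 3
      from step[OF homogeneous_dd(3)[OF F(1)] this] v show ?thesis
        by (intro image_eqI[of _ _ "(0, 0, x / to_ratfun (ddz F))"]) (simp_all add: dot3_def vgrad_def vloc_def)
    qed
  qed
qed

lemma jacobian_singular:
  fixes F :: "'a::field poly3"
  assumes F: "homogeneous N F" and z: "grad3 F v = 0"
  shows "(\<lambda>c. dot3 c (vgrad F)) ` vloc v a \<noteq> loc v 0"
proof
  assume "(\<lambda>c. dot3 c (vgrad F)) ` vloc v a = loc v 0"
  then have "1 \<in> (\<lambda>c. dot3 c (vgrad F)) ` vloc v a" by simp
  then obtain c1 c2 c3 where c: "c1 \<in> loc v a" "c2 \<in> loc v a" "c3 \<in> loc v a"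
    "1 = c1 * to_ratfun (ddx F) + c2 * to_ratfun (ddy F) + c3 * to_ratfun (ddz F)"
    by (auto simp: vloc_def dot3_def vgrad_def)
  note d = homogeneous_dd[OF F, THEN loc_form, of v]
  have z': "eval3 (ddx F) v = 0" "eval3 (ddy F) v = 0" "eval3 (ddz F) v = 0"
    using z by (simp_all add: grad3_def zero_prod_def)
  note m = loc_mult[OF c(1) d(1) refl] loc_mult[OF c(2) d(2) refl] loc_mult[OF c(3) d(3) refl]
  have "val3 v 1 = val3 v (c1 * to_ratfun (ddx F)) + val3 v (c2 * to_ratfun (ddy F)) + val3 v (c3 * to_ratfun (ddz F))"
    unfolding c(4) val3_add[OF loc_add[OF m(1,2)] m(3)] val3_add[OF m(1,2)] ..
  then show False
    unfolding val3_mult[OF c(1) d(1)] val3_mult[OF c(2) d(2)] val3_mult[OF c(3) d(3)] val3_to_ratfun z' by simp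
qed

text \<open>A point on one member and off another is no base point, so no further member passes
  through it.\<close>

lemma eval3_other_member:
  assumes "det2 c c' \<noteq> 0" "eval3 (pencil_member f g c) v = 0" "eval3 (pencil_member f g c') v \<noteq> 0"
    and "det2 c d \<noteq> 0"
  shows "eval3 (pencil_member f g d) v \<noteq> 0"
proof -
  have "eval3 (pencil_member f g d) v = det2 c d / det2 c c' * eval3 (pencil_member f g c') v"
    using arg_cong[OF pencil_member_change[OF assms(1), of f g d], of "\<lambda>F. eval3 F v"] assms(2)
    by (simp del: times_divide_eq_left)
  with assms show ?thesis by (simp del: times_divide_eq_left)
qed

lemma union_remove:
  "finite I \<Longrightarrow> i \<in> I \<Longrightarrow>
     union_of_members f g I q = pencil_member f g (q i) * union_of_members f g (I - {i}) q"
  unfolding union_of_members_def by (rule prod.remove)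

lemma homogeneous_union:
  assumes "finite I" "homogeneous n f" "homogeneous n g"
  shows "homogeneous (card I * n) (union_of_members f g I q)"
  using homogeneous_prod[OF assms(1), of "\<lambda>_. n" "\<lambda>i. pencil_member f g (q i)"]
    homogeneous_pencil_member[OF assms(2,3)] by (simp add: union_of_members_def)

lemma distinct_params_det2:
  assumes "distinct_params I q" "i \<in> I" "j \<in> I" "i \<noteq> j"
  shows "det2 (q i) (q j) \<noteq> 0"
proof -
  have "q i \<noteq> (0, 0)" "q j \<noteq> (0, 0)" "\<not> same_param (q i) (q j)"
    using assms by (auto simp: distinct_params_def)
  then show ?thesis using same_param_det2 by blast
qed

lemma complement_nonvanishing:
  assumes "distinct_params I q" "finite I" "i \<in> I" "det2 (q i) c' \<noteq> 0"
    and "eval3 (pencil_member f g (q i)) v = 0" "eval3 (pencil_member f g c') v \<noteq> 0"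
  shows "eval3 (union_of_members f g (I - {i}) q) v \<noteq> 0"
  unfolding union_of_members_def eval3_prod prod_zero_iff[OF finite_Diff[OF assms(2)]]
proof
  assume "\<exists>j\<in>I - {i}. eval3 (pencil_member f g (q j)) v = 0"
  then obtain j where "j \<in> I" "i \<noteq> j" "eval3 (pencil_member f g (q j)) v = 0" by blast
  with eval3_other_member[OF assms(4-6) distinct_params_det2[OF assms(1,3)]] show False by blast
qed

text \<open>At a singular point of one member the stalk of the Jacobian ideal of the whole union is
  proper, so the hypothesis supplies two generators there. The remaining members form the factor
  \<open>u\<close>, a unit at \<open>v\<close>, as \<open>scaling_field\<close> requires.\<close>

lemma lci_scaling_field:
  fixes f g :: "'a::{field_char_0,factorial_ring_gcd,semiring_gcd_mult_normalize} poly3"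
  assumes f: "homogeneous n f" and g: "homogeneous n g" and n: "n \<ge> 1"
    and red: "squarefree (pencil_member f g (q i))"
    and p: "p \<in> P2" "v \<noteq> 0" "\<And>a. twist a p = loc v a"
    and q: "distinct_params I q" "finite I" "i \<in> I"
    and lci: "locally_complete_intersection (jacobian_sheaf (card I * n) (union_of_members f g I q))"
    and sing: "grad3 (pencil_member f g (q i)) v = 0"
    and c': "det2 (q i) c' \<noteq> 0" "eval3 (pencil_member f g c') v \<noteq> 0"
  obtains \<chi> where "\<chi> \<in> vloc v 1" "dot3 \<chi> (vgrad (pencil_member f g (q i))) = to_ratfun (pencil_member f g (q i))"
    "dot3 \<chi> (vgrad (pencil_member f g c')) = 0"
proof -
  define l where "l = pencil_member f g (q i)"
  define h where "h = pencil_member f g c'"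
  define u where "u = union_of_members f g (I - {i}) q"
  define F where "F = union_of_members f g I q"
  have hl: "homogeneous n l" and hh: "homogeneous n h"
    unfolding l_def h_def by (intro homogeneous_pencil_member f g)+
  have lv: "eval3 l v = 0"
    using euler_grad3[OF hl, of v] sing n by (simp add: l_def)
  have F_eq: "F = l * u" unfolding F_def l_def u_def using q by (intro union_remove)
  have uv: "eval3 u v \<noteq> 0"
    unfolding u_def using complement_nonvanishing[OF q c'(1) _ c'(2)] lv by (simp add: l_def)
  obtain u1 u2 where bf: "binary_form l h n (card (I - {i})) u u1 u2"
    using binary_form_union[OF finite_Diff[OF q(2)] f g c'(1)] unfolding l_def h_def u_def by blast
  let ?G = "vgrad F" and ?a = "1 - int (card I * n)"
  have J: "jacobian_sheaf (card I * n) F p = (\<lambda>c. dot3 c ?G) ` vloc v ?a"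
    by (rule jacobian_sheaf_eq[OF p(3)])
  have "grad3 F v = 0"
    unfolding F_eq grad3_mult using lv sing by (simp add: l_def)
  from jacobian_singular[OF homogeneous_union[OF q(2) f g, of q, folded F_def] this]
  have "jacobian_sheaf (card I * n) F p \<noteq> structure_sheaf p" unfolding J p(3) .
  from mp[OF bspec[OF lci[unfolded locally_complete_intersection_def] p(1)] this[unfolded F_def]]
  obtain x where x: "x \<in> (\<lambda>c. dot3 c ?G) ` vloc v ?a" "\<exists>y\<in>(\<lambda>c. dot3 c ?G) ` vloc v ?a.
      (\<lambda>c. dot3 c ?G) ` vloc v ?a = {a * x + b * y | a b. a \<in> loc v 0 \<and> b \<in> loc v 0}"
    unfolding F_def[symmetric] J p(3) by (rule bexE)
  from x(2) obtain y where xy: "y \<in> (\<lambda>c. dot3 c ?G) ` vloc v ?a"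
    "(\<lambda>c. dot3 c ?G) ` vloc v ?a = {a * x + b * y | a b. a \<in> loc v 0 \<and> b \<in> loc v 0}" by (rule bexE)
  obtain \<theta> where \<theta>: "\<theta> \<in> vloc v 0" "dot3 \<theta> ?G = 0"
    "(val3 v (fst \<theta>), val3 v (fst (snd \<theta>)), val3 v (snd (snd \<theta>))) \<noteq> 0"
    by (rule two_generators_relation[OF p(2) x(1) xy(1) eq_refl[OF xy(2)]])
  show ?thesis
    by (rule scaling_field[OF red[folded l_def] hl n hh p(2) lv sing[folded l_def] c'(2)[folded h_def] uv bf
        \<theta>(1) \<theta>(2)[unfolded F_eq] \<theta>(3)]) (rule that, simp_all add: l_def h_def)
qed

subsection \<open>Comparison of the stalks\<close>

text \<open>Three cases: the section does not vanish at the point; it vanishes and the singular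
  member through the point lies in the curve; or that member is exceptional. The first two give the
  first alternative, the third the second.\<close>

lemma zero_scheme_stalk:
  fixes f g :: "'a::{field_char_0,factorial_ring_gcd,semiring_gcd_mult_normalize} poly3"
  assumes n: "n \<ge> 1" and f: "homogeneous n f" and g: "homogeneous n g" and cop: "coprime f g"
    and red: "\<And>c. c \<noteq> (0, 0) \<Longrightarrow> squarefree (pencil_member f g c)"
    and base: "card {p \<in> P2. vanishes_at f p \<and> vanishes_at g p} = n\<^sup>2"
    and S: "finite S" "distinct_params S sing"
    and all_sing: "\<And>c. c \<noteq> (0, 0) \<Longrightarrow>
          singular_curve (pencil_member f g c) \<longleftrightarrow> (\<exists>i\<in>S. same_param c (sing i))"
    and lci: "locally_complete_intersection (jacobian_sheaf (card S * n) (union_of_members f g S sing))"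
    and K: "finite K" "K \<noteq> {}" "distinct_params K q"
    and E: "distinct_params E exc"
    and exc: "\<And>c. c \<noteq> (0, 0) \<Longrightarrow> (\<exists>i\<in>E. same_param c (exc i)) \<longleftrightarrow>
          singular_curve (pencil_member f g c) \<and> \<not> (\<exists>j\<in>K. same_param c (q j))"
    and p: "p \<in> P2"
  defines "ZS \<equiv> zero_scheme_sheaf (union_of_members f g K q) (2 * int n - 2) (gradient_wedge f g) p"
    and "J \<equiv> \<lambda>i. jacobian_sheaf n (pencil_member f g (exc i)) p"
  shows "(ZS = structure_sheaf p \<and> (\<forall>i\<in>E. J i = structure_sheaf p)) \<or>
    (\<exists>i0\<in>E. ZS = J i0 \<and> (\<forall>i\<in>E - {i0}. J i = structure_sheaf p))"
proof -
  obtain v where v: "v \<noteq> 0" "p = proj_rel `` {v}"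
    and van: "\<And>d F. homogeneous d F \<Longrightarrow> vanishes_at F p \<longleftrightarrow> eval3 F v = 0"
    and tw: "\<And>a. twist a p = loc v a"
    using P2_representative[OF p] by (metis (no_types, lifting))
  let ?pm = "pencil_member f g" and ?s = "gradient_wedge f g" and ?F = "union_of_members f g K q"
  note hpm = homogeneous_pencil_member[OF f g]
  have ZS: "ZS = functional_values v (vgrad ?F) (2 * int n - 2) ?s"
    unfolding ZS_def by (rule zero_scheme_sheaf_eq[OF tw])
  have J: "J i = (\<lambda>c. dot3 c (vgrad (?pm (exc i)))) ` vloc v (1 - int n)" for i
    unfolding J_def by (rule jacobian_sheaf_eq[OF tw])
  have R: "structure_sheaf p = loc v 0" by (rule tw)
  have J_smooth: "J i = structure_sheaf p" if "grad3 (?pm (exc i)) v \<noteq> 0" for i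
    unfolding J R by (rule jacobian_unit[OF v(1) hpm n that])
  have s_loc: "?s \<in> vloc v (2 * int n - 2)"
    unfolding gradient_wedge_eq by (rule vloc_cross3[OF vloc_vgrad[OF f n refl] vloc_vgrad[OF g n refl]]) simp
  have pm01: "?pm (1, 0) = f" "?pm (0, 1) = g" by (simp_all add: pencil_member_def)
  have "\<exists>w1 w2. binary_form (?pm (1, 0)) (?pm (0, 1)) n (card K) ?F w1 w2"
    by (rule binary_form_union[OF K(1) f g]) simp
  then obtain w1 w2 where bfF: "binary_form f g n (card K) ?F w1 w2" unfolding pm01 by blast
  have "vgrad ?F = smult3 (to_ratfun w1) (vgrad f) + smult3 (to_ratfun w2) (vgrad g)"
    using bfF by (simp add: binary_form_def vgrad_def smult3_def)
  then have s_perp: "dot3 ?s (vgrad ?F) = 0"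
    unfolding gradient_wedge_eq by (simp add: dot3_add dot3_smult)
  define w where "w = cross3 (grad3 f v) (grad3 g v)"
  have w_val: "w = (val3 v (fst ?s), val3 v (fst (snd ?s)), val3 v (snd (snd ?s)))"
    unfolding gradient_wedge_def fst_conv snd_conv val3_to_ratfun w_def by (simp add: cross3_def grad3_def)
  have pm_grad: "grad3 (?pm c) v = smult3 (fst c) (grad3 f v) + smult3 (snd c) (grad3 g v)" for c
    by (cases c) (simp add: pencil_member_def grad3_add grad3_const3_mult)
  have exc_nz: "exc i \<noteq> (0, 0)" if "i \<in> E" for i using E that by (simp add: distinct_params_def)
  show ?thesis
  proof (cases "w = 0")
    case False
    have "grad3 (?pm c) v \<noteq> 0" if "c \<noteq> (0, 0)" for c
    proof
      assume *: "grad3 (?pm c) v = 0"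
      have "smult3 (fst c) w = cross3 (grad3 (?pm c) v) (grad3 g v)"
        "smult3 (snd c) w = cross3 (grad3 f v) (grad3 (?pm c) v)"
        unfolding pm_grad w_def cross3_add cross3_smult by simp_all
      then have "smult3 (fst c) w = 0" "smult3 (snd c) w = 0"
        unfolding * by (simp_all add: cross3_def zero_prod_def split: prod.split)
      with False that show False by (cases w; cases c) (auto simp: smult3_def zero_prod_def)
    qed
    then have "\<forall>i\<in>E. J i = structure_sheaf p" using J_smooth exc_nz by blast
    moreover have "ZS = structure_sheaf p"
      unfolding ZS R using functional_values_nonvanishing[OF v(1) s_loc s_perp] False w_val by simp
    ultimately show ?thesis by blast
  next
    case True
    have not_base: "\<not> (eval3 f v = 0 \<and> eval3 g v = 0)"
    proof
      assume *: "eval3 f v = 0 \<and> eval3 g v = 0"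
      have "w \<noteq> 0"
        unfolding w_def by (rule base_point_transversal[OF cop f g n base p v conjunct1[OF *] conjunct2[OF *] van])
      with True show False by simp
    qed
    \<comment> \<open>Parallel gradients of \<open>f\<close> and \<open>g\<close> mean that some
      member has zero gradient at \<open>v\<close>; by the Euler relation it also passes through
      \<open>v\<close>.\<close>
    have "\<exists>c. c \<noteq> (0, 0) \<and> grad3 (?pm c) v = 0"
    proof (cases "grad3 f v = 0")
      case True
      then show ?thesis by (intro exI[of _ "(1, 0)"]) (simp add: pm_grad)
    next
      case False
      then obtain t where t: "grad3 g v = smult3 t (grad3 f v)" using cross3_parallel True unfolding w_def by metis
      have "grad3 (?pm (t, - 1)) v = 0"
        unfolding pm_grad t by (cases "grad3 f v") (simp add: smult3_def zero_prod_def)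
      then show ?thesis by (intro exI[of _ "(t, - 1)"]) simp
    qed
    then obtain c where c: "c \<noteq> (0, 0)" "grad3 (?pm c) v = 0" by blast
    have sing_pm: "singular_curve (?pm d)" if "grad3 (?pm d) v = 0" for d
    proof -
      have "eval3 (?pm d) v = 0" using euler_grad3[OF hpm, of v d] that n by simp
      with that show ?thesis
        unfolding singular_curve_def using p
        by (intro bexI[of _ p]) (simp_all add: van[OF hpm] van[OF homogeneous_dd(1)[OF hpm]]
            van[OF homogeneous_dd(2)[OF hpm]] van[OF homogeneous_dd(3)[OF hpm]] grad3_def zero_prod_def)
    qed
    from all_sing[OF c(1)] sing_pm[OF c(2)] obtain i where i: "i \<in> S" "same_param c (sing i)" by blast
    \<comment> \<open>The proportional parameter listed in \<open>sing\<close>, to which the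
      complete intersection hypothesis refers.\<close>
    define b where "b = sing i"
    have b0: "b \<noteq> (0, 0)" using S(2) i(1) by (simp add: b_def distinct_params_def)
    have scale: "\<exists>t. t \<noteq> 0 \<and> ?pm d = const3 t * ?pm e" if "same_param d e" for d e
    proof -
      from that obtain t where "t \<noteq> 0" "fst d = t * fst e" "snd d = t * snd e"
        by (cases d; cases e) (auto simp: same_param_def)
      then show ?thesis
        by (intro exI[of _ t]) (cases d; cases e; simp add: pencil_member_def const3_mult algebra_simps)
    qed
    have gb: "grad3 (?pm d) v = 0" if "same_param d c" for d
      using scale[OF that] c(2) by (auto simp: grad3_const3_mult)
    have bc: "same_param b c" using same_param_sym[OF i(2)] by (simp add: b_def)
    have bv: "eval3 (?pm b) v = 0"
      using euler_grad3[OF hpm, of v b] gb[OF bc] n by simp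
    \<comment> \<open>A second basis vector of the pencil; its member avoids \<open>v\<close>, since
      otherwise \<open>v\<close> would be a base point.\<close>
    define c' where "c' = (if fst b = 0 then (1, 0) else (0, 1) :: 'a \<times> 'a)"
    have det: "det2 b c' \<noteq> 0" using b0 by (cases b) (auto simp: c'_def)
    have c'v: "eval3 (?pm c') v \<noteq> 0"
    proof
      assume "eval3 (?pm c') v = 0"
      then have "eval3 (?pm d) v = 0" for d
        using arg_cong[OF pencil_member_change[OF det, of f g d], of "\<lambda>F. eval3 F v"] bv by simp
      from this[of "(1, 0)"] this[of "(0, 1)"] not_base show False by (simp add: pm01)
    qed
    have other: "eval3 (?pm d) v \<noteq> 0" if "d \<noteq> (0, 0)" "\<not> same_param b d" for d
      using eval3_other_member[OF det bv c'v] same_param_det2[OF b0 that(1)] that(2) by blast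
    have J_other: "J j = structure_sheaf p" if "j \<in> E" "\<not> same_param b (exc j)" for j
    proof (rule J_smooth, rule notI)
      assume "grad3 (?pm (exc j)) v = 0"
      then have "eval3 (?pm (exc j)) v = 0" using euler_grad3[OF hpm, of v "exc j"] n by simp
      with other[OF exc_nz[OF that(1)] that(2)] show False by blast
    qed
    obtain \<chi> where \<chi>: "\<chi> \<in> vloc v 1" "dot3 \<chi> (vgrad (?pm b)) = to_ratfun (?pm b)"
      "dot3 \<chi> (vgrad (?pm c')) = 0"
      using lci_scaling_field[OF f g n red[OF b0, unfolded b_def] p v(1) tw S(2,1) i(1) lci gb[OF bc, unfolded b_def]
          det[unfolded b_def] c'v] unfolding b_def by blast
    have scaled: "scaled_singularity v (?pm d) (?pm c') n \<chi>" if d: "d \<noteq> (0, 0)" "same_param d b" for d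
    proof
      show "dot3 \<chi> (vgrad (?pm d)) = to_ratfun (?pm d)"
        using scale[OF d(2)] \<chi>(2) by (auto simp: vgrad_const3_mult dot3_smult)
    qed (fact v(1) red[OF d(1)] hpm n c'v \<chi>)+
    have det_d: "det2 d c' \<noteq> 0" if "same_param d b" for d
    proof -
      from that obtain t where "t \<noteq> 0" "fst d = t * fst b" "snd d = t * snd b"
        by (cases d; cases b) (auto simp: same_param_def)
      then have "det2 d c' = t * det2 b c'" by (simp add: algebra_simps)
      with \<open>t \<noteq> 0\<close> det show ?thesis by simp
    qed
    show ?thesis
    proof (cases "\<exists>j\<in>K. same_param b (q j)")
      case True
      then obtain j where j: "j \<in> K" "same_param b (q j)" by blast
      have "\<not> same_param b (exc i)" if "i \<in> E" for i
      proof
        assume "same_param b (exc i)"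
        with same_param_sym[OF this] j(2) have "same_param (exc i) (q j)" by (blast intro: same_param_trans)
        moreover have "\<not> (\<exists>j\<in>K. same_param (exc i) (q j))"
          using exc[OF exc_nz[OF that]] that same_param_refl by blast
        ultimately show False using j(1) by blast
      qed
      then have J_all: "\<forall>i\<in>E. J i = structure_sheaf p" using J_other by blast
      have qj: "q j \<noteq> (0, 0)" "same_param (q j) b"
        using K(3) j(1) same_param_sym[OF j(2)] by (simp_all add: distinct_params_def)
      interpret sc: scaled_singularity v "?pm (q j)" "?pm c'" n \<chi> by (rule scaled[OF qj])
      define u where "u = union_of_members f g (K - {j}) q"
      have F_eq: "?F = ?pm (q j) * u" unfolding u_def by (rule union_remove[OF K(1) j(1)])
      have qv: "eval3 (?pm (q j)) v = 0" using scale[OF qj(2)] bv by auto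
      have uv: "eval3 u v \<noteq> 0"
        unfolding u_def by (rule complement_nonvanishing[OF K(3,1) j(1) det_d[OF qj(2)] qv c'v])
      obtain u1 u2 where bf: "binary_form (?pm (q j)) (?pm c') n (card (K - {j})) u u1 u2"
        using binary_form_union[OF finite_Diff[OF K(1)] f g det_d[OF qj(2)]] unfolding u_def by blast
      obtain \<phi> where \<phi>: "linear_functional (loc v 0) {\<theta> \<in> vloc v (2 * int n - 2). dot3 \<theta> (vgrad ?F) = 0} \<phi>"
        "\<phi> sc.s = 1"
        using sc.functional_values_on_curve[OF bf uv qv] unfolding F_eq by blast
      let ?\<kappa> = "to_ratfun (const3 (det2 (q j) c'))"
      have \<kappa>: "?\<kappa> \<in> loc v 0"
        using loc_form[OF homogeneous_const3] by simp
      \<comment> \<open>\<open>sc.s\<close> is formed from another basis of the pencil and differs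
        from \<open>?s\<close> by the constant \<open>?\<kappa>\<close>, which is therefore inverse
        to the value of \<open>\<phi>\<close> at \<open>?s\<close>.\<close>
      have "sc.s = smult3 ?\<kappa> ?s" unfolding sc.s_def by (rule cross3_vgrad_members)
      then have "?\<kappa> * \<phi> ?s = 1"
        using linear_functional_smult[OF \<phi>(1) \<kappa>, of ?s] \<phi>(2) s_loc s_perp by simp
      from functional_values_unit[OF \<phi>(1) s_loc s_perp \<kappa> this] have "ZS = structure_sheaf p"
        unfolding ZS R .
      with J_all show ?thesis by blast
    next
      case False
      with exc[OF b0] sing_pm[OF gb[OF bc]] obtain i1 where i1: "i1 \<in> E" "same_param b (exc i1)" by blast
      have ei: "exc i1 \<noteq> (0, 0)" "same_param (exc i1) b" using exc_nz[OF i1(1)] same_param_sym[OF i1(2)] by simp_all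
      have "\<not> same_param b (exc j)" if "j \<in> E - {i1}" for j
      proof
        assume "same_param b (exc j)"
        with ei(2) have "same_param (exc i1) (exc j)" by (rule same_param_trans)
        with E i1(1) that show False by (auto simp: distinct_params_def)
      qed
      then have J_rest: "\<forall>j\<in>E - {i1}. J j = structure_sheaf p" using J_other by blast
      interpret sc: scaled_singularity v "?pm (exc i1)" "?pm c'" n \<chi> by (rule scaled[OF ei])
      have Fv: "eval3 ?F v \<noteq> 0"
        unfolding union_of_members_def eval3_prod prod_zero_iff[OF K(1)]
      proof
        assume "\<exists>j\<in>K. eval3 (?pm (q j)) v = 0"
        then obtain j where "j \<in> K" "eval3 (?pm (q j)) v = 0" by blast
        moreover have "q j \<noteq> (0, 0)" using K(3) \<open>j \<in> K\<close> by (simp add: distinct_params_def)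
        ultimately show False using other False by blast
      qed
      have N: "1 \<le> card K * n" using K n by (simp add: Suc_le_eq card_gt_0_iff)
      have "ZS = (\<lambda>c. dot3 c ?s) ` vloc v (- (2 * int n - 2))"
        unfolding ZS by (rule functional_values_off_curve[OF v(1) homogeneous_union[OF K(1) f g] N Fv s_loc s_perp])
      also have "\<dots> = (\<lambda>c. dot3 c sc.s) ` vloc v (2 - 2 * int n)"
      proof -
        define \<kappa> where "\<kappa> = det2 (exc i1) c'"
        have \<kappa>0: "\<kappa> \<noteq> 0" unfolding \<kappa>_def by (rule det_d[OF ei(2)])
        have k: "to_ratfun (const3 \<kappa>) \<in> loc v 0" "to_ratfun (const3 (inverse \<kappa>)) \<in> loc v 0"
          using loc_form[OF homogeneous_const3] by simp_all
        have inv: "to_ratfun (const3 (inverse \<kappa>)) * to_ratfun (const3 \<kappa>) = 1"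
          unfolding to_ratfun_hom(3)[symmetric] const3_mult[symmetric] using \<kappa>0 by simp
        have s_eq: "sc.s = smult3 (to_ratfun (const3 \<kappa>)) ?s"
          unfolding sc.s_def \<kappa>_def by (rule cross3_vgrad_members)
        have e: "- (2 * int n - 2) = 2 - 2 * int n" by simp
        show ?thesis
          unfolding e
        proof (intro Set.equalityI image_subsetI)
          fix c assume c: "c \<in> vloc v (2 - 2 * int n)"
          have "dot3 c ?s = dot3 (smult3 (to_ratfun (const3 (inverse \<kappa>))) c) sc.s"
            unfolding s_eq dot3_smult by (simp only: mult.assoc[symmetric] inv inv[unfolded mult.commute[of _ "to_ratfun (const3 \<kappa>)"]] mult_1_left)
          moreover have "smult3 (to_ratfun (const3 (inverse \<kappa>))) c \<in> vloc v (2 - 2 * int n)"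
            by (rule vloc_smult[OF k(2) c]) simp
          ultimately show "dot3 c ?s \<in> (\<lambda>c. dot3 c sc.s) ` vloc v (2 - 2 * int n)" by blast
          have "dot3 c sc.s = dot3 (smult3 (to_ratfun (const3 \<kappa>)) c) ?s"
            unfolding s_eq dot3_smult ..
          moreover have "smult3 (to_ratfun (const3 \<kappa>)) c \<in> vloc v (2 - 2 * int n)"
            by (rule vloc_smult[OF k(1) c]) simp
          ultimately show "dot3 c sc.s \<in> (\<lambda>c. dot3 c ?s) ` vloc v (2 - 2 * int n)" by blast
        qed
      qed
      also have "\<dots> = J i1" unfolding J by (rule sc.jacobian_eq[symmetric])
      finally show ?thesis using i1(1) J_rest by blast
    qed
  qed
qed

subsection \<open>Tensor products of ideals all but one of which are trivial\<close>

lemma formal_mult_superset: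
  assumes "finite S" "Poly_Mapping.keys t \<subseteq> S"
  shows "formal_mult I t = (\<Sum>x\<in>S. Poly_Mapping.lookup t x * (\<Prod>i\<in>I. x i))"
  unfolding formal_mult_def using assms
  by (intro sum.mono_neutral_left) (auto simp: in_keys_iff)

lemma formal_mult_add: "formal_mult I (s + t) = formal_mult I s + formal_mult I t"
proof -
  let ?S = "Poly_Mapping.keys s \<union> Poly_Mapping.keys t"
  have fin: "finite ?S" by simp
  have "formal_mult I (s + t) = (\<Sum>x\<in>?S. Poly_Mapping.lookup (s + t) x * (\<Prod>i\<in>I. x i))"
    by (rule formal_mult_superset[OF fin]) (rule Poly_Mapping.keys_add)
  also have "\<dots> = (\<Sum>x\<in>?S. Poly_Mapping.lookup s x * (\<Prod>i\<in>I. x i)) +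
      (\<Sum>x\<in>?S. Poly_Mapping.lookup t x * (\<Prod>i\<in>I. x i))"
    by (simp add: lookup_add distrib_right sum.distrib)
  also have "\<dots> = formal_mult I s + formal_mult I t"
    using formal_mult_superset[OF fin, of s I] formal_mult_superset[OF fin, of t I] by simp
  finally show ?thesis .
qed

lemma formal_mult_0 [simp]: "formal_mult I 0 = 0"
  by (simp add: formal_mult_def)

lemma formal_mult_diff: "formal_mult I (s - t) = formal_mult I s - formal_mult I t"
  using formal_mult_add[of I "s - t" t] by simp

lemma formal_mult_single: "formal_mult I (Poly_Mapping.single x c) = c * (\<Prod>i\<in>I. x i)"
  by (simp add: formal_mult_def)

lemma prod_fun_upd: "finite I \<Longrightarrow> i \<in> I \<Longrightarrow> (\<Prod>j\<in>I. (x(i := u)) j) = u * (\<Prod>j\<in>I - {i}. x j)"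
  by (subst prod.remove[of I i]) (auto intro!: prod.cong)

lemma formal_mult_relation:
  assumes "t \<in> tensor_relations R I M" "finite I"
  shows "formal_mult I t = 0"
  using assms(1)
proof (induction rule: tensor_relations.induct)
  case (additive c x i u v)
  then show ?case
    unfolding formal_mult_diff formal_mult_single prod_fun_upd[OF assms(2) \<open>i \<in> I\<close>]
    by (simp add: algebra_simps)
next
  case (scaling c x i a u)
  then show ?case
    unfolding formal_mult_diff formal_mult_single prod_fun_upd[OF assms(2) \<open>i \<in> I\<close>]
    by (simp add: algebra_simps)
qed (simp_all add: formal_mult_add)

text \<open>\<open>M\<close> is a family of ideals of the subring \<open>R\<close>; that all but one
  of them equal \<open>R\<close> is added by \<open>trivial_tensor_index\<close> and
  \<open>trivial_except\<close>.\<close>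

locale trivial_tensor =
  fixes R :: "'b::comm_ring_1 set" and I :: "'i set" and M :: "'i \<Rightarrow> 'b set"
  assumes ring: "0 \<in> R" "1 \<in> R" "\<And>x y. x \<in> R \<Longrightarrow> y \<in> R \<Longrightarrow> x * y \<in> R" "\<And>x. x \<in> R \<Longrightarrow> - x \<in> R"
    and fin: "finite I"
    and ideal: "\<And>i. i \<in> I \<Longrightarrow> M i \<subseteq> R" "\<And>i. i \<in> I \<Longrightarrow> 0 \<in> M i"
      "\<And>i x y. i \<in> I \<Longrightarrow> x \<in> M i \<Longrightarrow> y \<in> M i \<Longrightarrow> x + y \<in> M i"
      "\<And>i x y. i \<in> I \<Longrightarrow> x \<in> R \<Longrightarrow> y \<in> M i \<Longrightarrow> x * y \<in> M i"
begin

abbreviation "rels \<equiv> tensor_relations R I M"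

lemma rel_minus: "t \<in> rels \<Longrightarrow> - t \<in> rels"
proof (induction rule: tensor_relations.induct)
  case zero
  show ?case using tensor_relations.zero[of R I M] by simp
next
  case (sum s t)
  from tensor_relations.sum[OF sum.IH(2,1)] show ?case by (simp add: algebra_simps)
next
  case (additive c x i u v)
  from tensor_relations.additive[OF ring(4)[OF additive(1)] additive(2-5)]
  show ?case by (simp add: single_uminus algebra_simps)
next
  case (scaling c x i a u)
  from tensor_relations.scaling[OF ring(4)[OF scaling(1)] scaling(2-5)]
  show ?case by (simp add: single_uminus algebra_simps)
qed

lemma rel_diff: "s \<in> rels \<Longrightarrow> t \<in> rels \<Longrightarrow> s - t \<in> rels"
  using tensor_relations.sum[of s R I M "- t"] rel_minus[of t] by simp

lemma rel_trans: "r - s \<in> rels \<Longrightarrow> s - t \<in> rels \<Longrightarrow> r - t \<in> rels"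
  using tensor_relations.sum[of "r - s" R I M "s - t"] by simp

lemma rel_mono: "s - s' \<in> rels \<Longrightarrow> t - t' \<in> rels \<Longrightarrow> (s + t) - (s' + t') \<in> rels"
  using tensor_relations.sum[of "s - s'" R I M "t - t'"] by (simp add: algebra_simps)

end

locale trivial_tensor_index = trivial_tensor R I M
  for R :: "'b::comm_ring_1 set" and I :: "'i set" and M :: "'i \<Rightarrow> 'b set" +
  fixes i0 :: 'i
  assumes i0: "i0 \<in> I" and triv: "\<And>i. i \<in> I \<Longrightarrow> i \<noteq> i0 \<Longrightarrow> M i = R"
begin

text \<open>Stands for the pure tensor with \<open>u\<close> in position \<open>i0\<close> and
  \<open>1\<close> elsewhere; \<open>undefined\<close> outside \<open>I\<close> makes the tuple
  extensional.\<close>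

definition unit_tuple :: "'b \<Rightarrow> 'i \<Rightarrow> 'b" where
  "unit_tuple u = (\<lambda>i. if i = i0 then u else if i \<in> I then 1 else undefined)"

lemma unit_tuple: "u \<in> M i0 \<Longrightarrow> unit_tuple u \<in> (\<Pi>\<^sub>E i\<in>I. M i)"
  using i0 triv ring by (auto simp: unit_tuple_def PiE_def extensional_def)

lemma unit_tuple_upd: "(unit_tuple u)(i0 := w) = unit_tuple w"
  by (auto simp: unit_tuple_def)

text \<open>The entries away from \<open>i0\<close> lie in \<open>R\<close> and move one after
  another into the scalar, leaving \<open>1\<close>, which is allowed because
  \<open>M i = R\<close>; finally the scalar moves into position \<open>i0\<close>.\<close>

lemma single_rel:
  assumes x: "x \<in> (\<Pi>\<^sub>E i\<in>I. M i)" and c: "c \<in> R"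
  shows "c * (\<Prod>i\<in>I. x i) \<in> M i0"
    "Poly_Mapping.single x c - Poly_Mapping.single (unit_tuple (c * (\<Prod>i\<in>I. x i))) 1 \<in> rels"
proof -
  have xM: "x i \<in> M i" if "i \<in> I" for i using x that by auto
  have xR: "x i \<in> R" if "i \<in> I" for i using xM[OF that] ideal(1)[OF that] by blast
  \<comment> \<open>The tuple after the entries in \<open>S\<close> have been moved out.\<close>
  define y where "y S = (\<lambda>i. if i \<in> S then 1 else x i)" for S
  have step: "c * (\<Prod>i\<in>S. x i) \<in> R \<and> y S \<in> (\<Pi>\<^sub>E i\<in>I. M i) \<and>
      Poly_Mapping.single x c - Poly_Mapping.single (y S) (c * (\<Prod>i\<in>S. x i)) \<in> rels"
    if "S \<subseteq> I - {i0}" for S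
  proof -
    have "finite S" using that fin finite_subset by blast
    then show ?thesis using that
    proof (induction S rule: finite_induct)
      case empty
      have "y {} = x" by (simp add: y_def)
      then show ?case using c x tensor_relations.zero[of R I M] by simp
    next
      case (insert j S)
      then have IH: "c * (\<Prod>i\<in>S. x i) \<in> R" "y S \<in> (\<Pi>\<^sub>E i\<in>I. M i)"
        "Poly_Mapping.single x c - Poly_Mapping.single (y S) (c * (\<Prod>i\<in>S. x i)) \<in> rels" by auto
      have j: "j \<in> I" "j \<noteq> i0" using insert.prems by auto
      then have 1: "1 \<in> M j" using triv ring by auto
      have upd: "(y S)(j := x j * 1) = y S" "(y S)(j := 1) = y (insert j S)"
        using insert.hyps by (auto simp: y_def)
      have prod: "c * (\<Prod>i\<in>S. x i) * x j = c * (\<Prod>i\<in>insert j S. x i)"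
        using insert.hyps by (simp add: mult.assoc mult.left_commute mult.commute)
      have "Poly_Mapping.single (y S) (c * (\<Prod>i\<in>S. x i)) -
          Poly_Mapping.single (y (insert j S)) (c * (\<Prod>i\<in>insert j S. x i)) \<in> rels"
        using tensor_relations.scaling[OF IH(1,2) j(1) xR[OF j(1)] 1] unfolding upd prod .
      from rel_trans[OF IH(3) this]
      have "Poly_Mapping.single x c - Poly_Mapping.single (y (insert j S)) (c * (\<Prod>i\<in>insert j S. x i)) \<in> rels" .
      moreover have "c * (\<Prod>i\<in>insert j S. x i) \<in> R"
        unfolding prod[symmetric] using ring(3)[OF IH(1) xR[OF j(1)]] .
      moreover have "y (insert j S) \<in> (\<Pi>\<^sub>E i\<in>I. M i)"
        using IH(2) j 1 unfolding upd(2)[symmetric] by (auto simp: PiE_def extensional_def)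
      ultimately show ?case by blast
    qed
  qed
  let ?d = "c * (\<Prod>i\<in>I - {i0}. x i)"
  have d: "?d \<in> R" "y (I - {i0}) \<in> (\<Pi>\<^sub>E i\<in>I. M i)"
    "Poly_Mapping.single x c - Poly_Mapping.single (y (I - {i0})) ?d \<in> rels" using step[of "I - {i0}"] by auto
  have dx: "?d * x i0 = c * (\<Prod>i\<in>I. x i)"
    unfolding prod.remove[OF fin i0, of x] by (simp only: mult.assoc mult.commute[of "x i0"])
  show "c * (\<Prod>i\<in>I. x i) \<in> M i0"
    unfolding dx[symmetric] by (rule ideal(4)[OF i0 d(1) xM[OF i0]])
  have upd: "(y (I - {i0}))(i0 := x i0) = y (I - {i0})" "(y (I - {i0}))(i0 := ?d * x i0) = unit_tuple (?d * x i0)"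
    using x i0 by (auto simp: y_def unit_tuple_def PiE_def extensional_def)
  have "Poly_Mapping.single (unit_tuple (?d * x i0)) 1 - Poly_Mapping.single (y (I - {i0})) ?d \<in> rels"
    using tensor_relations.scaling[OF ring(2) d(2) i0 d(1) xM[OF i0]] unfolding upd by simp
  from rel_diff[OF d(3) this]
  show "Poly_Mapping.single x c - Poly_Mapping.single (unit_tuple (c * (\<Prod>i\<in>I. x i))) 1 \<in> rels"
    unfolding dx by simp
qed

text \<open>The normal forms of \<open>single_rel\<close> add up in position \<open>i0\<close>, so
  the class of a tensor depends only on its product: multiplication is injective.\<close>

lemma formal_tensor_rel:
  assumes "t \<in> formal_tensors R I M"
  shows "formal_mult I t \<in> M i0" "t - Poly_Mapping.single (unit_tuple (formal_mult I t)) 1 \<in> rels"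
proof -
  let ?s = "\<lambda>S. \<Sum>x\<in>S. Poly_Mapping.single x (Poly_Mapping.lookup t x)"
  let ?N = "\<lambda>u. Poly_Mapping.single (unit_tuple u) (1::'b)"
  have add: "?N (u + w) - (?N u + ?N w) \<in> rels" if "u \<in> M i0" "w \<in> M i0" for u w
    using tensor_relations.additive[OF ring(2) unit_tuple[OF that(1)] i0 that]
    by (simp add: unit_tuple_upd algebra_simps)
  have main: "formal_mult I (?s S) \<in> M i0 \<and> ?s S - ?N (formal_mult I (?s S)) \<in> rels"
    if "S \<subseteq> Poly_Mapping.keys t" for S
  proof -
    have "finite S" using that finite_keys finite_subset by blast
    then show ?thesis using that
    proof (induction S rule: finite_induct)
      case empty
      \<comment> \<open>Additivity with both entries zero makes the tensor of \<open>0\<close> a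
        relation.\<close>
      have "- ?N 0 \<in> rels" using add[OF ideal(2)[OF i0] ideal(2)[OF i0]] by simp
      then show ?case using ideal(2)[OF i0] by simp
    next
      case (insert x S)
      then have x: "x \<in> (\<Pi>\<^sub>E i\<in>I. M i)" "Poly_Mapping.lookup t x \<in> R"
        using assms by (auto simp: formal_tensors_def)
      let ?a = "Poly_Mapping.lookup t x * (\<Prod>i\<in>I. x i)"
      have IH: "formal_mult I (?s S) \<in> M i0" "?s S - ?N (formal_mult I (?s S)) \<in> rels" using insert by auto
      have fm: "formal_mult I (?s (insert x S)) = ?a + formal_mult I (?s S)"
        using insert.hyps by (simp add: formal_mult_add formal_mult_single)
      have "?s (insert x S) - (?N ?a + ?N (formal_mult I (?s S))) \<in> rels"
        using rel_mono[OF single_rel(2)[OF x] IH(2)] insert.hyps by simp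
      moreover have "(?N ?a + ?N (formal_mult I (?s S))) - ?N (?a + formal_mult I (?s S)) \<in> rels"
        using rel_minus[OF add[OF single_rel(1)[OF x] IH(1)]] by simp
      ultimately have "?s (insert x S) - ?N (?a + formal_mult I (?s S)) \<in> rels" by (rule rel_trans)
      then show ?case unfolding fm using ideal(3)[OF i0 single_rel(1)[OF x] IH(1)] by blast
    qed
  qed
  have t: "?s (Poly_Mapping.keys t) = t"
    by (rule poly_mapping_eqI) (simp add: lookup_sum lookup_single when_def in_keys_iff)
  show "formal_mult I t \<in> M i0" "t - ?N (formal_mult I t) \<in> rels"
    using main[OF order_refl] unfolding t by (rule conjunct1, rule conjunct2)
qed

end

context trivial_tensor
begin

text \<open>Covers also the empty index set, where the tensor product is the ring itself.\<close>

definition trivial_except :: "'b set \<Rightarrow> bool" where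
  "trivial_except N \<longleftrightarrow> I = {} \<and> N = R \<or> (\<exists>i0\<in>I. N = M i0 \<and> (\<forall>i\<in>I. i \<noteq> i0 \<longrightarrow> M i = R))"

text \<open>With a single tuple, that of empty domain, a formal tensor is one coefficient.\<close>

lemma empty_formal_tensor:
  assumes I: "I = {}" and e: "(\<Pi>\<^sub>E i\<in>I. M i) = {e}" and t: "t \<in> formal_tensors R I M"
  shows "t = Poly_Mapping.single e (formal_mult I t)" "formal_mult I t \<in> R"
proof -
  have "Poly_Mapping.keys t \<subseteq> (\<Pi>\<^sub>E i\<in>I. M i) \<and> range (Poly_Mapping.lookup t) \<subseteq> R"
    using t unfolding formal_tensors_def by (rule CollectD)
  then have keys: "Poly_Mapping.keys t \<subseteq> {e}" "range (Poly_Mapping.lookup t) \<subseteq> R"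
    unfolding e by (rule conjunct1, rule conjunct2)
  have "formal_mult I t = (\<Sum>x\<in>{e}. Poly_Mapping.lookup t x * (\<Prod>i\<in>I. x i))"
    by (rule formal_mult_superset[OF _ keys(1)]) simp
  then have fm: "formal_mult I t = Poly_Mapping.lookup t e" by (simp add: I)
  show "formal_mult I t \<in> R" unfolding fm by (rule subsetD[OF keys(2) rangeI])
  show "t = Poly_Mapping.single e (formal_mult I t)"
  proof (rule poly_mapping_eqI)
    fix x
    show "Poly_Mapping.lookup t x = Poly_Mapping.lookup (Poly_Mapping.single e (formal_mult I t)) x"
    proof (cases "x = e")
      case True
      then show ?thesis by (simp add: fm)
    next
      case False
      with keys(1) have "x \<notin> Poly_Mapping.keys t" by blast
      with False show ?thesis by (simp add: lookup_single when_def in_keys_iff)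
    qed
  qed
qed

lemma formal_tensor_values:
  assumes N: "trivial_except N" and t: "t \<in> formal_tensors R I M"
  shows "formal_mult I t \<in> N" "s \<in> formal_tensors R I M \<Longrightarrow> formal_mult I s = formal_mult I t \<Longrightarrow> s - t \<in> rels"
proof -
  have "formal_mult I t \<in> N \<and> (s \<in> formal_tensors R I M \<longrightarrow> formal_mult I s = formal_mult I t \<longrightarrow> s - t \<in> rels)"
    using N unfolding trivial_except_def
  proof (elim disjE conjE bexE)
    assume I: "I = {}" and NR: "N = R"
    have "(\<Pi>\<^sub>E i\<in>I. M i) = {\<lambda>_. undefined}" unfolding I by (rule PiE_empty_domain)
    then obtain e where e: "(\<Pi>\<^sub>E i\<in>I. M i) = {e}" ..
    have "s - t \<in> rels" if s: "s \<in> formal_tensors R I M" "formal_mult I s = formal_mult I t"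
    proof -
      have "s = Poly_Mapping.single e (formal_mult I s)" by (rule empty_formal_tensor(1)[OF I e s(1)])
      also have "\<dots> = Poly_Mapping.single e (formal_mult I t)" by (simp only: s(2))
      also have "\<dots> = t" by (rule empty_formal_tensor(1)[OF I e t, symmetric])
      finally have "s = t" .
      then show ?thesis using tensor_relations.zero[of R I M] by simp
    qed
    with empty_formal_tensor(2)[OF I e t] NR show ?thesis by simp
  next
    fix i0 assume e: "i0 \<in> I" "N = M i0" and nt: "\<forall>i\<in>I. i \<noteq> i0 \<longrightarrow> M i = R"
    interpret trivial_tensor_index R I M i0
      by unfold_locales (use e nt in blast)+
    have "s - t \<in> rels" if s: "s \<in> formal_tensors R I M" "formal_mult I s = formal_mult I t"
      using rel_diff[OF formal_tensor_rel(2)[OF s(1)] formal_tensor_rel(2)[OF t]] s(2) by simp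
    with formal_tensor_rel(1)[OF t] e(2) show ?thesis by simp
  qed
  then show "formal_mult I t \<in> N"
    "s \<in> formal_tensors R I M \<Longrightarrow> formal_mult I s = formal_mult I t \<Longrightarrow> s - t \<in> rels" by iprover+
qed

text \<open>Classes are fibres of multiplication; this turns the gluing of tensors into the gluing
  of functions.\<close>

lemma tensor_class:
  assumes N: "trivial_except N" and t: "t \<in> formal_tensors R I M"
  shows "tensor_rel R I M `` {t} = {s \<in> formal_tensors R I M. formal_mult I s = formal_mult I t}"
proof (intro Set.equalityI subsetI)
  fix s assume "s \<in> tensor_rel R I M `` {t}"
  then have s: "s \<in> formal_tensors R I M" "t - s \<in> rels" by (auto simp: tensor_rel_def)
  from formal_mult_relation[OF s(2) fin] s(1)
  show "s \<in> {s \<in> formal_tensors R I M. formal_mult I s = formal_mult I t}"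
    by (simp add: formal_mult_diff)
next
  fix s assume "s \<in> {s \<in> formal_tensors R I M. formal_mult I s = formal_mult I t}"
  then have "s \<in> formal_tensors R I M" "formal_mult I t = formal_mult I s" by auto
  with formal_tensor_values(2)[OF N this(1) t this(2)] t
  show "s \<in> tensor_rel R I M `` {t}" by (auto simp: tensor_rel_def)
qed

lemma tensor_mult_class:
  assumes N: "trivial_except N" and t: "t \<in> formal_tensors R I M"
  shows "tensor_mult I (tensor_rel R I M `` {t}) = formal_mult I t"
proof -
  have "formal_mult I ` (tensor_rel R I M `` {t}) = {formal_mult I t}"
    unfolding tensor_class[OF assms] using t by auto
  then show ?thesis by (simp add: tensor_mult_def)
qed

end

subsection \<open>Passage from stalks to sheaves\<close>

lemma zariski_open_P2: "zariski_open (P2 :: 'a::field point set)"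
proof -
  have "\<not> vanishes_at (1 :: 'a poly3) p" if "p \<in> P2" for p
    using that by (rule P2_representative) (auto simp: vanishes_at_def)
  then have "P2 = {p \<in> P2. \<exists>F\<in>{1 :: 'a poly3}. \<not> vanishes_at F p}" by auto
  then show ?thesis unfolding zariski_open_def by (intro exI[of _ "{1}"]) (auto intro: exI[of _ 0])
qed

lemma zariski_open_subset: "zariski_open U \<Longrightarrow> U \<subseteq> P2"
  by (auto simp: zariski_open_def)

lemma vanishes_at_mult:
  assumes "p \<in> P2" "homogeneous d F" "homogeneous e G"
  shows "vanishes_at (F * G) p \<longleftrightarrow> vanishes_at F p \<or> vanishes_at G p"
  using assms(1)
proof (rule P2_representative)
  fix v assume "\<And>d F. homogeneous d F \<Longrightarrow> vanishes_at F p \<longleftrightarrow> eval3 F v = 0"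
  from this[OF assms(2)] this[OF assms(3)] this[OF homogeneous_mult[OF assms(2,3)]] show ?thesis by simp
qed

lemma zariski_open_Int:
  assumes "zariski_open U" "zariski_open V"
  shows "zariski_open (U \<inter> V)"
proof -
  obtain S where S: "\<forall>F\<in>S. \<exists>d. homogeneous d F" "U = {p\<in>P2. \<exists>F\<in>S. \<not> vanishes_at F p}"
    using assms(1) unfolding zariski_open_def by (elim exE conjE)
  obtain T where T: "\<forall>F\<in>T. \<exists>d. homogeneous d F" "V = {p\<in>P2. \<exists>F\<in>T. \<not> vanishes_at F p}"
    using assms(2) unfolding zariski_open_def by (elim exE conjE)
  let ?P = "(\<lambda>(F, G). F * G) ` (S \<times> T)"
  have "\<forall>F\<in>?P. \<exists>d. homogeneous d F"
  proof
    fix H assume "H \<in> ?P"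
    then obtain F G where H: "F \<in> S" "G \<in> T" "H = F * G" by auto
    then obtain d e where "homogeneous d F" "homogeneous e G" using S(1) T(1) by blast
    then have "homogeneous (d + e) H" unfolding H(3) by (rule homogeneous_mult)
    then show "\<exists>d. homogeneous d H" ..
  qed
  moreover have "p \<in> U \<inter> V \<longleftrightarrow> p \<in> {p\<in>P2. \<exists>F\<in>?P. \<not> vanishes_at F p}" for p
  proof (cases "p \<in> P2")
    case True
    have mult: "vanishes_at (F * G) p \<longleftrightarrow> vanishes_at F p \<or> vanishes_at G p" if FG: "F \<in> S" "G \<in> T" for F G
    proof -
      obtain d e where "homogeneous d F" "homogeneous e G" using bspec[OF S(1) FG(1)] bspec[OF T(1) FG(2)] by blast
      then show ?thesis by (rule vanishes_at_mult[OF True])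
    qed
    have "(\<exists>H\<in>?P. \<not> vanishes_at H p) \<longleftrightarrow> (\<exists>F\<in>S. \<not> vanishes_at F p) \<and> (\<exists>G\<in>T. \<not> vanishes_at G p)"
      (is "?L \<longleftrightarrow> ?R")
    proof
      assume ?L
      then obtain H where H: "H \<in> ?P" "\<not> vanishes_at H p" by (rule bexE)
      from H(1) obtain F G where FG: "F \<in> S" "G \<in> T" "H = F * G" by auto
      from mult[OF FG(1,2)] H(2) have "\<not> vanishes_at F p" "\<not> vanishes_at G p" unfolding FG(3) by simp_all
      with FG(1,2) show ?R by (intro conjI bexI)
    next
      assume ?R
      then obtain F G where FG: "F \<in> S" "\<not> vanishes_at F p" "G \<in> T" "\<not> vanishes_at G p" by (elim conjE bexE)
      have "(F, G) \<in> S \<times> T" using FG by simp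
      then have "F * G \<in> ?P" by (rule rev_image_eqI) simp
      moreover have "\<not> vanishes_at (F * G) p" using mult[OF FG(1,3)] FG(2,4) by simp
      ultimately show ?L by (rule bexI[rotated])
    qed
    then show ?thesis using True by (simp only: S(2) T(2) Int_iff mem_Collect_eq simp_thms)
  next
    case False
    then show ?thesis by (simp add: S(2))
  qed
  then have "U \<inter> V = {p\<in>P2. \<exists>F\<in>?P. \<not> vanishes_at F p}" by (rule Set.set_eqI)
  ultimately show ?thesis unfolding zariski_open_def by blast
qed

lemma zariski_open_INT:
  assumes "finite I" "\<And>i. i \<in> I \<Longrightarrow> zariski_open (U i)"
  shows "zariski_open (P2 \<inter> (\<Inter>i\<in>I. U i))"
  using assms
proof (induction I rule: finite_induct)
  case empty
  then show ?case using zariski_open_P2 by simp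
next
  case (insert i I)
  then have "zariski_open (U i)" "zariski_open (P2 \<inter> (\<Inter>i\<in>I. U i))" by auto
  then have "zariski_open (U i \<inter> (P2 \<inter> (\<Inter>i\<in>I. U i)))" by (rule zariski_open_Int)
  then show ?case by (simp add: Int_left_commute)
qed

text \<open>Irreducibility of the plane: the product of one nonzero form from each open set is
  nonzero, so it has a point where it does not vanish.\<close>

lemma zariski_open_meet:
  fixes U V :: "'a::field_char_0 point set"
  assumes "zariski_open U" "zariski_open V" "U \<noteq> {}" "V \<noteq> {}"
  shows "U \<inter> V \<noteq> {}"
proof -
  obtain S where S: "\<forall>F\<in>S. \<exists>d. homogeneous d F" "U = {p\<in>P2. \<exists>F\<in>S. \<not> vanishes_at F p}"
    using assms(1) unfolding zariski_open_def by (elim exE conjE)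
  obtain T where T: "\<forall>F\<in>T. \<exists>d. homogeneous d F" "V = {p\<in>P2. \<exists>F\<in>T. \<not> vanishes_at F p}"
    using assms(2) unfolding zariski_open_def by (elim exE conjE)
  obtain p F where F: "F \<in> S" "\<not> vanishes_at F p" using assms(3) S(2) by blast
  obtain q G where G: "G \<in> T" "\<not> vanishes_at G q" using assms(4) T(2) by blast
  have "F \<noteq> 0" "G \<noteq> 0" using F(2) G(2) by (auto simp: vanishes_at_def)
  \<comment> \<open>The factor \<open>X3\<close> ensures that the vector found is not the
    origin.\<close>
  then have "F * G * X3 \<noteq> 0" by simp
  then obtain v where v: "eval3 (F * G * X3) v \<noteq> 0" using eval3_nonzero by blast
  then have "eval3 F v * eval3 G v * eval3 X3 v \<noteq> 0" by (simp only: eval3_mult not_False_eq_True)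
  then have Fv: "eval3 F v \<noteq> 0" "eval3 G v \<noteq> 0" "eval3 X3 v \<noteq> 0" by auto
  then have v0: "v \<noteq> (0, 0, 0)" by (metis eval3_X3)
  let ?p = "proj_rel `` {v}"
  have "?p \<in> P2" using v0 by (auto simp: P2_def quotient_def)
  moreover have "v \<in> ?p"
  proof -
    obtain x y z where "v = (x, y, z)" by (cases v)
    with v0 show ?thesis by (auto simp: proj_rel_def intro!: exI[of _ 1])
  qed
  moreover from this have "\<not> vanishes_at F ?p" "\<not> vanishes_at G ?p"
    using Fv(1,2) unfolding vanishes_at_def by (meson)+
  ultimately have "?p \<in> U \<inter> V" using F(1) G(1) unfolding S(2) T(2) by (intro IntI CollectI conjI bexI)
  then show ?thesis by blast
qed

lemma formal_tensors_stalk: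
  assumes "p \<in> V"
  shows "formal_tensors (sections_over V R) I (\<lambda>i. sections_over V (M i)) \<subseteq> formal_tensors (R p) I (\<lambda>i. M i p)"
proof -
  have "sections_over V R \<subseteq> R p" "sections_over V (M i) \<subseteq> M i p" for i
    using assms by (auto simp: sections_over_def)
  then show ?thesis unfolding formal_tensors_def PiE_def Pi_def by blast
qed

text \<open>The description of stalks spreads to neighbourhoods because triviality of each ideal is
  an open condition; values on different neighbourhoods agree because nonempty open sets
  meet.\<close>

lemma ideal_sheaf_eq_tensor_of_stalks:
  fixes J :: "'a::field_char_0 point \<Rightarrow> 'a ratfun3 set"
  assumes fin: "finite I"
    and ideals: "\<And>p. p \<in> P2 \<Longrightarrow> trivial_tensor (structure_sheaf p) I (\<lambda>i. Js i p)"
    and stalk: "\<And>p. p \<in> P2 \<Longrightarrow> trivial_tensor.trivial_except (structure_sheaf p) I (\<lambda>i. Js i p) (J p)"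
    and opn: "\<And>i. i \<in> I \<Longrightarrow> zariski_open {p \<in> P2. Js i p = structure_sheaf p}"
  shows "ideal_sheaf_eq_tensor J I Js"
proof -
  let ?F = "\<lambda>p. formal_tensors (structure_sheaf p) I (\<lambda>i. Js i p)"
  let ?cl = "\<lambda>p t. tensor_rel (structure_sheaf p) I (\<lambda>i. Js i p) `` {t}"
  let ?FV = "\<lambda>V. formal_tensors (sections_over V structure_sheaf) I (\<lambda>i. sections_over V (Js i))"
  note cls = trivial_tensor.tensor_class[OF ideals stalk]
  note mlt = trivial_tensor.tensor_mult_class[OF ideals stalk]
  note vals = trivial_tensor.formal_tensor_values(1)[OF ideals stalk]
  have prod: "\<exists>t\<in>?F p. T = ?cl p t" if "T \<in> tensor_product (structure_sheaf p) I (\<lambda>i. Js i p)" for T p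
    using that unfolding tensor_product_def by (elim quotientE) blast
  have except: "(I = {} \<and> J p = structure_sheaf p) \<or>
      (\<exists>i0\<in>I. J p = Js i0 p \<and> (\<forall>i\<in>I. i \<noteq> i0 \<longrightarrow> Js i p = structure_sheaf p))" if "p \<in> P2" for p
    using stalk[OF that] unfolding trivial_tensor.trivial_except_def[OF ideals[OF that]] .
  have ex_local: "\<exists>V. zariski_open V \<and> p \<in> V \<and> V \<subseteq> U \<and> (\<exists>t\<in>?FV V. formal_mult I t = h)"
    if U: "zariski_open U" and h: "h \<in> sections_over U J" and p: "p \<in> U" for U h p
  proof -
    have UP: "U \<subseteq> P2" using U by (rule zariski_open_subset)
    have hJ: "h \<in> J q" if "q \<in> U" for q using h that by (auto simp: sections_over_def)
    from except[of p] p UP have "(I = {} \<and> J p = structure_sheaf p) \<or>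
      (\<exists>i0\<in>I. J p = Js i0 p \<and> (\<forall>i\<in>I. i \<noteq> i0 \<longrightarrow> Js i p = structure_sheaf p))" by blast
    then show ?thesis
    proof (elim disjE conjE bexE)
      assume I: "I = {}"
      have "h \<in> sections_over U structure_sheaf"
        using except hJ UP I unfolding sections_over_def by blast
      then have R: "h \<in> sections_over U structure_sheaf" "0 \<in> sections_over U structure_sheaf"
        using ideals UP by (auto simp: sections_over_def trivial_tensor_def)
      obtain e where e: "e \<in> (\<Pi>\<^sub>E i\<in>I. sections_over U (Js i))" unfolding I by simp
      have "Poly_Mapping.single e h \<in> ?FV U"
        unfolding formal_tensors_def using R e by (auto simp: lookup_single when_def)
      moreover have "formal_mult I (Poly_Mapping.single e h) = h" by (simp add: formal_mult_single I)
      ultimately show ?thesis using U p by blast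
    next
      fix i0 assume e: "i0 \<in> I" "\<forall>i\<in>I. i \<noteq> i0 \<longrightarrow> Js i p = structure_sheaf p"
      \<comment> \<open>On \<open>V\<close> all ideals except that of \<open>i0\<close> are trivial,
        so the pure tensor with \<open>h\<close> in position \<open>i0\<close> represents
        \<open>h\<close> on all of \<open>V\<close>.\<close>
      define V where "V = U \<inter> (P2 \<inter> (\<Inter>i\<in>I - {i0}. {q \<in> P2. Js i q = structure_sheaf q}))"
      have V: "zariski_open V" "p \<in> V" "V \<subseteq> U"
        unfolding V_def using U p UP e fin opn
        by (auto intro!: zariski_open_Int zariski_open_INT)
      have VR: "Js i q = structure_sheaf q" if "q \<in> V" "i \<in> I" "i \<noteq> i0" for i q
        using that by (auto simp: V_def)
      \<comment> \<open>The exceptional index \<open>i1\<close> at \<open>q\<close> may differ from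
        \<open>i0\<close>; then all the ideals are trivial at \<open>q\<close> and agree.\<close>
      have VJ: "J q = Js i0 q" if q: "q \<in> V" for q
      proof -
        have "q \<in> P2" using q by (simp add: V_def)
        from except[OF this] e(1) obtain i1 where i1: "i1 \<in> I" "J q = Js i1 q"
          "\<forall>i\<in>I. i \<noteq> i1 \<longrightarrow> Js i q = structure_sheaf q" by blast
        show ?thesis
        proof (cases "i1 = i0")
          case False
          with VR[OF q i1(1)] i1 e(1) show ?thesis by simp
        qed (simp add: i1)
      qed
      define x where "x = (\<lambda>i. if i = i0 then h else if i \<in> I then 1 else undefined)"
      have ring: "0 \<in> structure_sheaf q" "1 \<in> structure_sheaf q" if "q \<in> V" for q
        using ideals[of q] that UP V(3) by (auto simp: trivial_tensor_def)
      have "x \<in> (\<Pi>\<^sub>E i\<in>I. sections_over V (Js i))"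
      proof (rule PiE_I)
        fix i assume i: "i \<in> I"
        have "x i \<in> Js i q" if q: "q \<in> V" for q
        proof (cases "i = i0")
          case True
          then show ?thesis using hJ[of q] VJ[OF q] V(3) q by (auto simp: x_def)
        next
          case False
          then show ?thesis using VR[OF q i] ring[OF q] i by (simp add: x_def)
        qed
        then show "x i \<in> sections_over V (Js i)" by (auto simp: sections_over_def)
      qed (use e in \<open>auto simp: x_def\<close>)
      moreover have "0 \<in> sections_over V structure_sheaf" "1 \<in> sections_over V structure_sheaf"
        using ring by (auto simp: sections_over_def)
      ultimately have "Poly_Mapping.single x 1 \<in> ?FV V"
        unfolding formal_tensors_def by (auto simp: lookup_single when_def)
      moreover have "formal_mult I (Poly_Mapping.single x 1) = h"
      proof -
        have "(\<Prod>i\<in>I. x i) = (\<Prod>i\<in>I. if i = i0 then h else 1)"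
          by (intro prod.cong) (auto simp: x_def)
        then show ?thesis using fin e(1) by (simp add: formal_mult_single)
      qed
      ultimately show ?thesis using V by blast
    qed
  qed
  have part1: "\<exists>h\<in>sections_over U J. \<forall>p\<in>U. tensor_mult I (\<sigma> p) = h"
    if U: "zariski_open U" "U \<noteq> {}" and \<sigma>: "\<sigma> \<in> tensor_sheaf_sections I Js U" for U \<sigma>
  proof -
    have UP: "U \<subseteq> P2" using U(1) by (rule zariski_open_subset)
    have loc: "\<exists>V. zariski_open V \<and> p \<in> V \<and> V \<subseteq> U \<and>
        (\<exists>c. \<forall>q\<in>V. tensor_mult I (\<sigma> q) = c \<and> c \<in> J q)" if p: "p \<in> U" for p
    proof -
      from \<sigma> p obtain V t where V: "zariski_open V" "p \<in> V" "V \<subseteq> U" "t \<in> ?FV V" "\<forall>q\<in>V. \<sigma> q = ?cl q t"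
        unfolding tensor_sheaf_sections_def by blast
      have "tensor_mult I (\<sigma> q) = formal_mult I t \<and> formal_mult I t \<in> J q" if q: "q \<in> V" for q
      proof -
        have qP: "q \<in> P2" using q V(3) UP by blast
        have t: "t \<in> ?F q" using formal_tensors_stalk[OF q] V(4) by blast
        have "\<sigma> q = ?cl q t" using V(5) q by blast
        then show ?thesis using mlt[OF qP qP t] vals[OF qP qP t] by simp
      qed
      with V(1-3) show ?thesis by blast
    qed
    obtain p0 where p0: "p0 \<in> U" using U(2) by blast
    let ?h = "tensor_mult I (\<sigma> p0)"
    have "tensor_mult I (\<sigma> p) = ?h \<and> ?h \<in> J p" if p: "p \<in> U" for p
    proof -
      from loc[OF p] obtain V c where V: "zariski_open V" "p \<in> V"
        "\<And>q. q \<in> V \<Longrightarrow> tensor_mult I (\<sigma> q) = c \<and> c \<in> J q" by blast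
      from loc[OF p0] obtain W d where W: "zariski_open W" "p0 \<in> W"
        "\<And>q. q \<in> W \<Longrightarrow> tensor_mult I (\<sigma> q) = d \<and> d \<in> J q" by blast
      have "V \<inter> W \<noteq> {}" using V(1,2) W(1,2) by (intro zariski_open_meet) auto
      then obtain q where "q \<in> V" "q \<in> W" by blast
      with V(3)[of q] W(3)[of q] have "c = d" by simp
      with V(3)[OF V(2)] W(3)[OF W(2)] show ?thesis by simp
    qed
    then show ?thesis by (intro bexI[of _ ?h]) (auto simp: sections_over_def)
  qed
  have part2: "\<exists>!\<sigma>. \<sigma> \<in> tensor_sheaf_sections I Js U \<and> (\<forall>p\<in>U. tensor_mult I (\<sigma> p) = h)"
    if U: "zariski_open U" and h: "h \<in> sections_over U J" for U h
  proof -
    have UP: "U \<subseteq> P2" using U by (rule zariski_open_subset)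
    \<comment> \<open>At each point the fibre of multiplication over \<open>h\<close>, which is a
      single class by \<open>tensor_class\<close>; this gives existence and uniqueness.\<close>
    define \<tau> where "\<tau> = (\<lambda>p\<in>U. {s \<in> ?F p. formal_mult I s = h})"
    have \<tau>_cl: "\<tau> q = ?cl q t" if "q \<in> U" "t \<in> ?F q" "formal_mult I t = h" for q t
    proof -
      have qP: "q \<in> P2" using that(1) UP by blast
      show ?thesis
        unfolding cls[OF qP qP that(2)] that(3) \<tau>_def by (rule restrict_apply'[OF that(1)])
    qed
    define good where "good t q \<longleftrightarrow> t \<in> ?F q \<and> \<tau> q = ?cl q t \<and> formal_mult I t = h" for t q
    have loc: "\<exists>V. zariski_open V \<and> p \<in> V \<and> V \<subseteq> U \<and> (\<exists>t\<in>?FV V. \<forall>q\<in>V. good t q)"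
      if p: "p \<in> U" for p
    proof -
      from ex_local[OF U h p] obtain V t where V: "zariski_open V" "p \<in> V" "V \<subseteq> U" "t \<in> ?FV V" "formal_mult I t = h"
        by blast
      have "good t q" if q: "q \<in> V" for q
      proof -
        have t: "t \<in> ?F q" using formal_tensors_stalk[OF q] V(4) by blast
        have "q \<in> U" using q V(3) by blast
        from t \<tau>_cl[OF this t V(5)] V(5) show ?thesis unfolding good_def by (intro conjI)
      qed
      with V(1-4) show ?thesis by blast
    qed
    have \<tau>_p: "\<exists>t. good t p" if "p \<in> U" for p
      using loc[OF that] by blast
    have "\<tau> \<in> tensor_sheaf_sections I Js U"
      unfolding tensor_sheaf_sections_def
    proof (intro CollectI conjI ballI PiE_I)
      fix p assume p: "p \<in> U"
      from \<tau>_p[OF p] obtain t where t: "good t p" ..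
      then show "\<tau> p \<in> tensor_product (structure_sheaf p) I (\<lambda>i. Js i p)"
        unfolding tensor_product_def good_def by (simp add: quotientI)
      from loc[OF p] obtain V t where "zariski_open V" "p \<in> V" "V \<subseteq> U" "t \<in> ?FV V" "\<forall>q\<in>V. good t q"
        by blast
      then show "\<exists>V. zariski_open V \<and> p \<in> V \<and> V \<subseteq> U \<and> (\<exists>t\<in>?FV V. \<forall>q\<in>V. \<tau> q = ?cl q t)"
        by (intro exI[of _ V] conjI bexI[of _ t]) (simp_all add: good_def)
    qed (simp add: \<tau>_def)
    moreover have "tensor_mult I (\<tau> p) = h" if p: "p \<in> U" for p
    proof -
      from \<tau>_p[OF p] obtain t where "good t p" ..
      then have t: "t \<in> ?F p" "\<tau> p = ?cl p t" "formal_mult I t = h" unfolding good_def by iprover+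
      have "p \<in> P2" using p UP by blast
      from mlt[OF this this t(1)] t show ?thesis by simp
    qed
    moreover have "\<sigma> = \<tau>"
      if \<sigma>: "\<sigma> \<in> tensor_sheaf_sections I Js U" "\<forall>p\<in>U. tensor_mult I (\<sigma> p) = h" for \<sigma>
    proof (rule ext)
      fix p
      show "\<sigma> p = \<tau> p"
      proof (cases "p \<in> U")
        case True
        then have pP: "p \<in> P2" using UP by blast
        have "\<sigma> p \<in> tensor_product (structure_sheaf p) I (\<lambda>i. Js i p)"
          using \<sigma>(1) True unfolding tensor_sheaf_sections_def by (auto simp: PiE_def)
        from prod[OF this] obtain t where t: "t \<in> ?F p" "\<sigma> p = ?cl p t" by blast
        have "formal_mult I t = h" using \<sigma>(2) True mlt[OF pP pP t(1)] t(2) by auto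
        from t(2) \<tau>_cl[OF True t(1) this, symmetric] show ?thesis by (rule trans)
      next
        case False
        have "\<sigma> \<in> extensional U" using \<sigma>(1) unfolding tensor_sheaf_sections_def PiE_def by blast
        with False show ?thesis by (simp add: \<tau>_def extensional_def)
      qed
    qed
    ultimately show ?thesis by (intro ex1I[of _ \<tau>]) blast+
  qed
  show ?thesis
    unfolding ideal_sheaf_eq_tensor_def
    by (intro allI impI conjI ballI; elim conjE) (rule part1, assumption+, rule part2, assumption+)
qed

text \<open>The stalk is the whole local ring exactly where some partial derivative does not
  vanish.\<close>

lemma jacobian_sheaf_unit_open:
  fixes F :: "'a::field_char_0 poly3"
  assumes F: "homogeneous n F" "n \<ge> 1"
  shows "zariski_open {p \<in> P2. jacobian_sheaf n F p = structure_sheaf p}"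
proof -
  let ?S = "{ddx F, ddy F, ddz F}"
  note d = homogeneous_dd[OF F(1)]
  have "jacobian_sheaf n F p = structure_sheaf p \<longleftrightarrow> (\<exists>G\<in>?S. \<not> vanishes_at G p)" if "p \<in> P2" for p
    using that
  proof (rule P2_representative)
    fix v assume v: "v \<noteq> 0" and tw: "\<And>a. twist a p = loc v a"
      and van: "\<And>d F. homogeneous d F \<Longrightarrow> vanishes_at F p \<longleftrightarrow> eval3 F v = 0"
    have "jacobian_sheaf n F p = structure_sheaf p \<longleftrightarrow> grad3 F v \<noteq> 0"
      unfolding jacobian_sheaf_eq[OF tw] tw using jacobian_unit[OF v F] jacobian_singular[OF F(1)] by blast
    also have "\<dots> \<longleftrightarrow> (\<exists>G\<in>?S. \<not> vanishes_at G p)"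
      using van[OF d(1)] van[OF d(2)] van[OF d(3)] by (auto simp: grad3_def zero_prod_def)
    finally show ?thesis .
  qed
  then have "{p \<in> P2. jacobian_sheaf n F p = structure_sheaf p} = {p \<in> P2. \<exists>G\<in>?S. \<not> vanishes_at G p}" by blast
  moreover have "\<forall>G\<in>?S. \<exists>d. homogeneous d G" using d by blast
  ultimately show ?thesis unfolding zariski_open_def by blast
qed

lemma jacobian_ideals_trivial_tensor:
  fixes F :: "'i \<Rightarrow> 'a::field_char_0 poly3"
  assumes "p \<in> P2" "finite I" and F: "\<And>i. i \<in> I \<Longrightarrow> homogeneous n (F i)" "n \<ge> 1"
  shows "trivial_tensor (structure_sheaf p) I (\<lambda>i. jacobian_sheaf n (F i) p)"
  using assms(1)
proof (rule P2_representative)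
  fix v assume v: "v \<noteq> 0" and tw: "\<And>a. twist a p = loc v a"
  show ?thesis
    unfolding tw jacobian_sheaf_eq[OF tw]
  proof
    show "x * y \<in> loc v 0" if "x \<in> loc v 0" "y \<in> loc v 0" for x y by (rule loc_mult[OF that]) simp
    show "(\<lambda>c. dot3 c (vgrad (F i))) ` vloc v (1 - int n) \<subseteq> loc v 0" if "i \<in> I" for i
      by (rule image_subsetI, rule loc_dot3[OF _ vloc_vgrad[OF F(1)[OF that] F(2) refl]], assumption) simp
    show "0 \<in> (\<lambda>c. dot3 c (vgrad (F i))) ` vloc v (1 - int n)" for i
      using v by (intro image_eqI[of _ _ "(0, 0, 0)"]) (simp_all add: vloc_def dot3_def vgrad_def)
    show "x + y \<in> (\<lambda>c. dot3 c (vgrad (F i))) ` vloc v (1 - int n)"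
      if "x \<in> (\<lambda>c. dot3 c (vgrad (F i))) ` vloc v (1 - int n)"
        "y \<in> (\<lambda>c. dot3 c (vgrad (F i))) ` vloc v (1 - int n)" for i x y
    proof -
      from that obtain c d where "c \<in> vloc v (1 - int n)" "d \<in> vloc v (1 - int n)"
        "x = dot3 c (vgrad (F i))" "y = dot3 d (vgrad (F i))" by blast
      then show ?thesis by (intro image_eqI[of _ _ "c + d"]) (simp_all add: dot3_add vloc_add)
    qed
    show "x * y \<in> (\<lambda>c. dot3 c (vgrad (F i))) ` vloc v (1 - int n)"
      if "x \<in> loc v 0" "y \<in> (\<lambda>c. dot3 c (vgrad (F i))) ` vloc v (1 - int n)" for i x y
    proof -
      from that(2) obtain c where c: "c \<in> vloc v (1 - int n)" "y = dot3 c (vgrad (F i))" by blast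
      have "smult3 x c \<in> vloc v (1 - int n)" by (rule vloc_smult[OF that(1) c(1)]) simp
      then show ?thesis using c(2) by (intro image_eqI[of _ _ "smult3 x c"]) (simp_all add: dot3_smult)
    qed
  qed (use v assms(2) in \<open>auto intro: loc_minus\<close>)
qed

theorem theorem2p10:
  fixes f0 g0 :: "'k::field_char_0 poly3"
    and f g :: "'k alg_closure poly3"
    and n k r m :: nat
    and q exc sing :: "nat \<Rightarrow> 'k alg_closure \<times> 'k alg_closure"
  assumes "f = base_change f0" and "g = base_change g0"
    and "n \<ge> 1" and "homogeneous n f" and "homogeneous n g"
    and "squarefree f" and "squarefree g"
    and "coprime f g"
    and "general_member_smooth f g"
    and all_reduced: "\<And>c. c \<noteq> (0, 0) \<Longrightarrow> squarefree (pencil_member f g c)"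
    and base_locus: "card {p \<in> P2. vanishes_at f p \<and> vanishes_at g p} = n\<^sup>2"
    \<comment> \<open>\<open>D\<^sup>s\<^sup>g\<close> is the union of the members with parameters \<open>sing 1, \<dots>, sing m\<close>\<close>
    and "distinct_params {1..m} sing"
    and all_singular: "\<And>c. c \<noteq> (0, 0) \<Longrightarrow>
          singular_curve (pencil_member f g c) \<longleftrightarrow> (\<exists>i\<in>{1..m}. same_param c (sing i))"
    and "locally_complete_intersection (jacobian_sheaf (m * n) (union_of_members f g {1..m} sing))"
    \<comment> \<open>\<open>D\<^sub>k\<close> is the union of the members with parameters \<open>q 1, \<dots>, q k\<close>\<close>
    and "k \<ge> 2" and "distinct_params {1..k} q"
    \<comment> \<open>\<open>exc 1, \<dots>, exc r\<close> are the parameters of the singular members not contained in \<open>D\<^sub>k\<close>\<close>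
    and "distinct_params {1..r} exc"
    and exceptions: "\<And>c. c \<noteq> (0, 0) \<Longrightarrow>
          (\<exists>i\<in>{1..r}. same_param c (exc i)) \<longleftrightarrow>
          singular_curve (pencil_member f g c) \<and> \<not> (\<exists>j\<in>{1..k}. same_param c (q j))"
  shows "ideal_sheaf_eq_tensor
           (zero_scheme_sheaf (union_of_members f g {1..k} q) (2 * int n - 2) (gradient_wedge f g))
           {1..r} (\<lambda>i. jacobian_sheaf n (pencil_member f g (exc i)))"
proof -
  let ?J = "\<lambda>i. jacobian_sheaf n (pencil_member f g (exc i))"
  let ?Z = "zero_scheme_sheaf (union_of_members f g {1..k} q) (2 * int n - 2) (gradient_wedge f g)"
  note n = \<open>n \<ge> 1\<close> and f = \<open>homogeneous n f\<close> and g = \<open>homogeneous n g\<close>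
  have lci: "locally_complete_intersection
      (jacobian_sheaf (card {1..m} * n) (union_of_members f g {1..m} sing))"
    using assms(14) by simp
  have K: "{1..k} \<noteq> {}" using \<open>k \<ge> 2\<close> by simp
  have ideals: "trivial_tensor (structure_sheaf p) {1..r} (\<lambda>i. ?J i p)" if "p \<in> P2" for p
    by (rule jacobian_ideals_trivial_tensor[OF that _ homogeneous_pencil_member[OF f g] n]) simp
  show ?thesis
  proof (rule ideal_sheaf_eq_tensor_of_stalks[OF finite_atLeastAtMost ideals])
    fix p :: "'k alg_closure point" assume p: "p \<in> P2"
    note stalk = zero_scheme_stalk[OF n f g \<open>coprime f g\<close> all_reduced base_locus finite_atLeastAtMost
        \<open>distinct_params {1..m} sing\<close> all_singular lci finite_atLeastAtMost K \<open>distinct_params {1..k} q\<close>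
        \<open>distinct_params {1..r} exc\<close> exceptions p]
    \<comment> \<open>If all ideals are trivial at \<open>p\<close>, any index can play the role of
      \<open>i0\<close>; for \<open>r = 0\<close> the separate alternative of
      \<open>trivial_except\<close> applies.\<close>
    then show "trivial_tensor.trivial_except (structure_sheaf p) {1..r} (\<lambda>i. ?J i p) (?Z p)"
      unfolding trivial_tensor.trivial_except_def[OF ideals[OF p]] by (cases "{1..r} = {}") blast+
  next
    fix i
    show "zariski_open {p \<in> P2. ?J i p = structure_sheaf p}"
      by (rule jacobian_sheaf_unit_open[OF homogeneous_pencil_member[OF f g] n])
  qed
qed

end
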